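(* Let $\rho\in\mathcal P^\infty_+(M)$. The operator $K^S_\rho f=-\operatorname{div}(\rho I_\rho^*\operatorname{grad}f)$, $f\in C^\infty(M)$, extends uniquely to an isometric isomorphism $$K^S_\rho:T^*_{\rho,S}\to T_{\rho,S}.$$ Its minimum norm velocity representative is $B^S_\rho f=I_\rho^*\operatorname{grad}f$ (that is, $I_\rho^*\operatorname{grad}f$ is the element of least $\mathcal H_k$-norm among $v\in\mathcal H_k$ with $-\operatorname{div}(\rho v)=K^S_\rho f$), and regular covectors $f,h\in C^\infty(M)$ satisfy $$\langle f,K^S_\rho h\rangle=\langle f,h\rangle_{T^*_{\rho,S}}.$$
   Context: $M$ is a connected, closed, oriented Riemannian manifold with metric $g$ and volume $\mathrm{vol}$; $\mathcal P^\infty_+(M)$ is the set of smooth strictly positive $\rho$ with $\int_M\rho\,d\mathrm{vol}=1$. $k$ is a smooth positive definite kernel on $TM$: $k(x,y):T_xM\to T_yM$ linear, $k(y,x)=k(x,y)^*$, $\sum_{i,j}\langle k(x_i,x_j)\xi_i,\xi_j\rangle_g\ge0$ for all finite families $x_i\in M$, $\xi_i\in T_{x_i}M$. $\mathcal H_k$ is the associated Hilbert space of vector fields, with $\langle v,k(x,\cdot)\xi\rangle_{\mathcal H_k}=\langle v(x),\xi\rangle_g$, assumed continuously included in $C^1(M;TM)$. $I_\rho:\mathcal H_k\to L^2(\rho;TM)$ is the inclusion, where $L^2(\rho;TM)$ has inner product $\int_M\langle u,v\rangle_g\rho\,d\mathrm{vol}$, and $I_\rho^*$ its Hilbert adjoint.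 $T_{\rho,S}=\{-\operatorname{div}(\rho v):v\in\mathcal H_k\}$ with norm $\|\sigma\|_{T_{\rho,S}}=\inf\{\|v\|_{\mathcal H_k}:-\operatorname{div}(\rho v)=\sigma\}$. $T^*_{\rho,S}$ is the Hilbert space obtained from $C^\infty(M)$ with the form $\langle f,h\rangle_{T^*_{\rho,S}}=\langle I_\rho^*\operatorname{grad}f,I_\rho^*\operatorname{grad}h\rangle_{\mathcal H_k}$ by quotienting by $\{f:I_\rho^*\operatorname{grad}f=0\}$ and completing. The pairing is $\langle f,\sigma\rangle=\int_M f\sigma\,d\mathrm{vol}$. *)

theory Defs
  imports "HOL-Analysis.Analysis" "HOL-Library.Function_Algebras"
begin

section \<open>Pointwise vector space structure on functions\<close>

instantiation "fun" :: (type, real_vector) real_vector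
begin

definition scaleR_fun :: "real \<Rightarrow> ('a \<Rightarrow> 'b) \<Rightarrow> 'a \<Rightarrow> 'b"
  where "scaleR_fun a f = (\<lambda>x. a *\<^sub>R f x)"

instance
  by standard
    (simp_all add: scaleR_fun_def plus_fun_def fun_eq_iff scaleR_add_right scaleR_add_left)

end


section \<open>Inner products on subsets of a vector space, completion, adjoint\<close>

definition semi_norm :: "('a \<Rightarrow> 'a \<Rightarrow> real) \<Rightarrow> 'a \<Rightarrow> real"
  where "semi_norm b x = sqrt (b x x)"

definition inner_product_on :: "'a::real_vector set \<Rightarrow> ('a \<Rightarrow> 'a \<Rightarrow> real) \<Rightarrow> bool" where
  "inner_product_on V b \<longleftrightarrow>
     (\<forall>x\<in>V. \<forall>y\<in>V. b x y = b y x) \<and>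
     (\<forall>x\<in>V. \<forall>y\<in>V. \<forall>z\<in>V. b (x + y) z = b x z + b y z) \<and>
     (\<forall>a. \<forall>x\<in>V. \<forall>y\<in>V. b (a *\<^sub>R x) y = a * b x y) \<and>
     (\<forall>x\<in>V. x \<noteq> 0 \<longrightarrow> 0 < b x x)"

definition cauchy_seqs :: "'a::real_vector set \<Rightarrow> ('a \<Rightarrow> 'a \<Rightarrow> real) \<Rightarrow> (nat \<Rightarrow> 'a) set" where
  "cauchy_seqs V b =
     {X. (\<forall>n. X n \<in> V) \<and>
         (\<forall>e>0. \<exists>N. \<forall>m\<ge>N. \<forall>n\<ge>N. semi_norm b (X m - X n) < e)}"

definition hilbert_space_on :: "'a::real_vector set \<Rightarrow> ('a \<Rightarrow> 'a \<Rightarrow> real) \<Rightarrow> bool" where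
  "hilbert_space_on H ip \<longleftrightarrow>
     subspace H \<and> inner_product_on H ip \<and>
     (\<forall>X\<in>cauchy_seqs H ip. \<exists>x\<in>H. (\<lambda>n. semi_norm ip (X n - x)) \<longlonglongrightarrow> 0)"

text \<open>
  The Hilbert space obtained from a vector space \<open>V\<close> with a positive semidefinite form \<open>b\<close>:
  Cauchy sequences modulo sequences at distance tending to 0.  Two constant sequences
  \<open>x\<close>, \<open>y\<close> are identified iff \<open>b (x - y) (x - y) = 0\<close>, so that the
  quotient by the null space of \<open>b\<close> and the completion are performed in one step.
\<close>

definition completion_rel ::
    "'a::real_vector set \<Rightarrow> ('a \<Rightarrow> 'a \<Rightarrow> real) \<Rightarrow> ((nat \<Rightarrow> 'a) \<times> (nat \<Rightarrow> 'a)) set" where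
  "completion_rel V b =
     {(X, Y). X \<in> cauchy_seqs V b \<and> Y \<in> cauchy_seqs V b \<and>
              (\<lambda>n. semi_norm b (X n - Y n)) \<longlonglongrightarrow> 0}"

definition hilbert_completion ::
    "'a::real_vector set \<Rightarrow> ('a \<Rightarrow> 'a \<Rightarrow> real) \<Rightarrow> (nat \<Rightarrow> 'a) set set" where
  "hilbert_completion V b = cauchy_seqs V b // completion_rel V b"

definition completion_embed ::
    "'a::real_vector set \<Rightarrow> ('a \<Rightarrow> 'a \<Rightarrow> real) \<Rightarrow> 'a \<Rightarrow> (nat \<Rightarrow> 'a) set" where
  "completion_embed V b x = completion_rel V b `` {\<lambda>_. x}"

definition completion_add ::
    "'a::real_vector set \<Rightarrow> ('a \<Rightarrow> 'a \<Rightarrow> real) \<Rightarrow>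
     (nat \<Rightarrow> 'a) set \<Rightarrow> (nat \<Rightarrow> 'a) set \<Rightarrow> (nat \<Rightarrow> 'a) set" where
  "completion_add V b P Q = (\<Union>X\<in>P. \<Union>Y\<in>Q. completion_rel V b `` {\<lambda>n. X n + Y n})"

definition completion_scale ::
    "'a::real_vector set \<Rightarrow> ('a \<Rightarrow> 'a \<Rightarrow> real) \<Rightarrow> real \<Rightarrow> (nat \<Rightarrow> 'a) set \<Rightarrow> (nat \<Rightarrow> 'a) set" where
  "completion_scale V b a P = (\<Union>X\<in>P. completion_rel V b `` {\<lambda>n. a *\<^sub>R X n})"

definition completion_inner ::
    "('a::real_vector \<Rightarrow> 'a \<Rightarrow> real) \<Rightarrow> (nat \<Rightarrow> 'a) set \<Rightarrow> (nat \<Rightarrow> 'a) set \<Rightarrow> real" where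
  "completion_inner b P Q = (THE r. \<forall>X\<in>P. \<forall>Y\<in>Q. (\<lambda>n. b (X n) (Y n)) \<longlonglongrightarrow> r)"

definition hilbert_adjoint ::
    "'a set \<Rightarrow> ('a \<Rightarrow> 'a \<Rightarrow> real) \<Rightarrow> 'b set \<Rightarrow> ('b \<Rightarrow> 'b \<Rightarrow> real) \<Rightarrow> ('a \<Rightarrow> 'b) \<Rightarrow> 'b \<Rightarrow> 'a" where
  "hilbert_adjoint H ipH L ipL T =
     (\<lambda>u\<in>L. THE w. w \<in> H \<and> (\<forall>v\<in>H. ipH w v = ipL u (T v)))"


section \<open>Smooth maps on open subsets of Euclidean spaces\<close>

fun Ck_on :: "nat \<Rightarrow> ('a::euclidean_space \<Rightarrow> 'b::euclidean_space) \<Rightarrow> 'a set \<Rightarrow> bool" where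
  "Ck_on 0 f S \<longleftrightarrow> continuous_on S f"
| "Ck_on (Suc k) f S \<longleftrightarrow>
     (\<forall>x\<in>S. f differentiable (at x)) \<and>
     (\<forall>w. Ck_on k (\<lambda>x. frechet_derivative f (at x) w) S)"

definition smooth_on :: "('a::euclidean_space \<Rightarrow> 'b::euclidean_space) \<Rightarrow> 'a set \<Rightarrow> bool"
  where "smooth_on f S \<longleftrightarrow> (\<forall>k. Ck_on k f S)"


section \<open>Oriented smooth manifolds\<close>

text \<open>
  A chart is a pair of its domain and its coordinate map (only the values on the domain
  matter).  The points of the manifold are all elements of the type \<open>'m\<close>.
\<close>

type_synonym ('m, 'n) chart = "'m set \<times> ('m \<Rightarrow> real ^ 'n)"

abbreviation dom_of :: "('m, 'n::finite) chart \<Rightarrow> 'm set" where "dom_of c \<equiv> fst c"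
abbreviation coord :: "('m, 'n::finite) chart \<Rightarrow> 'm \<Rightarrow> real ^ 'n" where "coord c \<equiv> snd c"
abbreviation img_of :: "('m, 'n::finite) chart \<Rightarrow> (real ^ 'n) set" where "img_of c \<equiv> snd c ` fst c"

definition chart_inv :: "('m, 'n::finite) chart \<Rightarrow> real ^ 'n \<Rightarrow> 'm"
  where "chart_inv c = inv_into (dom_of c) (coord c)"

definition transition ::
    "('m, 'n::finite) chart \<Rightarrow> ('m, 'n) chart \<Rightarrow> real ^ 'n \<Rightarrow> real ^ 'n"
  where "transition c d = coord d \<circ> chart_inv c"

definition is_chart :: "('m::topological_space, 'n::finite) chart \<Rightarrow> bool" where
  "is_chart c \<longleftrightarrow> open (dom_of c) \<and> open (img_of c) \<and>
     homeomorphism (dom_of c) (img_of c) (coord c) (chart_inv c)"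

text \<open>
  The orientation is encoded in the atlas: all transition maps have positive Jacobian determinant.
\<close>

definition oriented_atlas :: "('m::topological_space, 'n::finite) chart set \<Rightarrow> bool" where
  "oriented_atlas A \<longleftrightarrow>
     (\<forall>c\<in>A. is_chart c) \<and> (\<Union>c\<in>A. dom_of c) = UNIV \<and>
     (\<forall>c\<in>A. \<forall>d\<in>A. smooth_on (transition c d) (coord c ` (dom_of c \<inter> dom_of d)) \<and>
        (\<forall>x\<in>dom_of c \<inter> dom_of d.
           0 < det (matrix (frechet_derivative (transition c d) (at (coord c x))))))"

definition smooth_functions :: "('m, 'n::finite) chart set \<Rightarrow> ('m \<Rightarrow> real) set" where
  "smooth_functions A = {f. \<forall>c\<in>A. smooth_on (f \<circ> chart_inv c) (img_of c)}"

text \<open>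
  A tangent vector at \<open>x\<close> is a family of coordinate vectors, one for each chart of the
  atlas around \<open>x\<close>, related by the derivatives of the transition maps.
  The value at irrelevant charts is set to 0, so that equality of tangent vectors is
  equality of functions.
\<close>

type_synonym ('m, 'n) tvec = "('m, 'n) chart \<Rightarrow> real ^ 'n"

definition tangent_space :: "('m, 'n::finite) chart set \<Rightarrow> 'm \<Rightarrow> ('m, 'n) tvec set" where
  "tangent_space A x =
     {\<xi>. (\<forall>c\<in>A. \<forall>d\<in>A. x \<in> dom_of c \<longrightarrow> x \<in> dom_of d \<longrightarrow>
            \<xi> d = frechet_derivative (transition c d) (at (coord c x)) (\<xi> c)) \<and>
         (\<forall>c. \<not> (c \<in> A \<and> x \<in> dom_of c) \<longrightarrow> \<xi> c = 0)}"

text \<open>The tangent vector at \<open>x\<close> with coordinates \<open>w\<close> in the chart \<open>c\<close>:\<close>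

definition coord_vec ::
    "('m, 'n::finite) chart set \<Rightarrow> ('m, 'n) chart \<Rightarrow> 'm \<Rightarrow> real ^ 'n \<Rightarrow> ('m, 'n) tvec" where
  "coord_vec A c x w =
     (\<lambda>d. if d \<in> A \<and> x \<in> dom_of d
          then frechet_derivative (transition c d) (at (coord c x)) w else 0)"

definition vector_fields :: "('m, 'n::finite) chart set \<Rightarrow> ('m \<Rightarrow> ('m, 'n) tvec) set" where
  "vector_fields A = {v. \<forall>x. v x \<in> tangent_space A x}"

definition local_rep ::
    "('m, 'n::finite) chart \<Rightarrow> ('m \<Rightarrow> ('m, 'n) tvec) \<Rightarrow> real ^ 'n \<Rightarrow> real ^ 'n" where
  "local_rep c v = (\<lambda>y. v (chart_inv c y) c)"

definition C1_vector_fields :: "('m, 'n::finite) chart set \<Rightarrow> ('m \<Rightarrow> ('m, 'n) tvec) set" where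
  "C1_vector_fields A = {v \<in> vector_fields A. \<forall>c\<in>A. Ck_on 1 (local_rep c v) (img_of c)}"


section \<open>Riemannian geometry\<close>

type_synonym ('m, 'n) metric = "'m \<Rightarrow> ('m, 'n) tvec \<Rightarrow> ('m, 'n) tvec \<Rightarrow> real"

definition gram ::
    "('m, 'n::finite) chart set \<Rightarrow> ('m, 'n) metric \<Rightarrow> ('m, 'n) chart \<Rightarrow> 'm \<Rightarrow> real ^ 'n ^ 'n" where
  "gram A g c x = (\<chi> i j. g x (coord_vec A c x (axis i 1)) (coord_vec A c x (axis j 1)))"

definition vol_density ::
    "('m, 'n::finite) chart set \<Rightarrow> ('m, 'n) metric \<Rightarrow> ('m, 'n) chart \<Rightarrow> 'm \<Rightarrow> real" where
  "vol_density A g c x = sqrt (det (gram A g c x))"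

definition riemannian_metric :: "('m, 'n::finite) chart set \<Rightarrow> ('m, 'n) metric \<Rightarrow> bool" where
  "riemannian_metric A g \<longleftrightarrow>
     (\<forall>x. inner_product_on (tangent_space A x) (g x)) \<and>
     (\<forall>c\<in>A. \<forall>i j. smooth_on (\<lambda>y. gram A g c (chart_inv c y) $ i $ j) (img_of c))"

text \<open>
  The Riemannian volume is the unique Borel measure that has density \<open>sqrt (det g\<^sub>i\<^sub>j)\<close>
  with respect to Lebesgue measure in every chart.
\<close>

definition riemannian_volume ::
    "('m::topological_space, 'n::finite) chart set \<Rightarrow> ('m, 'n) metric \<Rightarrow> 'm measure \<Rightarrow> bool" where
  "riemannian_volume A g vol \<longleftrightarrow>
     sets vol = sets borel \<and>
     (\<forall>c\<in>A. \<forall>B\<in>sets borel. B \<subseteq> dom_of c \<longrightarrow>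
        emeasure vol B =
          (\<integral>\<^sup>+ y. ennreal (vol_density A g c (chart_inv c y)) * indicator (coord c ` B) y \<partial>lborel))"

definition grad ::
    "('m, 'n::finite) chart set \<Rightarrow> ('m, 'n) metric \<Rightarrow> ('m \<Rightarrow> real) \<Rightarrow> 'm \<Rightarrow> ('m, 'n) tvec" where
  "grad A g f x =
     (THE \<xi>. \<xi> \<in> tangent_space A x \<and>
        (\<forall>\<eta>\<in>tangent_space A x. \<forall>c\<in>A. x \<in> dom_of c \<longrightarrow>
           g x \<xi> \<eta> = frechet_derivative (f \<circ> chart_inv c) (at (coord c x)) (\<eta> c)))"

text \<open>
  The divergence, with \<open>J = sqrt (det g\<^sub>i\<^sub>j)\<close>, is \<open>J\<inverse> \<Sum>\<^sub>i \<partial>\<^sub>i (J v\<^sup>i)\<close> in every chart.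
\<close>

definition divergence ::
    "('m, 'n::finite) chart set \<Rightarrow> ('m, 'n) metric \<Rightarrow> ('m \<Rightarrow> ('m, 'n) tvec) \<Rightarrow> 'm \<Rightarrow> real" where
  "divergence A g v x =
     (THE r. \<forall>c\<in>A. x \<in> dom_of c \<longrightarrow>
        r = (\<Sum>i\<in>UNIV. frechet_derivative
               (\<lambda>y. vol_density A g c (chart_inv c y) * local_rep c v y $ i)
               (at (coord c x)) (axis i 1)) / vol_density A g c x)"

definition smooth_pos_densities ::
    "('m, 'n::finite) chart set \<Rightarrow> 'm measure \<Rightarrow> ('m \<Rightarrow> real) set" where
  "smooth_pos_densities A vol =
     {\<rho> \<in> smooth_functions A. (\<forall>x. 0 < \<rho> x) \<and> (\<integral>x. \<rho> x \<partial>vol) = 1}"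


section \<open>Kernels on the tangent bundle and their Hilbert spaces\<close>

type_synonym ('m, 'n) tkernel = "'m \<Rightarrow> 'm \<Rightarrow> ('m, 'n) tvec \<Rightarrow> ('m, 'n) tvec"

definition smooth_pos_def_kernel ::
    "('m, 'n::finite) chart set \<Rightarrow> ('m, 'n) metric \<Rightarrow> ('m, 'n) tkernel \<Rightarrow> bool" where
  "smooth_pos_def_kernel A g k \<longleftrightarrow>
     (\<forall>x y. \<forall>\<xi>\<in>tangent_space A x. k x y \<xi> \<in> tangent_space A y) \<and>
     (\<forall>x y. \<forall>\<xi>\<in>tangent_space A x. \<forall>\<eta>\<in>tangent_space A x. k x y (\<xi> + \<eta>) = k x y \<xi> + k x y \<eta>) \<and>
     (\<forall>x y a. \<forall>\<xi>\<in>tangent_space A x. k x y (a *\<^sub>R \<xi>) = a *\<^sub>R k x y \<xi>) \<and>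
     (\<forall>c\<in>A. \<forall>d\<in>A. \<forall>w.
        smooth_on (\<lambda>(p, q). k (chart_inv c p) (chart_inv d q) (coord_vec A c (chart_inv c p) w) d)
          (img_of c \<times> img_of d)) \<and>
     (\<forall>x y. \<forall>\<xi>\<in>tangent_space A x. \<forall>\<eta>\<in>tangent_space A y. g x (k y x \<eta>) \<xi> = g y \<eta> (k x y \<xi>)) \<and>
     (\<forall>N::nat. \<forall>x \<xi>. (\<forall>i<N. \<xi> i \<in> tangent_space A (x i)) \<longrightarrow>
        0 \<le> (\<Sum>i<N. \<Sum>j<N. g (x j) (k (x i) (x j) (\<xi> i)) (\<xi> j)))"

definition rkhs_of_kernel ::
    "('m, 'n::finite) chart set \<Rightarrow> ('m, 'n) metric \<Rightarrow> ('m, 'n) tkernel \<Rightarrow>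
     ('m \<Rightarrow> ('m, 'n) tvec) set \<Rightarrow>
     (('m \<Rightarrow> ('m, 'n) tvec) \<Rightarrow> ('m \<Rightarrow> ('m, 'n) tvec) \<Rightarrow> real) \<Rightarrow> bool" where
  "rkhs_of_kernel A g k H ip \<longleftrightarrow>
     hilbert_space_on H ip \<and> H \<subseteq> vector_fields A \<and>
     (\<forall>x. \<forall>\<xi>\<in>tangent_space A x.
        (\<lambda>y. k x y \<xi>) \<in> H \<and> (\<forall>v\<in>H. ip v (\<lambda>y. k x y \<xi>) = g x (v x) \<xi>))"

text \<open>
  The topology of the space of \<open>C\<^sup>1\<close> vector fields is given by the suprema of the
  components and their first derivatives over compact subsets of chart domains.
\<close>

definition continuously_included_in_C1 ::
    "('m::topological_space, 'n::finite) chart set \<Rightarrow> ('m \<Rightarrow> ('m, 'n) tvec) set \<Rightarrow>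
     (('m \<Rightarrow> ('m, 'n) tvec) \<Rightarrow> ('m \<Rightarrow> ('m, 'n) tvec) \<Rightarrow> real) \<Rightarrow> bool" where
  "continuously_included_in_C1 A H ip \<longleftrightarrow>
     H \<subseteq> C1_vector_fields A \<and>
     (\<forall>c\<in>A. \<forall>S. compact S \<longrightarrow> S \<subseteq> dom_of c \<longrightarrow>
        (\<exists>C. \<forall>v\<in>H. \<forall>x\<in>S.
           norm (v x c) \<le> C * semi_norm ip v \<and>
           onorm (frechet_derivative (local_rep c v) (at (coord c x))) \<le> C * semi_norm ip v))"

text \<open>Elements of \<open>L\<^sup>2(\<rho>; TM)\<close> are handled through representatives.\<close>

definition L2_inner ::
    "('m, 'n::finite) metric \<Rightarrow> 'm measure \<Rightarrow> ('m \<Rightarrow> real) \<Rightarrow>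
     ('m \<Rightarrow> ('m, 'n) tvec) \<Rightarrow> ('m \<Rightarrow> ('m, 'n) tvec) \<Rightarrow> real" where
  "L2_inner g vol \<rho> u v = (\<integral>x. g x (u x) (v x) * \<rho> x \<partial>vol)"

definition L2_vector_fields ::
    "('m::topological_space, 'n::finite) chart set \<Rightarrow> ('m, 'n) metric \<Rightarrow> 'm measure \<Rightarrow> ('m \<Rightarrow> real) \<Rightarrow>
     ('m \<Rightarrow> ('m, 'n) tvec) set" where
  "L2_vector_fields A g vol \<rho> =
     {u \<in> vector_fields A.
        (\<forall>c\<in>A. (\<lambda>x. u x c) \<in> borel_measurable (restrict_space borel (dom_of c))) \<and>
        integrable vol (\<lambda>x. g x (u x) (u x) * \<rho> x)}"

definition I_adj ::
    "('m::topological_space, 'n::finite) chart set \<Rightarrow> ('m, 'n) metric \<Rightarrow> 'm measure \<Rightarrow>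
     ('m \<Rightarrow> ('m, 'n) tvec) set \<Rightarrow>
     (('m \<Rightarrow> ('m, 'n) tvec) \<Rightarrow> ('m \<Rightarrow> ('m, 'n) tvec) \<Rightarrow> real) \<Rightarrow> ('m \<Rightarrow> real) \<Rightarrow>
     ('m \<Rightarrow> ('m, 'n) tvec) \<Rightarrow> 'm \<Rightarrow> ('m, 'n) tvec" where
  "I_adj A g vol H ip \<rho> =
     hilbert_adjoint H ip (L2_vector_fields A g vol \<rho>) (L2_inner g vol \<rho>) (\<lambda>v. v)"


section \<open>Tangent and cotangent spaces of the space of densities\<close>

definition continuity_op ::
    "('m, 'n::finite) chart set \<Rightarrow> ('m, 'n) metric \<Rightarrow> ('m \<Rightarrow> real) \<Rightarrow>
     ('m \<Rightarrow> ('m, 'n) tvec) \<Rightarrow> 'm \<Rightarrow> real" where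
  "continuity_op A g \<rho> v = - divergence A g (\<lambda>x. \<rho> x *\<^sub>R v x)"

definition T_S ::
    "('m, 'n::finite) chart set \<Rightarrow> ('m, 'n) metric \<Rightarrow> ('m \<Rightarrow> ('m, 'n) tvec) set \<Rightarrow> ('m \<Rightarrow> real) \<Rightarrow>
     ('m \<Rightarrow> real) set" where
  "T_S A g H \<rho> = {continuity_op A g \<rho> v |v. v \<in> H}"

definition T_S_norm ::
    "('m, 'n::finite) chart set \<Rightarrow> ('m, 'n) metric \<Rightarrow> ('m \<Rightarrow> ('m, 'n) tvec) set \<Rightarrow>
     (('m \<Rightarrow> ('m, 'n) tvec) \<Rightarrow> ('m \<Rightarrow> ('m, 'n) tvec) \<Rightarrow> real) \<Rightarrow> ('m \<Rightarrow> real) \<Rightarrow>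
     ('m \<Rightarrow> real) \<Rightarrow> real" where
  "T_S_norm A g H ip \<rho> \<sigma> = Inf {semi_norm ip v |v. v \<in> H \<and> continuity_op A g \<rho> v = \<sigma>}"

definition B_S ::
    "('m::topological_space, 'n::finite) chart set \<Rightarrow> ('m, 'n) metric \<Rightarrow> 'm measure \<Rightarrow>
     ('m \<Rightarrow> ('m, 'n) tvec) set \<Rightarrow>
     (('m \<Rightarrow> ('m, 'n) tvec) \<Rightarrow> ('m \<Rightarrow> ('m, 'n) tvec) \<Rightarrow> real) \<Rightarrow> ('m \<Rightarrow> real) \<Rightarrow>
     ('m \<Rightarrow> real) \<Rightarrow> 'm \<Rightarrow> ('m, 'n) tvec" where
  "B_S A g vol H ip \<rho> f = I_adj A g vol H ip \<rho> (grad A g f)"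

definition cotangent_form ::
    "('m::topological_space, 'n::finite) chart set \<Rightarrow> ('m, 'n) metric \<Rightarrow> 'm measure \<Rightarrow>
     ('m \<Rightarrow> ('m, 'n) tvec) set \<Rightarrow>
     (('m \<Rightarrow> ('m, 'n) tvec) \<Rightarrow> ('m \<Rightarrow> ('m, 'n) tvec) \<Rightarrow> real) \<Rightarrow> ('m \<Rightarrow> real) \<Rightarrow>
     ('m \<Rightarrow> real) \<Rightarrow> ('m \<Rightarrow> real) \<Rightarrow> real" where
  "cotangent_form A g vol H ip \<rho> f h =
     ip (I_adj A g vol H ip \<rho> (grad A g f)) (I_adj A g vol H ip \<rho> (grad A g h))"

definition K_S ::
    "('m::topological_space, 'n::finite) chart set \<Rightarrow> ('m, 'n) metric \<Rightarrow> 'm measure \<Rightarrow>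
     ('m \<Rightarrow> ('m, 'n) tvec) set \<Rightarrow>
     (('m \<Rightarrow> ('m, 'n) tvec) \<Rightarrow> ('m \<Rightarrow> ('m, 'n) tvec) \<Rightarrow> real) \<Rightarrow> ('m \<Rightarrow> real) \<Rightarrow>
     ('m \<Rightarrow> real) \<Rightarrow> 'm \<Rightarrow> real" where
  "K_S A g vol H ip \<rho> f = continuity_op A g \<rho> (I_adj A g vol H ip \<rho> (grad A g f))"

definition pairing :: "'m measure \<Rightarrow> ('m \<Rightarrow> real) \<Rightarrow> ('m \<Rightarrow> real) \<Rightarrow> real" where
  "pairing vol f \<sigma> = (\<integral>x. f x * \<sigma> x \<partial>vol)"

text \<open>
  Isometric isomorphisms from the completion of \<open>(V, b)\<close> onto a linear space \<open>W\<close> with norm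
  \<open>nrm\<close>.
\<close>

definition isometric_iso_from_completion ::
    "'a::real_vector set \<Rightarrow> ('a \<Rightarrow> 'a \<Rightarrow> real) \<Rightarrow> 'b::real_vector set \<Rightarrow> ('b \<Rightarrow> real) \<Rightarrow>
     ((nat \<Rightarrow> 'a) set \<Rightarrow> 'b) \<Rightarrow> bool" where
  "isometric_iso_from_completion V b W nrm K \<longleftrightarrow>
     bij_betw K (hilbert_completion V b) W \<and>
     (\<forall>P\<in>hilbert_completion V b. \<forall>Q\<in>hilbert_completion V b. K (completion_add V b P Q) = K P + K Q) \<and>
     (\<forall>a. \<forall>P\<in>hilbert_completion V b. K (completion_scale V b a P) = a *\<^sub>R K P) \<and>
     (\<forall>P\<in>hilbert_completion V b. nrm (K P) = semi_norm (completion_inner b) P)"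

end

theory Submission
  imports Defs
begin

text \<open>
  Write \<open>B f\<close> for \<open>I\<^sub>\<rho>\<^sup>* grad f\<close> and \<open>C v\<close> for \<open>- div (\<rho> v)\<close>.  The theorem says that \<open>C\<close>, restricted to the
  closure of the range of \<open>B\<close> in the Hilbert space \<open>H\<close>, is an isometry onto the quotient of \<open>H\<close> by
  the kernel of \<open>C\<close>.  The closure of the range is the completion of the covectors, because their
  form is the inner product of \<open>H\<close> pulled back along \<open>B\<close>; and the quotient is the tangent space with
  its infimum norm.  So all that has to be known about \<open>B\<close> and \<open>C\<close> is that the kernel of \<open>C\<close> is the
  orthogonal complement of the range of \<open>B\<close>.  The abstract consequences of this relation, including
  uniqueness of the extension and minimality of \<open>B f\<close> by Pythagoras, are drawn in the locale
  \<open>covector_completion\<close>, with the theorem \<open>unique_isometric_extension\<close>.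

  The relation itself comes from the divergence theorem (\<open>divergence_theorem\<close>):
  \<open>\<langle>B f, v\<rangle>\<^sub>H = \<integral> g(grad f, v) \<rho> dvol = \<integral> f C v dvol\<close> for smooth \<open>f\<close> and \<open>v\<close> in \<open>H\<close>.  Thus \<open>v\<close> is orthogonal
  to the range of \<open>B\<close> iff the continuous function \<open>C v\<close> integrates to zero against every smooth
  function, that is, iff \<open>C v = 0\<close> (\<open>eq_0_of_smooth_test_functions\<close>).  The same identity with \<open>v = B h\<close>
  is the formula for the pairing.  That \<open>B f\<close> exists is Riesz representation (\<open>riesz\<close>), with the bound
  provided by the continuous inclusion of \<open>H\<close> into the \<open>C\<^sup>1\<close> vector fields.

  The divergence theorem is first proved for functions supported in one chart, where it reduces to
  the vanishing of the integral of a derivative of a compactly supported function on Euclidean space,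
  and then globalised by a smooth partition of unity.  The local statement also shows that the
  coordinate expression of the divergence does not depend on the chart: two such expressions are
  continuous and have the same integrals against test functions.
\<close>

section \<open>Calculus of maps of class \<open>C\<^sup>k\<close>\<close>

lemma differentiable_imp_has_derivative:
  "f differentiable (at x) \<Longrightarrow> (f has_derivative frechet_derivative f (at x)) (at x)"
  by (simp add: frechet_derivative_works)

lemma Ck_on_imp_continuous: "Ck_on k f S \<Longrightarrow> continuous_on S f"
  by (cases k)
    (auto intro!: continuous_at_imp_continuous_on differentiable_imp_continuous_within)

lemma Ck_on_Suc_imp: "Ck_on (Suc k) f S \<Longrightarrow> Ck_on k f S"
proof (induction k arbitrary: f)
  case 0
  then show ?case using Ck_on_imp_continuous by (simp del: Ck_on.simps(2))
next
  case (Suc k)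
  then show ?case by (metis Ck_on.simps(2))
qed

lemma Ck_on_open_Un:
  assumes "open S" "open T"
  shows "Ck_on k f S \<Longrightarrow> Ck_on k f T \<Longrightarrow> Ck_on k f (S \<union> T)"
  by (induction k arbitrary: f) (auto intro: continuous_on_open_Un[OF assms])

lemma Ck_on_cong:
  assumes "open S" and "\<And>x. x \<in> S \<Longrightarrow> f x = g x" and "Ck_on k f S"
  shows "Ck_on k g S"
  using assms(2,3)
proof (induction k arbitrary: f g)
  case 0
  then show ?case by (simp cong: continuous_on_cong)
next
  case (Suc k)
  have g: "(g has_derivative frechet_derivative f (at x)) (at x)" if "x \<in> S" for x
    using has_derivative_transform_within_open[OF differentiable_imp_has_derivative assms(1) that]
      Suc.prems that by (metis Ck_on.simps(2))
  have eq: "frechet_derivative f (at x) w = frechet_derivative g (at x) w" if "x \<in> S" for x w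
    by (simp only: frechet_derivative_at[OF g[OF that]])
  have "Ck_on k (\<lambda>x. frechet_derivative f (at x) w) S" for w
    using Suc.prems(2) by simp
  from Suc.IH[OF eq this] have "Ck_on k (\<lambda>x. frechet_derivative g (at x) w) S" for w .
  then show ?case
    using g unfolding Ck_on.simps differentiable_def by blast
qed

text \<open>
  The definition speaks of the chosen derivative \<^const>\<open>frechet_derivative\<close>; any formula for the
  derivative serves instead.
\<close>

lemma Ck_on_SucI:
  assumes "open S"
    and "\<And>x. x \<in> S \<Longrightarrow> (f has_derivative D x) (at x)"
    and "\<And>w. Ck_on k (\<lambda>x. D x w) S"
  shows "Ck_on (Suc k) f S"
proof -
  have "D x = frechet_derivative f (at x)" if "x \<in> S" for x
    using frechet_derivative_at[OF assms(2)[OF that]] .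
  then have "Ck_on k (\<lambda>x. frechet_derivative f (at x) w) S" for w
    by (intro Ck_on_cong[OF assms(1) _ assms(3)[of w]]) simp
  then show ?thesis
    using assms(2) by (auto simp: differentiable_def)
qed

lemma Ck_on_SucD:
  assumes "Ck_on (Suc k) f S"
  shows "x \<in> S \<Longrightarrow> (f has_derivative frechet_derivative f (at x)) (at x)"
    and "Ck_on k (\<lambda>x. frechet_derivative f (at x) w) S"
  using assms by (auto simp: frechet_derivative_works)

lemma Ck_on_const: "Ck_on k (\<lambda>_. c) S"
  by (induction k arbitrary: c) simp_all

lemma Ck_on_bounded_linear_comp:
  assumes "bounded_linear L" "open S"
  shows "Ck_on k f S \<Longrightarrow> Ck_on k (\<lambda>x. L (f x)) S"
proof (induction k arbitrary: f)
  case 0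
  then show ?case by (simp add: bounded_linear.continuous_on[OF assms(1)])
next
  case (Suc k)
  note D = Ck_on_SucD[OF Suc.prems]
  show ?case
    by (rule Ck_on_SucI[OF assms(2) bounded_linear.has_derivative[OF assms(1) D(1)]])
      (use Suc.IH[OF D(2)] in auto)
qed

lemma Ck_on_bounded_linear:
  assumes "bounded_linear L" "open S"
  shows "Ck_on k L S"
proof (cases k)
  case 0
  then show ?thesis by (simp add: bounded_linear.continuous_on[OF assms(1)] continuous_on_id)
next
  case (Suc m)
  then show ?thesis
    using Ck_on_SucI[OF assms(2) bounded_linear_imp_has_derivative[OF assms(1)] Ck_on_const]
    by blast
qed

lemma Ck_on_ident: "open S \<Longrightarrow> Ck_on k (\<lambda>x. x) S"
  by (rule Ck_on_bounded_linear[OF bounded_linear_ident])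

lemma Ck_on_add:
  assumes "open S"
  shows "Ck_on k f S \<Longrightarrow> Ck_on k g S \<Longrightarrow> Ck_on k (\<lambda>x. f x + g x) S"
proof (induction k arbitrary: f g)
  case 0
  then show ?case by (simp add: continuous_on_add)
next
  case (Suc k)
  note D = Ck_on_SucD[OF Suc.prems(1)] and E = Ck_on_SucD[OF Suc.prems(2)]
  show ?case
    by (rule Ck_on_SucI[OF assms has_derivative_add[OF D(1) E(1)]])
      (use Suc.IH[OF D(2) E(2)] in auto)
qed

lemma Ck_on_sum:
  assumes "open S"
  shows "(\<And>i. i \<in> I \<Longrightarrow> Ck_on k (f i) S) \<Longrightarrow> Ck_on k (\<lambda>x. \<Sum>i\<in>I. f i x) S"
  by (induction I rule: infinite_finite_induct) (auto intro!: Ck_on_const Ck_on_add[OF assms])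

lemma Ck_on_scaleR:
  fixes f :: "'a::euclidean_space \<Rightarrow> real"
  assumes "open S"
  shows "Ck_on k f S \<Longrightarrow> Ck_on k g S \<Longrightarrow> Ck_on k (\<lambda>x. f x *\<^sub>R g x) S"
proof (induction k arbitrary: f g)
  case 0
  then show ?case by (simp add: continuous_on_scaleR)
next
  case (Suc k)
  note D = Ck_on_SucD[OF Suc.prems(1)] and E = Ck_on_SucD[OF Suc.prems(2)]
  note F = Ck_on_Suc_imp[OF Suc.prems(1)] and G = Ck_on_Suc_imp[OF Suc.prems(2)]
  show ?case
    by (rule Ck_on_SucI[OF assms has_derivative_scaleR[OF D(1) E(1)]])
      (use Suc.IH[OF F E(2)] Suc.IH[OF D(2) G] in \<open>auto intro!: Ck_on_add[OF assms]\<close>)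
qed

lemma Ck_on_mult:
  fixes f :: "'a::euclidean_space \<Rightarrow> real"
  assumes "open S" "Ck_on k f S" "Ck_on k g S"
  shows "Ck_on k (\<lambda>x. f x * g x) S"
  using Ck_on_scaleR[OF assms] by simp

lemma Ck_on_prod:
  fixes f :: "'i \<Rightarrow> 'a::euclidean_space \<Rightarrow> real"
  assumes "open S"
  shows "(\<And>i. i \<in> I \<Longrightarrow> Ck_on k (f i) S) \<Longrightarrow> Ck_on k (\<lambda>x. \<Prod>i\<in>I. f i x) S"
  by (induction I rule: infinite_finite_induct) (auto intro!: Ck_on_const Ck_on_mult[OF assms])

lemma linear_eq_sum_Basis:
  fixes L :: "'b::euclidean_space \<Rightarrow> 'c::real_vector"
  assumes "linear L"
  shows "L y = (\<Sum>b\<in>Basis. (y \<bullet> b) *\<^sub>R L b)"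
  using linear_sum[OF assms, of "\<lambda>b. (y \<bullet> b) *\<^sub>R b" Basis] linear_scale[OF assms]
  by (simp add: euclidean_representation)

text \<open>
  In the chain rule the derivative of the outer map is evaluated at a direction depending on the
  point; expanding that direction in the standard basis leaves only products and composites of
  class \<open>C\<^sup>k\<close>.
\<close>

lemma Ck_on_compose:
  fixes f :: "'a::euclidean_space \<Rightarrow> 'b::euclidean_space" and g :: "'b \<Rightarrow> 'c::euclidean_space"
  assumes "open S" "f ` S \<subseteq> T"
  shows "Ck_on k g T \<Longrightarrow> Ck_on k f S \<Longrightarrow> Ck_on k (\<lambda>x. g (f x)) S"
proof (induction k arbitrary: g)
  case 0
  then show ?case using assms(2) by (auto intro: continuous_on_compose2)
next
  case (Suc k)
  note D = Ck_on_SucD[OF Suc.prems(1)] and E = Ck_on_SucD[OF Suc.prems(2)]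
  have d: "((\<lambda>x. g (f x)) has_derivative
      (\<lambda>w. frechet_derivative g (at (f x)) (frechet_derivative f (at x) w))) (at x)"
    if "x \<in> S" for x
    using has_derivative_compose[OF E(1)[OF that] D(1)] assms(2) that by blast
  have expand: "(\<Sum>b\<in>Basis. (frechet_derivative f (at x) w \<bullet> b) *\<^sub>R frechet_derivative g (at (f x)) b)
      = frechet_derivative g (at (f x)) (frechet_derivative f (at x) w)" if "x \<in> S" for x w
  proof -
    have "f x \<in> T"
      using assms(2) that by blast
    from linear_eq_sum_Basis[OF has_derivative_linear[OF D(1)[OF this]]] show ?thesis
      by (rule sym)
  qed
  have "Ck_on k (\<lambda>x. \<Sum>b\<in>Basis. (frechet_derivative f (at x) w \<bullet> b) *\<^sub>R
      frechet_derivative g (at (f x)) b) S" for w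
  proof (rule Ck_on_sum[OF assms(1)], rule Ck_on_scaleR[OF assms(1)])
    show "Ck_on k (\<lambda>x. frechet_derivative f (at x) w \<bullet> b) S" for b
      using Ck_on_bounded_linear_comp[OF bounded_linear_inner_left assms(1) E(2)] .
    show "Ck_on k (\<lambda>x. frechet_derivative g (at (f x)) b) S" for b
      using Suc.IH[OF D(2) Ck_on_Suc_imp[OF Suc.prems(2)]] .
  qed
  then have "Ck_on k (\<lambda>x. frechet_derivative g (at (f x)) (frechet_derivative f (at x) w)) S" for w
    by (rule Ck_on_cong[OF assms(1), rotated]) (rule expand)
  then show ?case
    using Ck_on_SucI[OF assms(1) d] by blast
qed

lemma Ck_on_inverse: "Ck_on k (inverse :: real \<Rightarrow> real) {0<..}"
proof (induction k)
  case 0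
  show ?case by (auto intro!: continuous_intros)
next
  case (Suc k)
  show ?case
  proof (rule Ck_on_SucI)
    fix x :: real
    assume "x \<in> {0<..}"
    then show "(inverse has_derivative (\<lambda>w. - 1 *\<^sub>R (inverse x *\<^sub>R (w *\<^sub>R inverse x)))) (at x)"
      using has_derivative_inverse'[of x UNIV] by (simp add: mult.assoc)
  next
    show "Ck_on k (\<lambda>x. - 1 *\<^sub>R (inverse x *\<^sub>R (w *\<^sub>R inverse x))) {0<..}" for w :: real
      by (intro Ck_on_scaleR Ck_on_const Suc open_greaterThan)
  qed simp
qed

lemma Ck_on_sqrt: "Ck_on k sqrt {0<..}"
proof (induction k)
  case 0
  show ?case by (auto intro!: continuous_intros)
next
  case (Suc k)
  show ?case
  proof (rule Ck_on_SucI)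
    fix x :: real
    assume "x \<in> {0<..}"
    then show "(sqrt has_derivative (\<lambda>w. (w / 2) * inverse (sqrt x))) (at x)"
      using DERIV_real_sqrt[of x]
      by (auto simp: has_field_derivative_def field_simps elim!: has_derivative_eq_rhs)
  next
    show "Ck_on k (\<lambda>x. w / 2 * inverse (sqrt x)) {0<..}" for w
      by (intro Ck_on_mult Ck_on_const Ck_on_compose[OF _ _ Ck_on_inverse Suc]) auto
  qed simp
qed

section \<open>A smooth bump function\<close>

text \<open>
  \<open>flat_exp m\<close> is \<open>t\<^sup>-\<^sup>m exp (-1/t)\<close> on the positive axis.  The family is closed under
  differentiation, and each member vanishes faster than linearly at 0, so all of them are smooth.
\<close>

definition flat_exp :: "nat \<Rightarrow> real \<Rightarrow> real"
  where "flat_exp m t = (if 0 < t then exp (- inverse t) / t ^ m else 0)"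

lemma tendsto_flat_exp_0: "(flat_exp m \<longlongrightarrow> 0) (at 0)"
proof -
  have "((\<lambda>t. inverse t ^ m / exp (inverse t)) \<longlongrightarrow> 0) (at_right (0::real))"
    using filterlim_compose[OF tendsto_power_div_exp_0 filterlim_inverse_at_top_right] .
  then have "(flat_exp m \<longlongrightarrow> 0) (at_right 0)"
    by (rule Lim_transform_eventually)
      (auto simp: flat_exp_def eventually_at_filter exp_minus field_simps)
  moreover have "(flat_exp m \<longlongrightarrow> 0) (at_left 0)"
    by (rule tendsto_eventually) (auto simp: flat_exp_def eventually_at_filter)
  ultimately show ?thesis
    by (simp add: filterlim_split_at)
qed

lemma flat_exp_has_derivative:
  "(flat_exp m has_real_derivative (flat_exp (m + 2) t - real m * flat_exp (m + 1) t)) (at t)"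
proof -
  consider "t < 0" | "t = 0" | "0 < t" by linarith
  then show ?thesis
  proof cases
    case 1
    then show ?thesis
      by (auto simp: flat_exp_def intro: has_field_derivative_transform_within_open[of "\<lambda>_. 0" _ t "{..<0}"])
  next
    case 2
    have zero: "flat_exp j 0 = 0" for j
      by (simp add: flat_exp_def)
    have "flat_exp m h / h = flat_exp (m + 1) h" for h
      by (simp add: flat_exp_def)
    then show ?thesis
      using tendsto_flat_exp_0[of "m + 1"] by (simp add: DERIV_def 2 zero)
  next
    case 3
    have pow: "real m * t ^ (m - 1) = real m * t ^ m / t"
      using 3 by (cases m) auto
    have "((\<lambda>t. exp (- inverse t) / t ^ m) has_real_derivative
        (exp (- inverse t) * (inverse t)\<^sup>2 * t ^ m - exp (- inverse t) * (real m * t ^ (m - 1)))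
          / (t ^ m * t ^ m)) (at t)"
      using 3 by (auto intro!: derivative_eq_intros simp: power2_eq_square)
    also have "(exp (- inverse t) * (inverse t)\<^sup>2 * t ^ m - exp (- inverse t) * (real m * t ^ (m - 1)))
          / (t ^ m * t ^ m) = flat_exp (m + 2) t - real m * flat_exp (m + 1) t"
      unfolding pow using 3 by (simp add: flat_exp_def field_simps power2_eq_square)
    finally have "((\<lambda>t. exp (- inverse t) / t ^ m) has_real_derivative
        flat_exp (m + 2) t - real m * flat_exp (m + 1) t) (at t)" .
    then show ?thesis
      using 3 by (auto intro: has_field_derivative_transform_within_open[of _ _ t "{0<..}"]
        simp: flat_exp_def)
  qed
qed

lemma Ck_on_flat_exp: "Ck_on k (flat_exp m) UNIV"
proof (induction k arbitrary: m)
  case 0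
  show ?case
    using DERIV_isCont[OF flat_exp_has_derivative]
    by (auto intro!: continuous_at_imp_continuous_on)
next
  case (Suc k)
  show ?case
  proof (rule Ck_on_SucI)
    show "(flat_exp m has_derivative
        (\<lambda>w. flat_exp (m + 2) t * w + (- real m) * (flat_exp (m + 1) t * w))) (at t)" for t
      using flat_exp_has_derivative[of m t]
      by (auto simp: has_field_derivative_def algebra_simps elim!: has_derivative_eq_rhs)
    show "Ck_on k (\<lambda>t. flat_exp (m + 2) t * w + (- real m) * (flat_exp (m + 1) t * w)) UNIV" for w
      by (intro Ck_on_add Ck_on_mult Ck_on_const Suc open_UNIV)
  qed simp
qed

definition bump :: "'a::euclidean_space \<Rightarrow> real \<Rightarrow> 'a \<Rightarrow> real"
  where "bump a r y = flat_exp 0 (r\<^sup>2 - (y - a) \<bullet> (y - a))"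

lemma Ck_on_bump: "Ck_on k (bump a r) UNIV"
proof -
  have "Ck_on k (\<lambda>y. r\<^sup>2 + (-1) * (\<Sum>b\<in>Basis. ((y + (- a)) \<bullet> b) * ((y + (- a)) \<bullet> b))) UNIV"
    by (intro Ck_on_add Ck_on_mult Ck_on_const Ck_on_sum Ck_on_ident
        Ck_on_bounded_linear_comp[OF bounded_linear_inner_left] open_UNIV)
  then have "Ck_on k (\<lambda>y. r\<^sup>2 - (y - a) \<bullet> (y - a)) UNIV"
    by (simp add: euclidean_inner[of "_ - _" "_ - _"])
  then show ?thesis
    unfolding bump_def by (intro Ck_on_compose[OF _ _ Ck_on_flat_exp]) auto
qed

lemma bump_nonneg: "0 \<le> bump a r y"
  by (simp add: bump_def flat_exp_def)

lemma bump_centre_pos: "0 < r \<Longrightarrow> 0 < bump a r a"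
  by (simp add: bump_def flat_exp_def)

lemma bump_eq_0: "0 < r \<Longrightarrow> y \<notin> cball a r \<Longrightarrow> bump a r y = 0"
proof -
  assume r: "0 < r" and "y \<notin> cball a r"
  then have "r < norm (y - a)" by (simp add: dist_norm norm_minus_commute)
  then have "r\<^sup>2 < (norm (y - a))\<^sup>2"
    using r by (intro power_strict_mono) auto
  then show ?thesis
    by (simp add: bump_def flat_exp_def dot_square_norm)
qed

section \<open>Integration by parts in Euclidean space\<close>

lemma continuous_on_zero_extension:
  fixes h :: "'a::topological_space \<Rightarrow> 'b::{topological_space,zero}"
  assumes "open U" "closed K" "K \<subseteq> U" "continuous_on U h" "\<And>x. x \<in> U - K \<Longrightarrow> h x = 0"
  shows "continuous_on UNIV (\<lambda>x. if x \<in> U then h x else 0)"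
proof -
  let ?h = "\<lambda>x. if x \<in> U then h x else 0"
  have "continuous_on U ?h"
    using assms(4) by (simp cong: continuous_on_cong)
  moreover have "continuous_on (- K) ?h"
    using assms(5) by (intro continuous_on_eq[OF continuous_on_const[of _ 0]]) auto
  ultimately have "continuous_on (U \<union> - K) ?h"
    using assms(1,2) by (intro continuous_on_open_Un) auto
  moreover have "U \<union> - K = UNIV"
    using assms(3) by blast
  ultimately show ?thesis by simp
qed

lemma integrable_continuous_compact_support:
  fixes f :: "'a::euclidean_space \<Rightarrow> real"
  assumes "continuous_on UNIV f" "compact K" "\<And>x. x \<notin> K \<Longrightarrow> f x = 0"
  shows "integrable lborel f"
proof -
  have "integrable lborel (\<lambda>x. indicator K x *\<^sub>R f x)"
    using assms(1,2) by (intro borel_integrable_compact) (auto intro: continuous_on_subset)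
  moreover have "(\<lambda>x. indicator K x *\<^sub>R f x) = f"
    using assms(3) by (auto simp: indicator_def fun_eq_iff)
  ultimately show ?thesis by simp
qed

lemma lborel_integral_translate:
  fixes f :: "'a::euclidean_space \<Rightarrow> real"
  assumes "f \<in> borel_measurable borel"
  shows "(\<integral>x. f (x + a) \<partial>lborel) = (\<integral>x. f x \<partial>lborel)"
proof -
  have "(\<integral>x. f x \<partial>lborel) = (\<integral>x. f x \<partial>distr lborel borel ((+) a))"
    by (simp add: lborel_distr_plus)
  also have "\<dots> = (\<integral>x. f (x + a) \<partial>lborel)"
    using assms by (simp add: integral_distr add.commute)
  finally show ?thesis by simp
qed

text \<open>
  The integral of \<open>F (x + t e)\<close> does not depend on \<open>t\<close>, and differentiating it at \<open>t = 0\<close> under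
  the integral sign gives the claim.  The mean value theorem bounds the difference quotients by a
  constant on one compact set, which justifies the exchange of limit and integral.
\<close>

lemma integral_directional_derivative_eq_0:
  fixes F :: "'a::euclidean_space \<Rightarrow> real"
  assumes D: "\<And>x. (F has_derivative D x) (at x)"
    and cont: "continuous_on UNIV (\<lambda>x. D x e)"
    and K: "compact K" and supp: "\<And>x. x \<notin> K \<Longrightarrow> F x = 0"
  shows "integrable lborel (\<lambda>x. D x e)" and "(\<integral>x. D x e \<partial>lborel) = 0"
proof -
  have D0: "D x e = 0" if "x \<notin> K" for x
  proof -
    have "open (- K)"
      using compact_imp_closed[OF K] by auto
    then have "(F has_derivative (\<lambda>_. 0)) (at x)"
      using has_derivative_transform_within_open[of "\<lambda>_. 0" "\<lambda>_. 0" x UNIV "- K" F] supp that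
      by auto
    then show ?thesis
      using has_derivative_unique[OF D] by metis
  qed
  show int: "integrable lborel (\<lambda>x. D x e)"
    using integrable_continuous_compact_support[OF cont K D0] .
  have "compact ((\<lambda>x. D x e) ` K)"
    using K cont by (intro compact_continuous_image) (auto intro: continuous_on_subset)
  then obtain C where C: "\<And>x. x \<in> K \<Longrightarrow> \<bar>D x e\<bar> \<le> C"
    using compact_imp_bounded bounded_iff by (metis imageI real_norm_def)
  have C': "\<bar>D x e\<bar> \<le> max C 0" for x
    using C[of x] D0[of x] by (cases "x \<in> K") auto
  define K' where "K' = (\<lambda>(x, t). x - t *\<^sub>R e) ` (K \<times> {0..1})"
  have K': "compact K'"
    unfolding K'_def using K
    by (intro compact_continuous_image compact_Times)
      (auto intro!: continuous_intros simp: case_prod_unfold)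
  have contF: "continuous_on UNIV F"
    using has_derivative_continuous[OF D] by (auto intro!: continuous_at_imp_continuous_on)
  then have F_meas [measurable]: "F \<in> borel_measurable borel"
    by (rule borel_measurable_continuous_onI)
  have F_int: "integrable lborel F"
    using integrable_continuous_compact_support[OF contF K supp] .
  define s :: "nat \<Rightarrow> real" where "s n = inverse (real (Suc n))" for n
  have s: "0 < s n" "s n \<le> 1" for n
    by (auto simp: s_def field_simps)
  define Q where "Q n x = (F (x + s n *\<^sub>R e) - F x) / s n" for n x
  have line: "((\<lambda>t. F (x + t *\<^sub>R e)) has_real_derivative D (x + t *\<^sub>R e) e) (at t)" for x t
  proof -
    have "((\<lambda>t. F (x + t *\<^sub>R e)) has_derivative (\<lambda>h. D (x + t *\<^sub>R e) (h *\<^sub>R e))) (at t)"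
      by (rule has_derivative_compose[OF _ D]) (auto intro!: derivative_eq_intros)
    then show ?thesis
      using linear_scale[OF has_derivative_linear[OF D]]
      by (simp add: has_field_derivative_def mult.commute[of _ "D _ e"])
  qed
  have Q_lim: "(\<lambda>n. Q n x) \<longlonglongrightarrow> D x e" for x
  proof -
    have "((\<lambda>h. (F (x + h *\<^sub>R e) - F x) / h) \<longlongrightarrow> D x e) (at 0)"
      using line[of x 0] by (simp add: DERIV_def)
    moreover have "filterlim s (at 0) sequentially"
      using LIMSEQ_inverse_real_of_nat s(1) less_imp_neq[OF s(1)]
      by (auto simp: filterlim_at s_def[abs_def])
    ultimately show ?thesis
      unfolding Q_def by (rule filterlim_compose)
  qed
  have Q_bound: "\<bar>Q n x\<bar> \<le> max C 0 * indicator K' x" for n x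
  proof (cases "x \<in> K'")
    case True
    obtain z where "F (x + s n *\<^sub>R e) - F (x + 0 *\<^sub>R e) = (s n - 0) * D (x + z *\<^sub>R e) e"
      using MVT2[OF s(1)[of n], of "\<lambda>t. F (x + t *\<^sub>R e)" "\<lambda>t. D (x + t *\<^sub>R e) e"] line by blast
    then show ?thesis
      using True C' s(1)[of n] by (simp add: Q_def)
  next
    case False
    have "x + t *\<^sub>R e \<notin> K" if "0 \<le> t" "t \<le> 1" for t
    proof
      assume "x + t *\<^sub>R e \<in> K"
      then have "(x + t *\<^sub>R e) - t *\<^sub>R e \<in> K'"
        unfolding K'_def using that by (intro image_eqI[of _ _ "(x + t *\<^sub>R e, t)"]) auto
      then show False using False by simp
    qed
    from this[of 0] this[of "s n"] show ?thesis
      using s[of n] supp by (simp add: Q_def)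
  qed
  have "(\<lambda>n. \<integral>x. Q n x \<partial>lborel) \<longlonglongrightarrow> (\<integral>x. D x e \<partial>lborel)"
  proof (rule integral_dominated_convergence)
    show "integrable lborel (\<lambda>x. max C 0 * indicator K' x)"
      using K' emeasure_compact_finite[OF K'] by (auto simp: compact_imp_closed)
    show "Q n \<in> borel_measurable lborel" for n
      unfolding Q_def by measurable
  qed (use int Q_lim Q_bound in auto)
  moreover have "(\<integral>x. Q n x \<partial>lborel) = 0" for n
  proof -
    have "integrable lborel (\<lambda>x. F (x + s n *\<^sub>R e))"
    proof -
      have "integrable (distr lborel borel ((+) (s n *\<^sub>R e))) F"
        using F_int by (simp add: lborel_distr_plus)
      then show ?thesis
        by (subst (asm) integrable_distr_eq) (auto simp: add.commute)
    qed
    then show ?thesis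
      using F_int lborel_integral_translate[OF F_meas, of "s n *\<^sub>R e"]
      by (simp add: Q_def)
  qed
  ultimately show "(\<integral>x. D x e \<partial>lborel) = 0"
    by (simp add: LIMSEQ_const_iff)
qed

text \<open>
  The coordinate form in which integration by parts is applied: \<open>F\<close> lives on an open set and is
  extended by zero.
\<close>

lemma integral_directional_derivative_on_eq_0:
  fixes F :: "'a::euclidean_space \<Rightarrow> real"
  assumes U: "open U" and K: "compact K" "K \<subseteq> U" and F: "Ck_on 1 F U"
    and supp: "\<And>y. y \<in> U - K \<Longrightarrow> F y = 0"
  shows "integrable lborel (\<lambda>y. if y \<in> U then frechet_derivative F (at y) e else 0)"
    and "(\<integral>y. (if y \<in> U then frechet_derivative F (at y) e else 0) \<partial>lborel) = 0"
proof -
  have cl: "closed K" using K(1) by (rule compact_imp_closed)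
  define G where "G y = (if y \<in> U then F y else 0)" for y
  define D where "D y = (\<lambda>w. if y \<in> U then frechet_derivative F (at y) w else 0)" for y
  have F': "(F has_derivative frechet_derivative F (at y)) (at y)" if "y \<in> U" for y
    using F that Ck_on_SucD(1)[of 0 F U] by simp
  have zero: "(G has_derivative (\<lambda>_. 0)) (at y)" if "y \<notin> K" for y
    using has_derivative_transform_within_open[of "\<lambda>_. 0" "\<lambda>_. 0" y UNIV "- K" G] that open_Compl[OF cl] supp
    by (simp add: G_def)
  have G: "(G has_derivative D y) (at y)" for y
  proof (cases "y \<in> U")
    case True
    then show ?thesis
      using has_derivative_transform_within_open[OF F'[OF True] U True, of G]
      by (simp add: G_def D_def)
  next
    case False
    then show ?thesis
      using zero[of y] K(2) by (auto simp: D_def)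
  qed
  have "D y e = 0" if "y \<in> U - K" for y
    using has_derivative_unique[OF G zero] that by (metis Diff_iff)
  then have "continuous_on UNIV (\<lambda>y. if y \<in> U then frechet_derivative F (at y) e else 0)"
    using F by (intro continuous_on_zero_extension[OF U cl K(2)]) (auto simp: D_def)
  then have "continuous_on UNIV (\<lambda>y. D y e)"
    by (simp add: D_def)
  from integral_directional_derivative_eq_0[OF G this K(1)] show
    "integrable lborel (\<lambda>y. if y \<in> U then frechet_derivative F (at y) e else 0)"
    "(\<integral>y. (if y \<in> U then frechet_derivative F (at y) e else 0) \<partial>lborel) = 0"
    using K(2) supp by (auto simp: D_def G_def)
qed

section \<open>Hilbert spaces carried by sets\<close>

lemma tendsto_0_of_abs_le:
  fixes f :: "nat \<Rightarrow> real"
  assumes "\<And>n. \<bar>f n\<bar> \<le> g n" "g \<longlonglongrightarrow> 0"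
  shows "f \<longlonglongrightarrow> 0"
  using assms by (intro Lim_null_comparison[of f g] always_eventually) auto

locale hilbert_on =
  fixes H :: "'a::real_vector set" and ip :: "'a \<Rightarrow> 'a \<Rightarrow> real"
  assumes hilbert: "hilbert_space_on H ip"
begin

abbreviation nrm :: "'a \<Rightarrow> real" where "nrm \<equiv> semi_norm ip"

lemma subspace_H: "subspace H"
  using hilbert by (simp add: hilbert_space_on_def)

lemma inner_H: "inner_product_on H ip"
  using hilbert by (simp add: hilbert_space_on_def)

lemma mem_H [simp, intro]:
  "0 \<in> H" "x \<in> H \<Longrightarrow> y \<in> H \<Longrightarrow> x + y \<in> H" "x \<in> H \<Longrightarrow> y \<in> H \<Longrightarrow> x - y \<in> H"
  "x \<in> H \<Longrightarrow> a *\<^sub>R x \<in> H" "x \<in> H \<Longrightarrow> - x \<in> H"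
  using subspace_H by (auto intro: subspace_0 subspace_add subspace_diff subspace_scale subspace_neg)

lemma ip_commute: "x \<in> H \<Longrightarrow> y \<in> H \<Longrightarrow> ip x y = ip y x"
  using inner_H[unfolded inner_product_on_def, THEN conjunct1] by blast

lemma ip_add_left: "x \<in> H \<Longrightarrow> y \<in> H \<Longrightarrow> z \<in> H \<Longrightarrow> ip (x + y) z = ip x z + ip y z"
  using inner_H[unfolded inner_product_on_def, THEN conjunct2, THEN conjunct1] by blast

lemma ip_scale_left: "x \<in> H \<Longrightarrow> y \<in> H \<Longrightarrow> ip (a *\<^sub>R x) y = a * ip x y"
  using inner_H[unfolded inner_product_on_def, THEN conjunct2, THEN conjunct2, THEN conjunct1]
  by blast

lemma ip_pos: "x \<in> H \<Longrightarrow> x \<noteq> 0 \<Longrightarrow> 0 < ip x x"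
  using inner_H[unfolded inner_product_on_def, THEN conjunct2, THEN conjunct2, THEN conjunct2]
  by blast

lemma ip_add_right: "x \<in> H \<Longrightarrow> y \<in> H \<Longrightarrow> z \<in> H \<Longrightarrow> ip z (x + y) = ip z x + ip z y"
  using ip_add_left[of x y z] ip_commute[of z "x + y"] ip_commute[of z x] ip_commute[of z y] by simp

lemma ip_scale_right: "x \<in> H \<Longrightarrow> y \<in> H \<Longrightarrow> ip y (a *\<^sub>R x) = a * ip y x"
  using ip_scale_left[of x y a] ip_commute[of y "a *\<^sub>R x"] ip_commute[of y x] by simp

lemma ip_diff_left: "x \<in> H \<Longrightarrow> y \<in> H \<Longrightarrow> z \<in> H \<Longrightarrow> ip (x - y) z = ip x z - ip y z"
  using ip_add_left[of x "(- 1) *\<^sub>R y" z] ip_scale_left[of y z "- 1"] by simp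

lemma ip_diff_right: "x \<in> H \<Longrightarrow> y \<in> H \<Longrightarrow> z \<in> H \<Longrightarrow> ip z (x - y) = ip z x - ip z y"
  using ip_diff_left[of x y z] ip_commute[of z "x - y"] ip_commute[of z x] ip_commute[of z y] by simp

lemma ip_zero [simp]: "x \<in> H \<Longrightarrow> ip 0 x = 0" "x \<in> H \<Longrightarrow> ip x 0 = 0"
  using ip_scale_left[of 0 x 0] ip_scale_right[of 0 x 0] by auto

lemmas ip_simps = ip_add_left ip_add_right ip_diff_left ip_diff_right ip_scale_left ip_scale_right

lemma ip_nonneg: "x \<in> H \<Longrightarrow> 0 \<le> ip x x"
  using ip_pos[of x] by (cases "x = 0") auto

lemma ip_eq_0_iff: "x \<in> H \<Longrightarrow> ip x x = 0 \<longleftrightarrow> x = 0"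
  using ip_pos[of x] by (cases "x = 0") auto

lemma nrm_nonneg: "x \<in> H \<Longrightarrow> 0 \<le> nrm x"
  by (simp add: semi_norm_def ip_nonneg)

lemma nrm_sq: "x \<in> H \<Longrightarrow> (nrm x)\<^sup>2 = ip x x"
  by (simp add: semi_norm_def ip_nonneg)

lemma nrm_eq_0_iff: "x \<in> H \<Longrightarrow> nrm x = 0 \<longleftrightarrow> x = 0"
  by (simp add: semi_norm_def ip_eq_0_iff)

lemma nrm_diff_commute: "x \<in> H \<Longrightarrow> y \<in> H \<Longrightarrow> nrm (x - y) = nrm (y - x)"
  by (simp add: semi_norm_def ip_simps)

lemma nrm_scale: "x \<in> H \<Longrightarrow> nrm (a *\<^sub>R x) = \<bar>a\<bar> * nrm x"
  by (simp add: semi_norm_def ip_simps real_sqrt_mult flip: mult.assoc power2_eq_square)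

lemma cauchy_schwarz:
  assumes "x \<in> H" "y \<in> H"
  shows "\<bar>ip x y\<bar> \<le> nrm x * nrm y"
proof (cases "y = 0")
  case True
  then show ?thesis using assms nrm_eq_0_iff[of y] by simp
next
  case False
  then have y: "0 < ip y y" using ip_pos assms by simp
  let ?z = "ip y y *\<^sub>R x - ip x y *\<^sub>R y"
  have "0 \<le> ip ?z ?z"
    using assms by (intro ip_nonneg) auto
  also have "ip ?z ?z = ip y y * (ip y y * ip x x - (ip x y)\<^sup>2)"
    using assms ip_commute[of y x] by (simp add: ip_simps algebra_simps power2_eq_square)
  finally have "(ip x y)\<^sup>2 \<le> ip x x * ip y y"
    using y by (simp add: zero_le_mult_iff mult.commute)
  then have "sqrt ((ip x y)\<^sup>2) \<le> sqrt (ip x x * ip y y)"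
    by (rule real_sqrt_le_mono)
  then show ?thesis by (simp add: semi_norm_def real_sqrt_mult)
qed

lemma nrm_triangle:
  assumes "x \<in> H" "y \<in> H"
  shows "nrm (x + y) \<le> nrm x + nrm y"
proof -
  have "(nrm (x + y))\<^sup>2 = (nrm x)\<^sup>2 + 2 * ip x y + (nrm y)\<^sup>2"
    using assms ip_commute[of x y] by (simp add: nrm_sq ip_simps)
  also have "\<dots> \<le> (nrm x + nrm y)\<^sup>2"
    using cauchy_schwarz[OF assms] by (simp add: power2_sum)
  finally show ?thesis
    by (rule power2_le_imp_le) (simp add: nrm_nonneg assms)
qed

lemma nrm_triangle_diff:
  assumes "x \<in> H" "y \<in> H" "z \<in> H"
  shows "nrm (x - z) \<le> nrm (x - y) + nrm (y - z)"
  using nrm_triangle[of "x - y" "y - z"] assms by simp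

lemma tendsto_0_of_nrm_le:
  assumes "\<And>n. X n \<in> H" "\<And>n. nrm (X n) \<le> f n" "f \<longlonglongrightarrow> 0"
  shows "(\<lambda>n. nrm (X n)) \<longlonglongrightarrow> 0"
  using tendsto_sandwich[OF _ _ tendsto_const assms(3)] assms(2) nrm_nonneg[OF assms(1)]
  by (simp add: always_eventually)

lemma limit_unique:
  assumes "\<And>n. X n \<in> H" "x \<in> H" "y \<in> H"
    and "(\<lambda>n. nrm (X n - x)) \<longlonglongrightarrow> 0" "(\<lambda>n. nrm (X n - y)) \<longlonglongrightarrow> 0"
  shows "x = y"
proof -
  have "nrm (x - y) \<le> nrm (X n - x) + nrm (X n - y)" for n
    using nrm_triangle_diff[of x "X n" y] nrm_diff_commute[of x "X n"] assms by simp
  then have "nrm (x - y) \<le> 0 + 0"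
    using tendsto_add[OF assms(4,5)] by (intro LIMSEQ_le_const) auto
  then have "nrm (x - y) = 0"
    using nrm_nonneg[of "x - y"] assms by auto
  then show ?thesis using nrm_eq_0_iff assms by simp
qed

lemma ip_tendsto_left:
  assumes "\<And>n. X n \<in> H" "x \<in> H" "y \<in> H" "(\<lambda>n. nrm (X n - x)) \<longlonglongrightarrow> 0"
  shows "(\<lambda>n. ip (X n) y) \<longlonglongrightarrow> ip x y"
proof -
  have "\<bar>ip (X n) y - ip x y\<bar> \<le> nrm (X n - x) * nrm y" for n
    using cauchy_schwarz[of "X n - x" y] assms by (simp add: ip_simps)
  moreover have "(\<lambda>n. nrm (X n - x) * nrm y) \<longlonglongrightarrow> 0"
    using tendsto_mult_right[OF assms(4), of "nrm y"] by simp
  ultimately have "(\<lambda>n. ip (X n) y - ip x y) \<longlonglongrightarrow> 0"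
    by (rule tendsto_0_of_abs_le)
  then show ?thesis by (simp add: LIM_zero_iff)
qed

lemma ip_tendsto:
  assumes "\<And>n. X n \<in> H" "x \<in> H" "\<And>n. Y n \<in> H" "y \<in> H"
    and "(\<lambda>n. nrm (X n - x)) \<longlonglongrightarrow> 0" "(\<lambda>n. nrm (Y n - y)) \<longlonglongrightarrow> 0"
  shows "(\<lambda>n. ip (X n) (Y n)) \<longlonglongrightarrow> ip x y"
proof -
  have "\<bar>ip (X n - x) (Y n - y)\<bar> \<le> nrm (X n - x) * nrm (Y n - y)" for n
    using cauchy_schwarz[of "X n - x" "Y n - y"] assms by simp
  moreover have "(\<lambda>n. nrm (X n - x) * nrm (Y n - y)) \<longlonglongrightarrow> 0"
    using tendsto_mult[OF assms(5,6)] by simp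
  ultimately have "(\<lambda>n. ip (X n - x) (Y n - y)) \<longlonglongrightarrow> 0"
    by (rule tendsto_0_of_abs_le)
  moreover have "(\<lambda>n. ip (X n) y) \<longlonglongrightarrow> ip x y"
    using ip_tendsto_left assms by blast
  moreover have "(\<lambda>n. ip x (Y n)) \<longlonglongrightarrow> ip x y"
    using ip_tendsto_left[OF assms(3,4,2,6)] ip_commute assms by simp
  ultimately have "(\<lambda>n. ip (X n - x) (Y n - y) + ip (X n) y + ip x (Y n) - ip x y)
      \<longlonglongrightarrow> 0 + ip x y + ip x y - ip x y"
    by (intro tendsto_intros)
  moreover have "ip (X n - x) (Y n - y) + ip (X n) y + ip x (Y n) - ip x y = ip (X n) (Y n)" for n
    using assms by (simp add: ip_simps)
  ultimately show ?thesis by simp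
qed

lemma limit_exists:
  "X \<in> cauchy_seqs H ip \<Longrightarrow> \<exists>x\<in>H. (\<lambda>n. nrm (X n - x)) \<longlonglongrightarrow> 0"
  using hilbert by (simp add: hilbert_space_on_def)

lemma convergent_imp_cauchy:
  assumes "\<And>n. X n \<in> H" "x \<in> H" "(\<lambda>n. nrm (X n - x)) \<longlonglongrightarrow> 0"
  shows "X \<in> cauchy_seqs H ip"
  unfolding cauchy_seqs_def
proof (intro CollectI conjI allI impI assms(1))
  fix e :: real
  assume "0 < e"
  then obtain N where N: "\<And>n. N \<le> n \<Longrightarrow> nrm (X n - x) < e / 2"
    using order_tendstoD(2)[OF assms(3), of "e / 2"] by (auto simp: eventually_sequentially)
  have "nrm (X m - X n) < e" if "N \<le> m" "N \<le> n" for m n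
    using nrm_triangle_diff[of "X m" x "X n"] nrm_diff_commute[of x "X n"] N that assms
    by (smt (verit) field_sum_of_halves)
  then show "\<exists>N. \<forall>m\<ge>N. \<forall>n\<ge>N. nrm (X m - X n) < e"
    by blast
qed

text \<open>
  Riesz representation on a subspace \<open>U\<close> that need not be closed: the representing vector is the
  limit of a sequence in \<open>U\<close> minimising \<open>\<langle>u, u\<rangle> - 2 l u\<close>, which is Cauchy by the parallelogram
  identity.  With \<open>U\<close> the whole space this is the usual representation theorem; with \<open>l\<close> the inner
  product against a fixed vector it is the orthogonal projection onto the closure of \<open>U\<close>.
\<close>

lemma riesz_on_subspace:
  assumes U: "subspace U" "U \<subseteq> H"
    and add: "\<And>u v. u \<in> U \<Longrightarrow> v \<in> U \<Longrightarrow> l (u + v) = l u + l v"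
    and scale: "\<And>a u. u \<in> U \<Longrightarrow> l (a *\<^sub>R u) = a * l u"
    and bound: "\<And>u. u \<in> U \<Longrightarrow> \<bar>l u\<bar> \<le> C * nrm u"
  shows "\<exists>X w. (\<forall>n. X n \<in> U) \<and> w \<in> H \<and> (\<lambda>n. nrm (X n - w)) \<longlonglongrightarrow> 0 \<and> (\<forall>u\<in>U. ip w u = l u)"
proof -
  define J where "J u = ip u u - 2 * l u" for u
  have memU: "u + v \<in> U" "a *\<^sub>R u \<in> U" "u - v \<in> U" if "u \<in> U" "v \<in> U" for u v a
    using U(1) that by (auto intro: subspace_add subspace_scale subspace_diff)
  have memH: "u \<in> H" if "u \<in> U" for u
    using U(2) that by blast
  have "- C\<^sup>2 \<le> J u" if "u \<in> U" for u
  proof -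
    have "0 \<le> (nrm u - C)\<^sup>2" by simp
    then show ?thesis
      using bound[OF that] nrm_sq[OF memH[OF that]] by (simp add: J_def power2_diff mult.commute)
  qed
  then have bdd: "bdd_below (J ` U)" by (auto intro!: bdd_belowI)
  have ne: "J ` U \<noteq> {}" using subspace_0[OF U(1)] by blast
  define m where "m = Inf (J ` U)"
  have m_le: "m \<le> J u" if "u \<in> U" for u
    using bdd that by (auto simp: m_def intro: cInf_lower)
  have "\<exists>u\<in>U. J u < m + e" if "0 < e" for e
    using cInf_lessD[OF ne, of "m + e"] that by (auto simp: m_def)
  then have "\<forall>n. \<exists>u. u \<in> U \<and> J u < m + inverse (real (Suc n))"
    by (meson inverse_positive_iff_positive of_nat_0_less_iff zero_less_Suc)
  then obtain X where X: "\<And>n. X n \<in> U" "\<And>n. J (X n) < m + inverse (real (Suc n))"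
    by metis
  have parallelogram: "ip (u - v) (u - v) \<le> 2 * (J u - m) + 2 * (J v - m)"
    if "u \<in> U" "v \<in> U" for u v
  proof -
    have "l ((1/2) *\<^sub>R (u + v)) = (l u + l v) / 2"
      using that memU add scale by simp
    then have "4 * J ((1/2) *\<^sub>R (u + v)) = 2 * J u + 2 * J v - ip (u - v) (u - v)"
      using that memH ip_commute[of u v] by (simp add: J_def ip_simps algebra_simps)
    moreover have "m \<le> J ((1/2) *\<^sub>R (u + v))"
      by (rule m_le[OF memU(2)[OF memU(1)[OF that] that(1)]])
    ultimately show ?thesis by simp
  qed
  have "X \<in> cauchy_seqs H ip"
    unfolding cauchy_seqs_def
  proof (intro CollectI conjI allI impI)
    fix e :: real
    assume e: "0 < e"
    then obtain N where N: "inverse (real (Suc N)) < e\<^sup>2 / 4"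
      using reals_Archimedean[of "e\<^sup>2 / 4"] by auto
    have small: "2 * (J (X i) - m) < e\<^sup>2 / 2" if "N \<le> i" for i
    proof -
      have "inverse (real (Suc i)) \<le> inverse (real (Suc N))"
        using that by (intro le_imp_inverse_le) auto
      then have "J (X i) - m < e\<^sup>2 / 4"
        using X(2)[of i] N by linarith
      then show ?thesis by simp
    qed
    have "nrm (X i - X j) < e" if "N \<le> i" "N \<le> j" for i j
    proof -
      have "(nrm (X i - X j))\<^sup>2 < e\<^sup>2"
        using parallelogram[of "X i" "X j"] small[of i] small[of j] that X(1) memH
          nrm_sq[of "X i - X j"] by auto
      then show ?thesis using e by (simp add: power2_less_imp_less)
    qed
    then show "\<exists>N. \<forall>i\<ge>N. \<forall>j\<ge>N. nrm (X i - X j) < e" by blast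
  qed (use X memH in auto)
  then obtain w where w: "w \<in> H" "(\<lambda>n. nrm (X n - w)) \<longlonglongrightarrow> 0"
    using limit_exists by blast
  have "ip w u = l u" if u: "u \<in> U" for u
  proof (cases "u = 0")
    case True
    then show ?thesis using w scale[OF u, of 0] by simp
  next
    case False
    then have pos: "0 < ip u u" using ip_pos memH u by simp
    \<comment> \<open>Minimality up to \<open>1/(n+1)\<close> in direction \<open>u\<close>, at the best step length.\<close>
    have "\<bar>(ip (X n) u - l u)\<^sup>2\<bar> \<le> ip u u * inverse (real (Suc n))" for n
    proof -
      define d t where "d = ip (X n) u - l u" and "t = - d / ip u u"
      have "m \<le> J (X n + t *\<^sub>R u)"
        by (rule m_le[OF memU(1)[OF X(1) memU(2)[OF u u]]])
      also have "J (X n + t *\<^sub>R u) = J (X n) + 2 * t * d + t\<^sup>2 * ip u u"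
        using X(1)[of n] u memU add scale memH ip_commute[of u "X n"]
        by (simp add: J_def d_def ip_simps algebra_simps power2_eq_square)
      also have "\<dots> = J (X n) - d\<^sup>2 / ip u u"
        using pos by (simp add: t_def field_simps power2_eq_square)
      finally have "d\<^sup>2 / ip u u \<le> inverse (real (Suc n))"
        using X(2)[of n] by simp
      then show ?thesis using pos by (simp add: d_def field_simps)
    qed
    moreover have "(\<lambda>n. ip u u * inverse (real (Suc n))) \<longlonglongrightarrow> 0"
      using tendsto_mult_left[OF LIMSEQ_inverse_real_of_nat, of "ip u u"] by simp
    ultimately have "(\<lambda>n. (ip (X n) u - l u)\<^sup>2) \<longlonglongrightarrow> 0"
      by (rule tendsto_0_of_abs_le)
    then have "(\<lambda>n. ip (X n) u - l u) \<longlonglongrightarrow> 0" by simp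
    moreover have "(\<lambda>n. ip (X n) u) \<longlonglongrightarrow> ip w u"
      using ip_tendsto_left[of X w u] X memH w u by blast
    ultimately show ?thesis
      by (metis LIM_zero_cancel LIMSEQ_unique)
  qed
  then show ?thesis using X(1) w by blast
qed

lemma riesz:
  assumes "\<And>u v. u \<in> H \<Longrightarrow> v \<in> H \<Longrightarrow> l (u + v) = l u + l v"
    and "\<And>a u. u \<in> H \<Longrightarrow> l (a *\<^sub>R u) = a * l u"
    and "\<And>u. u \<in> H \<Longrightarrow> \<bar>l u\<bar> \<le> C * nrm u"
  shows "\<exists>!w. w \<in> H \<and> (\<forall>u\<in>H. ip w u = l u)"
proof -
  obtain w where w: "w \<in> H" "\<forall>u\<in>H. ip w u = l u"
    using riesz_on_subspace[OF subspace_H order_refl assms] by blast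
  moreover have "w' = w" if "w' \<in> H" "\<forall>u\<in>H. ip w' u = l u" for w'
    using that w ip_eq_0_iff[of "w' - w"] by (simp add: ip_simps)
  ultimately show ?thesis by blast
qed

end

section \<open>The completion of a space of covectors\<close>

text \<open>
  The linear algebra behind the isometry.  A space \<open>V\<close> of covectors is mapped by \<open>B\<close> into a Hilbert
  space \<open>H\<close> and carries the pulled back inner product; \<open>C\<close> is linear on \<open>H\<close>, and its kernel is the
  orthogonal complement of the range of \<open>B\<close>.  Hence \<open>C\<close> is injective on the closure of the range of
  \<open>B\<close>, has the same image there as on all of \<open>H\<close>, and that closure is the completion of \<open>V\<close>.
\<close>

locale covector_completion = hilbert_on H ip
  for H :: "'a::real_vector set" and ip +
  fixes V :: "'v::real_vector set" and B :: "'v \<Rightarrow> 'a" and C :: "'a \<Rightarrow> 'c::real_vector"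
    and b :: "'v \<Rightarrow> 'v \<Rightarrow> real"
  assumes subspace_V: "subspace V"
    and B_mem: "f \<in> V \<Longrightarrow> B f \<in> H"
    and B_add: "f \<in> V \<Longrightarrow> h \<in> V \<Longrightarrow> B (f + h) = B f + B h"
    and B_scale: "f \<in> V \<Longrightarrow> B (a *\<^sub>R f) = a *\<^sub>R B f"
    and b_eq: "f \<in> V \<Longrightarrow> h \<in> V \<Longrightarrow> b f h = ip (B f) (B h)"
    and C_add: "v \<in> H \<Longrightarrow> w \<in> H \<Longrightarrow> C (v + w) = C v + C w"
    and C_scale: "v \<in> H \<Longrightarrow> C (a *\<^sub>R v) = a *\<^sub>R C v"
    and C_eq_0_iff: "v \<in> H \<Longrightarrow> C v = 0 \<longleftrightarrow> (\<forall>f\<in>V. ip (B f) v = 0)"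
begin

definition approximates :: "(nat \<Rightarrow> 'v) \<Rightarrow> 'a \<Rightarrow> bool" where
  "approximates X w \<longleftrightarrow> (\<forall>n. X n \<in> V) \<and> w \<in> H \<and> (\<lambda>n. nrm (B (X n) - w)) \<longlonglongrightarrow> 0"

definition range_closure :: "'a set" where
  "range_closure = {w. \<exists>X. approximates X w}"

definition quotient_norm :: "'c \<Rightarrow> real" where
  "quotient_norm \<sigma> = Inf {nrm v |v. v \<in> H \<and> C v = \<sigma>}"

lemma mem_V [intro]:
  "f \<in> V \<Longrightarrow> h \<in> V \<Longrightarrow> f + h \<in> V" "f \<in> V \<Longrightarrow> h \<in> V \<Longrightarrow> f - h \<in> V" "f \<in> V \<Longrightarrow> a *\<^sub>R f \<in> V"
  using subspace_V by (auto intro: subspace_add subspace_diff subspace_scale)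

lemma B_diff: "f \<in> V \<Longrightarrow> h \<in> V \<Longrightarrow> B (f - h) = B f - B h"
  using B_add[of f "- 1 *\<^sub>R h"] B_scale[of h "- 1"] mem_V(3)[of h "- 1"] by simp

lemma C_diff: "v \<in> H \<Longrightarrow> w \<in> H \<Longrightarrow> C (v - w) = C v - C w"
  using C_add[of v "- 1 *\<^sub>R w"] C_scale[of w "- 1"] by simp

lemma semi_norm_b: "f \<in> V \<Longrightarrow> h \<in> V \<Longrightarrow> semi_norm b (f - h) = nrm (B f - B h)"
  by (simp add: semi_norm_def b_eq mem_V B_diff)

lemma approximates_mem:
  assumes "approximates X w"
  shows "X n \<in> V" "B (X n) \<in> H" "w \<in> H"
  using assms by (auto simp: approximates_def B_mem)

lemma range_closure_subset: "w \<in> range_closure \<Longrightarrow> w \<in> H"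
  by (auto simp: range_closure_def approximates_mem)

lemma approximates_unique: "approximates X w \<Longrightarrow> approximates X u \<Longrightarrow> w = u"
  by (rule limit_unique[of "\<lambda>n. B (X n)"]) (auto simp: approximates_def B_mem)

lemma approximates_const: "f \<in> V \<Longrightarrow> approximates (\<lambda>_. f) (B f)"
  using nrm_eq_0_iff[of 0] by (simp add: approximates_def B_mem)

lemma approximates_add:
  assumes "approximates X w" "approximates Y u"
  shows "approximates (\<lambda>n. X n + Y n) (w + u)"
proof -
  note m = approximates_mem[OF assms(1)] approximates_mem[OF assms(2)]
  have "(\<lambda>n. nrm (B (X n + Y n) - (w + u))) \<longlonglongrightarrow> 0"
  proof (rule tendsto_0_of_nrm_le)
    have eq: "B (X n + Y n) - (w + u) = (B (X n) - w) + (B (Y n) - u)" for n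
      using m by (simp add: B_add)
    show "nrm (B (X n + Y n) - (w + u)) \<le> nrm (B (X n) - w) + nrm (B (Y n) - u)" for n
      unfolding eq using m by (intro nrm_triangle mem_H)
    show "(\<lambda>n. nrm (B (X n) - w) + nrm (B (Y n) - u)) \<longlonglongrightarrow> 0"
      using assms by (intro tendsto_add_zero) (simp_all add: approximates_def)
  qed (use m in \<open>auto simp: B_add\<close>)
  then show ?thesis using m by (auto simp: approximates_def)
qed

lemma approximates_scale:
  assumes "approximates X w"
  shows "approximates (\<lambda>n. a *\<^sub>R X n) (a *\<^sub>R w)"
proof -
  note m = approximates_mem[OF assms]
  have "nrm (B (a *\<^sub>R X n) - a *\<^sub>R w) = \<bar>a\<bar> * nrm (B (X n) - w)" for n
    using m nrm_scale[of "B (X n) - w" a] by (simp add: B_scale scaleR_diff_right)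
  moreover have "(\<lambda>n. \<bar>a\<bar> * nrm (B (X n) - w)) \<longlonglongrightarrow> 0"
    using assms by (auto simp: approximates_def intro: tendsto_mult_right_zero)
  ultimately show ?thesis using m by (auto simp: approximates_def)
qed

lemma cauchy_iff_approximates: "X \<in> cauchy_seqs V b \<longleftrightarrow> (\<exists>w. approximates X w)"
proof
  assume X: "X \<in> cauchy_seqs V b"
  then have V: "X n \<in> V" for n
    by (simp add: cauchy_seqs_def)
  with X have "(\<lambda>n. B (X n)) \<in> cauchy_seqs H ip"
    unfolding cauchy_seqs_def using semi_norm_b[OF V V] by (simp add: B_mem)
  then show "\<exists>w. approximates X w"
    using V limit_exists[of "\<lambda>n. B (X n)"] by (auto simp: approximates_def)
next
  assume "\<exists>w. approximates X w"
  then obtain w where w: "approximates X w" ..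
  then have "(\<lambda>n. B (X n)) \<in> cauchy_seqs H ip"
    using convergent_imp_cauchy[of "\<lambda>n. B (X n)" w] by (simp add: approximates_def B_mem)
  then show "X \<in> cauchy_seqs V b"
    using w by (simp add: cauchy_seqs_def semi_norm_b approximates_def)
qed

lemma completion_rel_iff:
  assumes w: "approximates X w"
  shows "(X, Y) \<in> completion_rel V b \<longleftrightarrow> approximates Y w"
proof
  assume "(X, Y) \<in> completion_rel V b"
  then have Y: "Y \<in> cauchy_seqs V b" and d: "(\<lambda>n. semi_norm b (X n - Y n)) \<longlonglongrightarrow> 0"
    by (auto simp: completion_rel_def)
  from Y have V: "Y n \<in> V" for n by (simp add: cauchy_seqs_def)
  note m = approximates_mem[OF w] B_mem[OF V]
  have "(\<lambda>n. nrm (B (Y n) - w)) \<longlonglongrightarrow> 0"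
  proof (rule tendsto_0_of_nrm_le)
    show "nrm (B (Y n) - w) \<le> nrm (B (X n) - B (Y n)) + nrm (B (X n) - w)" for n
      using nrm_triangle_diff[of "B (Y n)" "B (X n)" w] nrm_diff_commute[of "B (Y n)" "B (X n)"] m
      by simp
    show "(\<lambda>n. nrm (B (X n) - B (Y n)) + nrm (B (X n) - w)) \<longlonglongrightarrow> 0"
      using d w V m by (intro tendsto_add_zero) (simp_all add: semi_norm_b approximates_def)
  qed (use m in auto)
  then show "approximates Y w" using V m by (simp add: approximates_def)
next
  assume Y: "approximates Y w"
  note m = approximates_mem[OF w] approximates_mem[OF Y]
  have "(\<lambda>n. nrm (B (X n) - B (Y n))) \<longlonglongrightarrow> 0"
  proof (rule tendsto_0_of_nrm_le)
    show "nrm (B (X n) - B (Y n)) \<le> nrm (B (X n) - w) + nrm (B (Y n) - w)" for n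
      using nrm_triangle_diff[of "B (X n)" w "B (Y n)"] nrm_diff_commute[of w "B (Y n)"] m by simp
    show "(\<lambda>n. nrm (B (X n) - w) + nrm (B (Y n) - w)) \<longlonglongrightarrow> 0"
      using w Y by (intro tendsto_add_zero) (simp_all add: approximates_def)
  qed (use m in auto)
  then show "(X, Y) \<in> completion_rel V b"
    using w Y m cauchy_iff_approximates by (auto simp: completion_rel_def semi_norm_b)
qed

text \<open>
  A class of Cauchy sequences consists of all sequences whose images under \<open>B\<close> have the same limit.
  In terms of that limit all operations of the completion become those of \<open>H\<close>.
\<close>

definition seqs_to :: "'a \<Rightarrow> (nat \<Rightarrow> 'v) set" where "seqs_to w = {X. approximates X w}"

lemma class_eq: "approximates X w \<Longrightarrow> completion_rel V b `` {X} = seqs_to w"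
  by (auto simp: seqs_to_def completion_rel_iff)

lemma completion_eq: "hilbert_completion V b = seqs_to ` range_closure"
proof -
  have "hilbert_completion V b = (\<Union>X\<in>{X. \<exists>w. approximates X w}. {completion_rel V b `` {X}})"
    by (simp add: hilbert_completion_def quotient_def cauchy_iff_approximates[symmetric])
  also have "\<dots> = seqs_to ` range_closure"
    using class_eq by (fastforce simp: range_closure_def)
  finally show ?thesis .
qed

lemma seqs_to_nonempty: "w \<in> range_closure \<Longrightarrow> \<exists>X. X \<in> seqs_to w"
  by (simp add: range_closure_def seqs_to_def)

lemma inj_seqs_to: "inj_on seqs_to range_closure"
  by (rule inj_onI) (metis approximates_unique mem_Collect_eq seqs_to_def seqs_to_nonempty)

lemma range_closure_add: "w \<in> range_closure \<Longrightarrow> u \<in> range_closure \<Longrightarrow> w + u \<in> range_closure"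
  unfolding range_closure_def using approximates_add by blast

lemma range_closure_scale: "w \<in> range_closure \<Longrightarrow> a *\<^sub>R w \<in> range_closure"
  unfolding range_closure_def using approximates_scale by blast

lemma B_range_closure: "f \<in> V \<Longrightarrow> B f \<in> range_closure"
  unfolding range_closure_def using approximates_const by blast

lemma completion_add_seqs:
  assumes "w \<in> range_closure" "u \<in> range_closure"
  shows "completion_add V b (seqs_to w) (seqs_to u) = seqs_to (w + u)"
proof -
  have "completion_rel V b `` {\<lambda>n. X n + Y n} = seqs_to (w + u)"
    if "X \<in> seqs_to w" "Y \<in> seqs_to u" for X Y
    using that class_eq approximates_add by (simp add: seqs_to_def)
  then show ?thesis
    using seqs_to_nonempty[OF assms(1)] seqs_to_nonempty[OF assms(2)]
    by (auto simp: completion_add_def)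
qed

lemma completion_scale_seqs:
  assumes "w \<in> range_closure"
  shows "completion_scale V b a (seqs_to w) = seqs_to (a *\<^sub>R w)"
proof -
  have "completion_rel V b `` {\<lambda>n. a *\<^sub>R X n} = seqs_to (a *\<^sub>R w)" if "X \<in> seqs_to w" for X
    using that class_eq approximates_scale by (simp add: seqs_to_def)
  then show ?thesis
    using seqs_to_nonempty[OF assms] by (auto simp: completion_scale_def)
qed

lemma completion_embed_seqs: "f \<in> V \<Longrightarrow> completion_embed V b f = seqs_to (B f)"
  by (simp add: completion_embed_def class_eq approximates_const)

lemma completion_inner_seqs:
  assumes "w \<in> range_closure" "u \<in> range_closure"
  shows "completion_inner b (seqs_to w) (seqs_to u) = ip w u"
proof -
  have lim: "(\<lambda>n. b (X n) (Y n)) \<longlonglongrightarrow> ip w u" if "approximates X w" "approximates Y u" for X Y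
    using that ip_tendsto[of "\<lambda>n. B (X n)" w "\<lambda>n. B (Y n)" u]
    by (simp add: approximates_def b_eq B_mem)
  obtain X Y where XY: "approximates X w" "approximates Y u"
    using assms by (auto simp: range_closure_def)
  show ?thesis
    unfolding completion_inner_def
  proof (rule the_equality)
    show "\<forall>X\<in>seqs_to w. \<forall>Y\<in>seqs_to u. (\<lambda>n. b (X n) (Y n)) \<longlonglongrightarrow> ip w u"
      using lim by (simp add: seqs_to_def)
    show "r = ip w u" if "\<forall>X\<in>seqs_to w. \<forall>Y\<in>seqs_to u. (\<lambda>n. b (X n) (Y n)) \<longlonglongrightarrow> r" for r
      using that XY LIMSEQ_unique[OF _ lim[OF XY]] by (simp add: seqs_to_def)
  qed
qed

lemma range_closure_orthogonal:
  assumes "w \<in> range_closure" "z \<in> H" "C z = 0"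
  shows "ip w z = 0"
proof -
  obtain X where X: "approximates X w" using assms by (auto simp: range_closure_def)
  have "(\<lambda>n. ip (B (X n)) z) \<longlonglongrightarrow> ip w z"
    using X assms(2) ip_tendsto_left[of "\<lambda>n. B (X n)" w z] by (simp add: approximates_def B_mem)
  moreover have "ip (B (X n)) z = 0" for n
    using C_eq_0_iff assms approximates_mem[OF X] by blast
  ultimately show ?thesis by (simp add: LIMSEQ_const_iff)
qed

text \<open>
  Vectors with the same image under \<open>C\<close> differ by an element of the kernel, which is orthogonal to
  \<open>w\<close>; the strict inequality is Pythagoras.
\<close>

lemma nrm_less_of_range_closure:
  assumes w: "w \<in> range_closure" and v: "v \<in> H" "C v = C w" "v \<noteq> w"
  shows "nrm w < nrm v"
proof -
  have H: "w \<in> H" using range_closure_subset[OF w] .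
  have "C (v - w) = 0" using v H by (simp add: C_diff)
  then have "ip w (v - w) = 0"
    using range_closure_orthogonal[OF w, of "v - w"] v H by simp
  then have "ip v v = ip w w + ip (v - w) (v - w)"
    using v H ip_commute[of v w] by (simp add: ip_simps)
  moreover have "0 < ip (v - w) (v - w)"
    using v H by (intro ip_pos) auto
  ultimately show ?thesis by (simp add: semi_norm_def)
qed

lemma C_inj_on_range_closure: "inj_on C range_closure"
proof (rule inj_onI)
  fix w u
  assume "w \<in> range_closure" "u \<in> range_closure" "C w = C u"
  then show "w = u"
    using nrm_less_of_range_closure[of w u] nrm_less_of_range_closure[of u w] range_closure_subset
    by fastforce
qed

text \<open>
  Projecting \<open>v\<close> to the closure of the range of \<open>B\<close> changes it by a vector orthogonal to that range,
  hence by an element of the kernel of \<open>C\<close>.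
\<close>

lemma C_image_range_closure: "C ` range_closure = C ` H"
proof -
  have "\<exists>w\<in>range_closure. C w = C v" if v: "v \<in> H" for v
  proof -
    have sub: "subspace (B ` V)"
      unfolding subspace_def
    proof (intro conjI ballI allI)
      show "0 \<in> B ` V"
        using B_scale[of 0 0] subspace_0[OF subspace_V] by (metis image_eqI scaleR_zero_left)
    qed (auto simp flip: B_add B_scale)
    have "\<bar>ip v u\<bar> \<le> nrm v * nrm u" if "u \<in> B ` V" for u
      using that v cauchy_schwarz B_mem by blast
    then have "\<exists>Y w. (\<forall>n. Y n \<in> B ` V) \<and> w \<in> H \<and> (\<lambda>n. nrm (Y n - w)) \<longlonglongrightarrow> 0 \<and>
        (\<forall>u\<in>B ` V. ip w u = ip v u)"
    proof (rule riesz_on_subspace[OF sub, rotated 3])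
      show BV: "B ` V \<subseteq> H" using B_mem by blast
      show "ip v (x + y) = ip v x + ip v y" if "x \<in> B ` V" "y \<in> B ` V" for x y
        using that BV v by (intro ip_add_right) auto
      show "ip v (a *\<^sub>R x) = a * ip v x" if "x \<in> B ` V" for a x
        using that BV v by (intro ip_scale_right) auto
    qed
    then obtain Y w where Y: "\<And>n. Y n \<in> B ` V" and w: "w \<in> H" "(\<lambda>n. nrm (Y n - w)) \<longlonglongrightarrow> 0"
      "\<And>u. u \<in> B ` V \<Longrightarrow> ip w u = ip v u"
      by blast
    have "\<forall>n. \<exists>f. f \<in> V \<and> Y n = B f"
      using Y by blast
    then obtain X where X: "\<And>n. X n \<in> V" "\<And>n. Y n = B (X n)"
      by metis
    then have "w \<in> range_closure"
      using w by (auto simp: range_closure_def approximates_def)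
    moreover have "C (v - w) = 0"
    proof -
      have "ip (B f) (v - w) = 0" if "f \<in> V" for f
        using v w(1) w(3)[of "B f"] that B_mem[OF that] ip_commute[of w "B f"] ip_commute[of v "B f"]
        by (simp add: ip_diff_right)
      then show ?thesis using v w(1) by (simp add: C_eq_0_iff)
    qed
    ultimately show ?thesis
      using C_diff[OF v w(1)] by (intro bexI[of _ w]) simp_all
  qed
  then show ?thesis
    using range_closure_subset by (intro equalityI image_subsetI) (blast, metis imageI)
qed

lemma quotient_norm_C:
  assumes "w \<in> range_closure"
  shows "quotient_norm (C w) = nrm w"
  unfolding quotient_norm_def
proof (rule cInf_eq_minimum)
  show "nrm w \<in> {nrm v |v. v \<in> H \<and> C v = C w}"
    using range_closure_subset[OF assms] by blast
  show "nrm w \<le> r" if "r \<in> {nrm v |v. v \<in> H \<and> C v = C w}" for r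
    using that nrm_less_of_range_closure[OF assms] by fastforce
qed

lemma isometric_iso_iff:
  "isometric_iso_from_completion V b (C ` H) quotient_norm K \<longleftrightarrow>
     bij_betw (\<lambda>w. K (seqs_to w)) range_closure (C ` H) \<and>
     (\<forall>w\<in>range_closure. \<forall>u\<in>range_closure. K (seqs_to (w + u)) = K (seqs_to w) + K (seqs_to u)) \<and>
     (\<forall>a. \<forall>w\<in>range_closure. K (seqs_to (a *\<^sub>R w)) = a *\<^sub>R K (seqs_to w)) \<and>
     (\<forall>w\<in>range_closure. quotient_norm (K (seqs_to w)) = nrm w)"
proof -
  have "bij_betw seqs_to range_closure (hilbert_completion V b)"
    using inj_seqs_to by (simp add: completion_eq bij_betw_def)
  then have "bij_betw K (hilbert_completion V b) (C ` H) \<longleftrightarrow>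
      bij_betw (\<lambda>w. K (seqs_to w)) range_closure (C ` H)"
    using bij_betw_comp_iff[of seqs_to range_closure "hilbert_completion V b" K "C ` H"]
    by (simp add: comp_def)
  then show ?thesis
    by (simp add: isometric_iso_from_completion_def completion_eq completion_add_seqs
        completion_scale_seqs completion_inner_seqs semi_norm_def)
qed

text \<open>
  For uniqueness, approximate \<open>w\<close> by \<open>B f\<^sub>n\<close>.  If \<open>u\<close> is the representative in the closure of the
  value at \<open>w\<close>, the isometry property at \<open>w - B f\<^sub>n\<close> shows that \<open>B f\<^sub>n\<close> converges to \<open>u\<close> as well.
\<close>

lemma iso_eq_C:
  assumes K: "isometric_iso_from_completion V b (C ` H) quotient_norm K"
    and embed: "\<And>f. f \<in> V \<Longrightarrow> K (completion_embed V b f) = C (B f)"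
    and w: "w \<in> range_closure"
  shows "K (seqs_to w) = C w"
proof -
  note K' = K[unfolded isometric_iso_iff]
  have "K (seqs_to w) \<in> C ` range_closure"
    using K' w bij_betwE by (fastforce simp: C_image_range_closure)
  then obtain u where u: "u \<in> range_closure" "K (seqs_to w) = C u" by blast
  obtain X where X: "approximates X w" using w by (auto simp: range_closure_def)
  note m = approximates_mem[OF X] range_closure_subset[OF u(1)]
  have "nrm (B (X n) - u) = nrm (B (X n) - w)" for n
  proof -
    let ?f = "- 1 *\<^sub>R B (X n)"
    have f: "?f \<in> range_closure" "B (X n) \<in> range_closure"
      using m B_range_closure range_closure_scale by blast+
    have "K (seqs_to (w + ?f)) = C u + - 1 *\<^sub>R C (B (X n))"
      using K' w f u embed[OF m(1)] completion_embed_seqs[OF m(1)] by metis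
    also have "\<dots> = C (u + ?f)"
      using m by (simp only: C_add C_scale mem_H)
    finally have "quotient_norm (C (u + ?f)) = nrm (w + ?f)"
      using K' range_closure_add[OF w f(1)] by metis
    then have "nrm (u + ?f) = nrm (w + ?f)"
      using quotient_norm_C range_closure_add[OF u(1) f(1)] by metis
    then show ?thesis
      using m nrm_diff_commute by simp
  qed
  then have "approximates X u"
    using X m by (simp add: approximates_def)
  then show ?thesis
    using approximates_unique X u by blast
qed

theorem unique_isometric_extension:
  "\<exists>!K. K \<in> extensional (hilbert_completion V b) \<and>
      isometric_iso_from_completion V b (C ` H) quotient_norm K \<and>
      (\<forall>f\<in>V. K (completion_embed V b f) = C (B f))"
proof -
  define K where "K = (\<lambda>P\<in>hilbert_completion V b. C (the_inv_into range_closure seqs_to P))"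
  have K: "K (seqs_to w) = C w" if "w \<in> range_closure" for w
    using that the_inv_into_f_f[OF inj_seqs_to] by (simp add: K_def completion_eq)
  have "bij_betw (\<lambda>w. K (seqs_to w)) range_closure (C ` H)"
    using C_inj_on_range_closure C_image_range_closure K
    by (simp add: bij_betw_def cong: inj_on_cong image_cong)
  then have "isometric_iso_from_completion V b (C ` H) quotient_norm K"
    using range_closure_subset
    by (simp add: isometric_iso_iff K range_closure_add range_closure_scale quotient_norm_C
        C_add C_scale)
  moreover have "K \<in> extensional (hilbert_completion V b)"
    by (simp add: K_def)
  moreover have "\<forall>f\<in>V. K (completion_embed V b f) = C (B f)"
    by (simp add: completion_embed_seqs B_range_closure K)
  moreover have "K' = K"
    if "K' \<in> extensional (hilbert_completion V b)"
      "isometric_iso_from_completion V b (C ` H) quotient_norm K'"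
      "\<forall>f\<in>V. K' (completion_embed V b f) = C (B f)" for K'
  proof (rule extensionalityI[OF that(1)])
    show "K \<in> extensional (hilbert_completion V b)"
      by (simp add: K_def)
    show "K' P = K P" if "P \<in> hilbert_completion V b" for P
      using that iso_eq_C[of K'] K \<open>isometric_iso_from_completion V b (C ` H) quotient_norm K'\<close>
        \<open>\<forall>f\<in>V. K' (completion_embed V b f) = C (B f)\<close> by (auto simp: completion_eq)
  qed
  ultimately show ?thesis by blast
qed

end

section \<open>Positive definite matrices\<close>

lemma linear_vec_eq_sum:
  fixes L :: "real ^ 'n::finite \<Rightarrow> 'c::real_vector"
  assumes "linear L"
  shows "L y = (\<Sum>i\<in>UNIV. (y $ i) *\<^sub>R L (axis i 1))"
proof -
  have "y = (\<Sum>i\<in>UNIV. (y $ i) *\<^sub>R axis i 1)"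
    using basis_expansion[of y] by (simp add: scalar_mult_eq_scaleR)
  then have "L y = L (\<Sum>i\<in>UNIV. (y $ i) *\<^sub>R axis i 1)"
    by simp
  also have "\<dots> = (\<Sum>i\<in>UNIV. (y $ i) *\<^sub>R L (axis i 1))"
    using assms by (simp add: linear_sum linear_scale)
  finally show ?thesis .
qed

lemma Ck_on_det:
  fixes M :: "'a::euclidean_space \<Rightarrow> real ^ 'n ^ 'n"
  assumes "open S" "\<And>i j. Ck_on k (\<lambda>y. M y $ i $ j) S"
  shows "Ck_on k (\<lambda>y. det (M y)) S"
  unfolding det_def using assms
  by (intro Ck_on_sum Ck_on_mult Ck_on_const Ck_on_prod)

text \<open>
  Along the segment from the identity matrix to \<open>M\<close> all matrices are positive definite, so the
  determinant cannot vanish; it is 1 at the start.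
\<close>

lemma det_pos_of_positive_definite:
  fixes M :: "real ^ 'n ^ 'n"
  assumes pos: "\<And>w. w \<noteq> 0 \<Longrightarrow> 0 < w \<bullet> (M *v w)"
  shows "0 < det M"
proof -
  define N where "N t = (\<chi> i j. t * M $ i $ j + (1 - t) * (mat 1 :: real ^ 'n ^ 'n) $ i $ j)" for t :: real
  have Nv: "N t *v w = t *\<^sub>R (M *v w) + (1 - t) *\<^sub>R w" for t w
    by (simp add: vec_eq_iff N_def matrix_vector_mult_def mat_def algebra_simps sum.distrib
        sum_distrib_left if_distrib[of "\<lambda>x. _ * x"] cong: if_cong)
  have nz: "det (N t) \<noteq> 0" if "0 \<le> t" "t \<le> 1" for t
  proof -
    have "w = 0" if "N t *v w = 0" for w
    proof (rule ccontr)
      assume w: "w \<noteq> 0"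
      then have p: "0 < w \<bullet> (M *v w)" "0 < w \<bullet> w" using pos by auto
      have "w \<bullet> (N t *v w) = t * (w \<bullet> (M *v w)) + (1 - t) * (w \<bullet> w)"
        by (simp add: Nv inner_add_right)
      moreover have "0 < t * (w \<bullet> (M *v w)) + (1 - t) * (w \<bullet> w)"
        using p \<open>0 \<le> t\<close> \<open>t \<le> 1\<close> by (cases "t = 0") (auto intro!: add_pos_nonneg)
      ultimately show False using that by simp
    qed
    then show ?thesis
      using matrix_left_invertible_ker invertible_left_inverse invertible_det_nz by metis
  qed
  have "continuous_on {0..1} (\<lambda>t. det (N t))"
    unfolding det_def N_def by (intro continuous_intros | simp)+
  moreover have "N 0 = mat 1" "N 1 = M"
    by (simp_all add: N_def vec_eq_iff)
  ultimately show ?thesis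
    using nz IVT2'[of "\<lambda>t. det (N t)" 1 0 0] by force
qed

lemma scaleR_fun_apply: "(a *\<^sub>R f) x = a *\<^sub>R f x"
  by (simp add: scaleR_fun_def)

section \<open>Charts and tangent vectors\<close>

locale closed_riemannian_manifold =
  fixes A :: "('m::{t2_space, second_countable_topology}, 'n::finite) chart set"
    and g :: "('m, 'n) metric"
    and vol :: "'m measure"
  assumes compact_M: "compact (UNIV :: 'm set)"
    and atlas: "oriented_atlas A"
    and metric: "riemannian_metric A g"
    and volume: "riemannian_volume A g vol"
begin

lemma chart_around: obtains c where "c \<in> A" "x \<in> dom_of c"
proof -
  have "x \<in> (\<Union>c\<in>A. dom_of c)"
    using atlas by (simp add: oriented_atlas_def)
  then show thesis using that by blast
qed

lemma chart:
  assumes "c \<in> A"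
  shows open_dom: "open (dom_of c)" and open_img: "open (img_of c)"
    and homeo: "homeomorphism (dom_of c) (img_of c) (coord c) (chart_inv c)"
  using atlas assms by (auto simp: oriented_atlas_def is_chart_def)

lemma chart_simps [simp]:
  assumes "c \<in> A"
  shows "x \<in> dom_of c \<Longrightarrow> chart_inv c (coord c x) = x"
    and "y \<in> img_of c \<Longrightarrow> coord c (chart_inv c y) = y"
    and "y \<in> img_of c \<Longrightarrow> chart_inv c y \<in> dom_of c"
  using homeo[OF assms] by (auto simp: homeomorphism_def)

lemma continuous_coord: "c \<in> A \<Longrightarrow> continuous_on (dom_of c) (coord c)"
  and continuous_chart_inv: "c \<in> A \<Longrightarrow> continuous_on (img_of c) (chart_inv c)"
  using homeo by (auto simp: homeomorphism_def)

lemma coord_image_eq: "c \<in> A \<Longrightarrow> coord c ` (dom_of c \<inter> U) = img_of c \<inter> chart_inv c -` U"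
  by force

lemma open_coord_image: "c \<in> A \<Longrightarrow> open U \<Longrightarrow> open (coord c ` (dom_of c \<inter> U))"
  unfolding coord_image_eq by (intro continuous_open_preimage continuous_chart_inv open_img)

lemma continuous_on_charts:
  assumes "\<And>c. c \<in> A \<Longrightarrow> continuous_on (dom_of c) h"
  shows "continuous_on UNIV h"
proof -
  have "continuous_on (\<Union>c\<in>A. dom_of c) h"
    using assms open_dom by (intro continuous_on_open_UN) auto
  then show ?thesis using atlas by (simp add: oriented_atlas_def)
qed

lemma continuous_on_dom_iff:
  assumes "c \<in> A"
  shows "continuous_on (dom_of c) h \<longleftrightarrow> continuous_on (img_of c) (\<lambda>y. h (chart_inv c y))"
proof
  assume "continuous_on (dom_of c) h"
  then show "continuous_on (img_of c) (\<lambda>y. h (chart_inv c y))"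
    using assms by (intro continuous_on_compose2[OF _ continuous_chart_inv]) auto
next
  assume "continuous_on (img_of c) (\<lambda>y. h (chart_inv c y))"
  then have "continuous_on (dom_of c) (\<lambda>x. h (chart_inv c (coord c x)))"
    using assms by (intro continuous_on_compose2[OF _ continuous_coord]) auto
  then show "continuous_on (dom_of c) h"
    using assms by (simp cong: continuous_on_cong)
qed

lemma Ck_on_transition:
  "c \<in> A \<Longrightarrow> d \<in> A \<Longrightarrow> Ck_on k (transition c d) (coord c ` (dom_of c \<inter> dom_of d))"
  using atlas by (simp add: oriented_atlas_def smooth_on_def)

abbreviation D_transition :: "('m, 'n) chart \<Rightarrow> ('m, 'n) chart \<Rightarrow> 'm \<Rightarrow> real ^ 'n \<Rightarrow> real ^ 'n" where
  "D_transition c d x \<equiv> frechet_derivative (transition c d) (at (coord c x))"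

lemma transition_has_derivative:
  assumes "c \<in> A" "d \<in> A" "x \<in> dom_of c" "x \<in> dom_of d"
  shows "(transition c d has_derivative D_transition c d x) (at (coord c x))"
  using Ck_on_SucD(1)[OF Ck_on_transition[OF assms(1,2), of "Suc 0"]] assms by blast

lemma linear_D_transition:
  assumes "c \<in> A" "d \<in> A" "x \<in> dom_of c" "x \<in> dom_of d"
  shows "linear (D_transition c d x)"
  using has_derivative_linear[OF transition_has_derivative[OF assms]] .

text \<open>
  The chain rule for a map seen in two charts.  With the map a further chart it is the cocycle
  property of the transition maps, with the map a real function it is the coordinate invariance of
  the differential.
\<close>

lemma has_derivative_change_chart:
  assumes "c \<in> A" "d \<in> A" "x \<in> dom_of c" "x \<in> dom_of d"
    and "((h \<circ> chart_inv d) has_derivative D) (at (coord d x))"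
  shows "((h \<circ> chart_inv c) has_derivative (\<lambda>w. D (D_transition c d x w))) (at (coord c x))"
proof -
  let ?S = "coord c ` (dom_of c \<inter> dom_of d)"
  have x: "coord d x = transition c d (coord c x)"
    using assms by (simp add: transition_def)
  have "((\<lambda>y. (h \<circ> chart_inv d) (transition c d y)) has_derivative
      (\<lambda>w. D (D_transition c d x w))) (at (coord c x))"
    using has_derivative_compose[OF transition_has_derivative[OF assms(1-4)]] assms(5) x by metis
  moreover have "(h \<circ> chart_inv d) (transition c d y) = (h \<circ> chart_inv c) y" if "y \<in> ?S" for y
    using that assms by (auto simp: transition_def)
  moreover have "open ?S" "coord c x \<in> ?S"
    using assms open_coord_image open_dom by auto
  ultimately show ?thesis
    using has_derivative_transform_within_open by blast
qed

lemma D_transition_comp: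
  assumes "c \<in> A" "d \<in> A" "e \<in> A" "x \<in> dom_of c" "x \<in> dom_of d" "x \<in> dom_of e"
  shows "D_transition c e x w = D_transition d e x (D_transition c d x w)"
proof -
  have "((coord e \<circ> chart_inv d) has_derivative D_transition d e x) (at (coord d x))"
    using transition_has_derivative[OF assms(2,3,5,6)] by (simp only: transition_def)
  from has_derivative_change_chart[OF assms(1,2,4,5) this]
  have "(transition c e has_derivative (\<lambda>w. D_transition d e x (D_transition c d x w))) (at (coord c x))"
    by (simp only: transition_def)
  then show ?thesis
    by (simp add: frechet_derivative_at[symmetric])
qed

lemma D_transition_self:
  assumes "c \<in> A" "x \<in> dom_of c"
  shows "D_transition c c x w = w"
proof -
  have "(transition c c has_derivative (\<lambda>w. w)) (at (coord c x))"
    by (rule has_derivative_transform_within_open[of "\<lambda>y. y" _ _ UNIV "img_of c"])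
      (use assms open_img in \<open>auto simp: transition_def\<close>)
  then show ?thesis
    by (simp add: frechet_derivative_at[symmetric])
qed

lemma coord_vec_mem:
  assumes "c \<in> A" "x \<in> dom_of c"
  shows "coord_vec A c x w \<in> tangent_space A x"
  unfolding tangent_space_def mem_Collect_eq
proof (intro conjI ballI allI impI)
  fix d e
  assume "d \<in> A" "e \<in> A" "x \<in> dom_of d" "x \<in> dom_of e"
  then show "coord_vec A c x w e = D_transition d e x (coord_vec A c x w d)"
    using D_transition_comp[of c d e x w] assms by (simp only: coord_vec_def if_True simp_thms)
qed (auto simp: coord_vec_def)

lemma coord_vec_apply [simp]: "c \<in> A \<Longrightarrow> x \<in> dom_of c \<Longrightarrow> coord_vec A c x w c = w"
  by (simp add: coord_vec_def D_transition_self)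

lemma tangent_change_chart:
  assumes "\<xi> \<in> tangent_space A x" "c \<in> A" "d \<in> A" "x \<in> dom_of c" "x \<in> dom_of d"
  shows "\<xi> d = D_transition c d x (\<xi> c)"
  using assms unfolding tangent_space_def mem_Collect_eq by blast

lemma tangent_eq_0:
  assumes "\<xi> \<in> tangent_space A x" "\<not> (d \<in> A \<and> x \<in> dom_of d)"
  shows "\<xi> d = 0"
  using assms unfolding tangent_space_def mem_Collect_eq by blast

lemma coord_vec_of_tangent:
  assumes "c \<in> A" "x \<in> dom_of c" "\<xi> \<in> tangent_space A x"
  shows "coord_vec A c x (\<xi> c) = \<xi>"
proof
  show "coord_vec A c x (\<xi> c) d = \<xi> d" for d
    using tangent_change_chart[OF assms(3,1) _ assms(2), of d] tangent_eq_0[OF assms(3), of d]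
    by (cases "d \<in> A \<and> x \<in> dom_of d") (simp_all only: coord_vec_def if_True if_False simp_thms)
qed

lemma linear_coord_vec:
  assumes "c \<in> A" "x \<in> dom_of c"
  shows "linear (coord_vec A c x)"
  by (rule linearI; rule ext)
    (use assms in \<open>auto simp: coord_vec_def scaleR_fun_def linear_add[OF linear_D_transition]
      linear_scale[OF linear_D_transition]\<close>)

lemma tangentI:
  assumes "\<And>c d. c \<in> A \<Longrightarrow> d \<in> A \<Longrightarrow> x \<in> dom_of c \<Longrightarrow> x \<in> dom_of d \<Longrightarrow> \<xi> d = D_transition c d x (\<xi> c)"
    and "\<And>c. \<not> (c \<in> A \<and> x \<in> dom_of c) \<Longrightarrow> \<xi> c = 0"
  shows "\<xi> \<in> tangent_space A x"
  using assms unfolding tangent_space_def mem_Collect_eq by blast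

lemma subspace_tangent: "subspace (tangent_space A x)"
  unfolding subspace_def
proof (intro conjI ballI allI)
  show "0 \<in> tangent_space A x"
    by (rule tangentI) (simp_all add: linear_0[OF linear_D_transition])
next
  fix \<xi> \<eta>
  assume T: "\<xi> \<in> tangent_space A x" "\<eta> \<in> tangent_space A x"
  show "\<xi> + \<eta> \<in> tangent_space A x"
  proof (rule tangentI)
    fix c d
    assume cd: "c \<in> A" "d \<in> A" "x \<in> dom_of c" "x \<in> dom_of d"
    show "(\<xi> + \<eta>) d = D_transition c d x ((\<xi> + \<eta>) c)"
      unfolding plus_fun_apply linear_add[OF linear_D_transition[OF cd]]
        tangent_change_chart[OF T(1) cd] tangent_change_chart[OF T(2) cd] ..
  qed (simp add: tangent_eq_0[OF T(1)] tangent_eq_0[OF T(2)])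
next
  fix a \<xi>
  assume T: "\<xi> \<in> tangent_space A x"
  show "a *\<^sub>R \<xi> \<in> tangent_space A x"
  proof (rule tangentI)
    fix c d
    assume cd: "c \<in> A" "d \<in> A" "x \<in> dom_of c" "x \<in> dom_of d"
    show "(a *\<^sub>R \<xi>) d = D_transition c d x ((a *\<^sub>R \<xi>) c)"
      unfolding scaleR_fun_def linear_scale[OF linear_D_transition[OF cd]]
        tangent_change_chart[OF T cd] ..
  qed (simp add: scaleR_fun_def tangent_eq_0[OF T])
qed

section \<open>The metric in coordinates\<close>

lemma g_inner: "inner_product_on (tangent_space A x) (g x)"
  using metric by (simp add: riemannian_metric_def)

lemma g_commute:
  "\<xi> \<in> tangent_space A x \<Longrightarrow> \<eta> \<in> tangent_space A x \<Longrightarrow> g x \<xi> \<eta> = g x \<eta> \<xi>"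
  using g_inner[of x, unfolded inner_product_on_def, THEN conjunct1] by blast

lemma g_add_left:
  "\<xi> \<in> tangent_space A x \<Longrightarrow> \<xi>' \<in> tangent_space A x \<Longrightarrow> \<eta> \<in> tangent_space A x \<Longrightarrow>
    g x (\<xi> + \<xi>') \<eta> = g x \<xi> \<eta> + g x \<xi>' \<eta>"
  using g_inner[of x, unfolded inner_product_on_def, THEN conjunct2, THEN conjunct1] by blast

lemma g_scale_left:
  "\<xi> \<in> tangent_space A x \<Longrightarrow> \<eta> \<in> tangent_space A x \<Longrightarrow> g x (a *\<^sub>R \<xi>) \<eta> = a * g x \<xi> \<eta>"
  using g_inner[of x, unfolded inner_product_on_def, THEN conjunct2, THEN conjunct2, THEN conjunct1]
  by blast

lemma g_pos: "\<xi> \<in> tangent_space A x \<Longrightarrow> \<xi> \<noteq> 0 \<Longrightarrow> 0 < g x \<xi> \<xi>"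
  using g_inner[of x, unfolded inner_product_on_def, THEN conjunct2, THEN conjunct2, THEN conjunct2]
  by blast

lemma g_diff_left:
  assumes "\<xi> \<in> tangent_space A x" "\<xi>' \<in> tangent_space A x" "\<eta> \<in> tangent_space A x"
  shows "g x (\<xi> - \<xi>') \<eta> = g x \<xi> \<eta> - g x \<xi>' \<eta>"
  using g_add_left[of \<xi> x "- 1 *\<^sub>R \<xi>'" \<eta>] g_scale_left[of \<xi>' x \<eta> "- 1"]
    subspace_scale[OF subspace_tangent, of \<xi>' x "- 1"] assms by simp

lemma g_scale_right:
  assumes "\<xi> \<in> tangent_space A x" "\<eta> \<in> tangent_space A x"
  shows "g x \<eta> (a *\<^sub>R \<xi>) = a * g x \<eta> \<xi>"
  using assms g_scale_left[of \<xi> x \<eta> a] g_commute[of "a *\<^sub>R \<xi>" x \<eta>] g_commute[of \<xi> x \<eta>]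
    subspace_scale[OF subspace_tangent] by simp

lemma g_coord:
  assumes c: "c \<in> A" "x \<in> dom_of c" and T: "\<xi> \<in> tangent_space A x" "\<eta> \<in> tangent_space A x"
  shows "g x \<xi> \<eta> = \<eta> c \<bullet> (gram A g c x *v \<xi> c)"
proof -
  let ?v = "coord_vec A c x"
  note v = coord_vec_mem[OF c]
  have left: "linear (\<lambda>w. g x (?v w) (?v u))" for u
    using v by (intro linearI)
      (simp_all add: linear_add[OF linear_coord_vec[OF c]] linear_scale[OF linear_coord_vec[OF c]]
        g_add_left g_scale_left)
  have right: "linear (\<lambda>w. g x (?v u) (?v w))" for u
    using left[of u] g_commute[OF v v] by simp
  have "g x \<xi> \<eta> = g x (?v (\<xi> c)) (?v (\<eta> c))"
    using coord_vec_of_tangent[OF c] T by simp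
  also have "\<dots> = (\<Sum>j\<in>UNIV. \<xi> c $ j *\<^sub>R g x (?v (axis j 1)) (?v (\<eta> c)))"
    by (rule linear_vec_eq_sum[OF left])
  also have "\<dots> = (\<Sum>j\<in>UNIV. \<xi> c $ j * (\<Sum>i\<in>UNIV. \<eta> c $ i * gram A g c x $ j $ i))"
    by (simp add: linear_vec_eq_sum[OF right, of _ "\<eta> c"] gram_def)
  also have "\<dots> = (\<Sum>j\<in>UNIV. \<xi> c $ j * (\<Sum>i\<in>UNIV. \<eta> c $ i * gram A g c x $ i $ j))"
    using g_commute[OF v v] by (simp add: gram_def)
  also have "\<dots> = \<eta> c \<bullet> (gram A g c x *v \<xi> c)"
    by (simp add: inner_vec_def matrix_vector_mult_def sum_distrib_left)
      (subst sum.swap, simp add: mult_ac)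
  finally show ?thesis .
qed

lemma det_gram_pos:
  assumes c: "c \<in> A" "x \<in> dom_of c"
  shows "0 < det (gram A g c x)"
proof (rule det_pos_of_positive_definite)
  fix w :: "real ^ 'n"
  assume "w \<noteq> 0"
  then have "coord_vec A c x w \<noteq> 0"
    using coord_vec_apply[OF c, of w] by fastforce
  then show "0 < w \<bullet> (gram A g c x *v w)"
    using g_pos[OF coord_vec_mem[OF c]] g_coord[OF c coord_vec_mem[OF c] coord_vec_mem[OF c]] c
    by force
qed

abbreviation local_density :: "('m, 'n) chart \<Rightarrow> real ^ 'n \<Rightarrow> real" where
  "local_density c y \<equiv> vol_density A g c (chart_inv c y)"

lemma vol_density_pos: "c \<in> A \<Longrightarrow> x \<in> dom_of c \<Longrightarrow> 0 < vol_density A g c x"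
  by (simp add: vol_density_def det_gram_pos)

lemma Ck_on_gram: "c \<in> A \<Longrightarrow> Ck_on k (\<lambda>y. gram A g c (chart_inv c y) $ i $ j) (img_of c)"
  using metric by (simp add: riemannian_metric_def smooth_on_def)

lemma Ck_on_det_gram: "c \<in> A \<Longrightarrow> Ck_on k (\<lambda>y. det (gram A g c (chart_inv c y))) (img_of c)"
  by (intro Ck_on_det Ck_on_gram open_img)

lemma Ck_on_local_density: "c \<in> A \<Longrightarrow> Ck_on k (local_density c) (img_of c)"
  unfolding vol_density_def
  by (rule Ck_on_compose[OF open_img _ Ck_on_sqrt Ck_on_det_gram]) (auto simp: det_gram_pos)

lemma continuous_gram: "c \<in> A \<Longrightarrow> continuous_on (dom_of c) (\<lambda>x. gram A g c x $ i $ j)"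
  using Ck_on_imp_continuous[OF Ck_on_gram] by (simp add: continuous_on_dom_iff)

definition continuous_field :: "('m \<Rightarrow> ('m, 'n) tvec) \<Rightarrow> bool" where
  "continuous_field u \<longleftrightarrow> u \<in> vector_fields A \<and> (\<forall>c\<in>A. continuous_on (dom_of c) (\<lambda>x. u x c))"

lemma continuous_field_gram:
  "continuous_field u \<Longrightarrow> c \<in> A \<Longrightarrow> continuous_on (dom_of c) (\<lambda>x. gram A g c x *v u x c)"
  unfolding matrix_vector_mult_def continuous_field_def
  by (intro continuous_on_vec_lambda continuous_on_sum continuous_on_mult continuous_gram
      continuous_on_component) auto

lemma continuous_inner_fields:
  assumes "continuous_field u" "continuous_field v"
  shows "continuous_on UNIV (\<lambda>x. g x (u x) (v x))"
proof (rule continuous_on_charts)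
  fix c
  assume c: "c \<in> A"
  have "continuous_on (dom_of c) (\<lambda>x. v x c \<bullet> (gram A g c x *v u x c))"
    using assms(2) c
    by (intro continuous_on_inner continuous_field_gram[OF assms(1)]) (auto simp: continuous_field_def)
  moreover have "g x (u x) (v x) = v x c \<bullet> (gram A g c x *v u x c)" if "x \<in> dom_of c" for x
    using g_coord[OF c that] assms by (simp add: continuous_field_def vector_fields_def)
  ultimately show "continuous_on (dom_of c) (\<lambda>x. g x (u x) (v x))"
    by (simp cong: continuous_on_cong)
qed

section \<open>The gradient\<close>

abbreviation Cinf :: "('m \<Rightarrow> real) set" where "Cinf \<equiv> smooth_functions A"

lemma Cinf_Ck: "f \<in> Cinf \<Longrightarrow> c \<in> A \<Longrightarrow> Ck_on k (f \<circ> chart_inv c) (img_of c)"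
  by (simp add: smooth_functions_def smooth_on_def)

lemma CinfI: "(\<And>c k. c \<in> A \<Longrightarrow> Ck_on k (f \<circ> chart_inv c) (img_of c)) \<Longrightarrow> f \<in> Cinf"
  by (simp add: smooth_functions_def smooth_on_def)

lemma Cinf_continuous:
  assumes "f \<in> Cinf"
  shows "continuous_on UNIV f"
  by (rule continuous_on_charts)
    (use Ck_on_imp_continuous[OF Cinf_Ck[OF assms, of _ 0]] in \<open>simp add: continuous_on_dom_iff comp_def\<close>)

lemma Cinf_has_derivative:
  assumes "f \<in> Cinf" "c \<in> A" "x \<in> dom_of c"
  shows "((f \<circ> chart_inv c) has_derivative frechet_derivative (f \<circ> chart_inv c) (at (coord c x)))
    (at (coord c x))"
  using Ck_on_SucD(1)[OF Cinf_Ck[OF assms(1,2), of "Suc 0"]] assms(3) by blast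

lemma differential_change_chart:
  assumes f: "f \<in> Cinf" and "c \<in> A" "d \<in> A" "x \<in> dom_of c" "x \<in> dom_of d"
    and "\<eta> \<in> tangent_space A x"
  shows "frechet_derivative (f \<circ> chart_inv c) (at (coord c x)) (\<eta> c) =
    frechet_derivative (f \<circ> chart_inv d) (at (coord d x)) (\<eta> d)"
proof -
  have "\<eta> d = D_transition c d x (\<eta> c)"
    using tangent_change_chart assms by blast
  then show ?thesis
    using frechet_derivative_at[OF has_derivative_change_chart[OF assms(2-5)
          Cinf_has_derivative[OF f assms(3,5)]]] by metis
qed

text \<open>
  In a chart the gradient is the solution of the linear system given by the Gram matrix.  Cramer's
  rule, rather than mere solvability, shows that it depends continuously on the point.
\<close>

definition local_grad :: "('m \<Rightarrow> real) \<Rightarrow> ('m, 'n) chart \<Rightarrow> 'm \<Rightarrow> real ^ 'n" where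
  "local_grad f c x = (\<chi> k. det (\<chi> i j. if j = k
      then frechet_derivative (f \<circ> chart_inv c) (at (coord c x)) (axis i 1)
      else gram A g c x $ i $ j) / det (gram A g c x))"

lemma gram_local_grad:
  assumes "c \<in> A" "x \<in> dom_of c"
  shows "gram A g c x *v local_grad f c x =
    (\<chi> i. frechet_derivative (f \<circ> chart_inv c) (at (coord c x)) (axis i 1))"
proof -
  define b :: "real ^ 'n" where
    "b = (\<chi> i. frechet_derivative (f \<circ> chart_inv c) (at (coord c x)) (axis i 1))"
  have "local_grad f c x = (\<chi> k. det (\<chi> i j. if j = k then b $ i else gram A g c x $ i $ j)
      / det (gram A g c x))"
    by (simp add: local_grad_def b_def cong: if_cong)
  then have "gram A g c x *v local_grad f c x = b"
    using cramer[of "gram A g c x" "local_grad f c x" b] det_gram_pos[OF assms] by simp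
  then show ?thesis by (simp only: b_def)
qed

lemma g_local_grad:
  assumes f: "f \<in> Cinf" and c: "c \<in> A" "x \<in> dom_of c" and \<eta>: "\<eta> \<in> tangent_space A x"
  shows "g x (coord_vec A c x (local_grad f c x)) \<eta> =
    frechet_derivative (f \<circ> chart_inv c) (at (coord c x)) (\<eta> c)"
proof -
  note lin = has_derivative_linear[OF Cinf_has_derivative[OF f c]]
  show ?thesis
    using g_coord[OF c coord_vec_mem[OF c] \<eta>, of "local_grad f c x"] c
    by (simp add: gram_local_grad inner_vec_def linear_vec_eq_sum[OF lin, of "\<eta> c"])
qed

lemma grad_eq:
  assumes f: "f \<in> Cinf" and c: "c \<in> A" "x \<in> dom_of c"
  shows "grad A g f x = coord_vec A c x (local_grad f c x)"
  unfolding grad_def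
proof (rule the_equality)
  let ?\<xi> = "coord_vec A c x (local_grad f c x)"
  have T: "?\<xi> \<in> tangent_space A x"
    using coord_vec_mem[OF c] .
  then show "?\<xi> \<in> tangent_space A x \<and> (\<forall>\<eta>\<in>tangent_space A x. \<forall>d\<in>A. x \<in> dom_of d \<longrightarrow>
      g x ?\<xi> \<eta> = frechet_derivative (f \<circ> chart_inv d) (at (coord d x)) (\<eta> d))"
    using g_local_grad[OF f c] differential_change_chart[OF f c(1) _ c(2)] by auto
  fix \<xi>
  assume \<xi>: "\<xi> \<in> tangent_space A x \<and> (\<forall>\<eta>\<in>tangent_space A x. \<forall>d\<in>A. x \<in> dom_of d \<longrightarrow>
      g x \<xi> \<eta> = frechet_derivative (f \<circ> chart_inv d) (at (coord d x)) (\<eta> d))"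
  have d: "\<xi> - ?\<xi> \<in> tangent_space A x"
    using \<xi> T subspace_diff[OF subspace_tangent] by blast
  have "g x (\<xi> - ?\<xi>) (\<xi> - ?\<xi>) = g x \<xi> (\<xi> - ?\<xi>) - g x ?\<xi> (\<xi> - ?\<xi>)"
    using \<xi> T d by (intro g_diff_left) blast+
  also have "\<dots> = 0"
    using \<xi> c d g_local_grad[OF f c d] by simp
  finally show "\<xi> = ?\<xi>"
    using g_pos[OF d] by force
qed

lemma grad_mem: "f \<in> Cinf \<Longrightarrow> grad A g f x \<in> tangent_space A x"
  by (rule chart_around[of x]) (simp add: grad_eq coord_vec_mem)

lemma g_grad:
  assumes "f \<in> Cinf" "c \<in> A" "x \<in> dom_of c" "\<eta> \<in> tangent_space A x"
  shows "g x (grad A g f x) \<eta> = frechet_derivative (f \<circ> chart_inv c) (at (coord c x)) (\<eta> c)"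
  using g_local_grad[OF assms] grad_eq[OF assms(1-3)] by simp

lemma continuous_field_grad:
  assumes f: "f \<in> Cinf"
  shows "continuous_field (grad A g f)"
  unfolding continuous_field_def
proof (intro conjI ballI)
  show "grad A g f \<in> vector_fields A"
    by (simp add: vector_fields_def grad_mem[OF f])
  fix c
  assume c: "c \<in> A"
  have entry: "continuous_on (img_of c) (\<lambda>y. (\<chi> i j. if j = k
      then frechet_derivative (f \<circ> chart_inv c) (at y) (axis i 1)
      else gram A g c (chart_inv c y) $ i $ j) $ i $ j)" for k i j
    using Ck_on_SucD(2)[OF Cinf_Ck[OF f c, of "Suc 0"]] Ck_on_imp_continuous[OF Ck_on_gram[OF c]]
    by (cases "j = k") simp_all
  have "continuous_on (img_of c) (\<lambda>y. local_grad f c (chart_inv c y))"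
  proof -
    have "continuous_on (img_of c) (\<lambda>y. (\<chi> k. det (\<chi> i j. if j = k
        then frechet_derivative (f \<circ> chart_inv c) (at y) (axis i 1)
        else gram A g c (chart_inv c y) $ i $ j) / det (gram A g c (chart_inv c y))))"
    proof (intro continuous_on_vec_lambda continuous_on_divide)
      show "continuous_on (img_of c) (\<lambda>y. det (\<chi> i j. if j = k
          then frechet_derivative (f \<circ> chart_inv c) (at y) (axis i 1)
          else gram A g c (chart_inv c y) $ i $ j))" for k
        unfolding det_def[of "\<chi> i j. _ i j"]
        by (intro continuous_on_sum continuous_on_mult continuous_on_const continuous_on_prod entry)
      show "continuous_on (img_of c) (\<lambda>y. det (gram A g c (chart_inv c y)))"
        using Ck_on_imp_continuous[OF Ck_on_det_gram[OF c]] .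
      show "\<forall>y\<in>img_of c. det (gram A g c (chart_inv c y)) \<noteq> 0"
        using det_gram_pos c by (metis chart_simps(3) less_irrefl)
    qed
    then show ?thesis
      using c by (simp add: local_grad_def cong: continuous_on_cong if_cong)
  qed
  then have "continuous_on (dom_of c) (local_grad f c)"
    using c by (simp add: continuous_on_dom_iff)
  then show "continuous_on (dom_of c) (\<lambda>x. grad A g f x c)"
    using c f by (simp add: grad_eq cong: continuous_on_cong)
qed

section \<open>Integration in charts\<close>

lemma sets_vol [measurable_cong, simp]: "sets vol = sets borel"
  using volume by (simp add: riemannian_volume_def)

lemma space_vol [simp]: "space vol = UNIV"
  using sets_eq_imp_space_eq[OF sets_vol] by simp

lemma emeasure_vol_chart:
  assumes "c \<in> A" "B \<in> sets borel" "B \<subseteq> dom_of c"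
  shows "emeasure vol B =
    (\<integral>\<^sup>+ y. ennreal (local_density c y) * indicator (coord c ` B) y \<partial>lborel)"
  using volume assms by (simp add: riemannian_volume_def)

lemma coord_image_iff:
  "c \<in> A \<Longrightarrow> B \<subseteq> dom_of c \<Longrightarrow> y \<in> coord c ` B \<longleftrightarrow> y \<in> img_of c \<and> chart_inv c y \<in> B"
  by (force simp: subset_iff)

lemma continuous_imp_measurable:
  "continuous_on UNIV (h :: 'm \<Rightarrow> real) \<Longrightarrow> h \<in> borel_measurable vol"
  by (simp add: borel_measurable_continuous_onI cong: measurable_cong_sets)

text \<open>
  The volume restricted to the chart domain and the image of the local density under the inverse
  chart are equal as measures, since the characterisation of the volume says that they agree on
  Borel sets.
\<close>

lemma integral_chart:
  assumes c: "c \<in> A" and h: "h \<in> borel_measurable borel" and supp: "\<And>x. x \<notin> dom_of c \<Longrightarrow> h x = 0"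
  shows "(\<integral>x. h x \<partial>vol) =
    (\<integral>y. (if y \<in> img_of c then local_density c y * h (chart_inv c y) else 0) \<partial>lborel)"
proof -
  define q where "q y = (if y \<in> img_of c then chart_inv c y else undefined)" for y
  define \<theta> where "\<theta> y = (if y \<in> img_of c then local_density c y else 0)" for y
  have img: "img_of c \<in> sets borel" using open_img[OF c] by auto
  have dom: "dom_of c \<in> sets borel" using open_dom[OF c] by auto
  have q [measurable]: "q \<in> borel_measurable borel"
    unfolding q_def using img continuous_chart_inv[OF c]
    by (intro borel_measurable_continuous_on_if) auto
  have \<theta> [measurable]: "\<theta> \<in> borel_measurable borel"
    unfolding \<theta>_def using img Ck_on_imp_continuous[OF Ck_on_local_density[OF c, of 0]]
    by (intro borel_measurable_continuous_on_if) auto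
  have \<theta>_nonneg: "0 \<le> \<theta> y" for y
    using vol_density_pos[OF c] c by (auto simp: \<theta>_def intro: less_imp_le)
  let ?\<mu> = "density vol (\<lambda>x. ennreal (indicator (dom_of c) x))"
  let ?\<nu> = "distr (density lborel (\<lambda>y. ennreal (\<theta> y))) borel q"
  have ind [measurable]: "(\<lambda>x. indicator (dom_of c) x :: real) \<in> borel_measurable borel"
    using dom by simp
  have "?\<mu> = ?\<nu>"
  proof (rule measure_eqI)
    show "sets ?\<mu> = sets ?\<nu>" by simp
    fix B
    assume "B \<in> sets ?\<mu>"
    then have B [measurable]: "B \<in> sets borel" by simp
    have "emeasure ?\<mu> B = (\<integral>\<^sup>+ x. ennreal (indicator (dom_of c) x) * indicator B x \<partial>vol)"
      by (rule emeasure_density) (auto cong: measurable_cong_sets)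
    also have "\<dots> = (\<integral>\<^sup>+ x. indicator (B \<inter> dom_of c) x \<partial>vol)"
      by (intro nn_integral_cong) (simp split: split_indicator)
    also have "\<dots> = emeasure vol (B \<inter> dom_of c)"
      using B dom by (intro nn_integral_indicator) simp
    also have "\<dots> = (\<integral>\<^sup>+ y. ennreal (local_density c y) * indicator (coord c ` (B \<inter> dom_of c)) y \<partial>lborel)"
      using B dom by (intro emeasure_vol_chart[OF c]) auto
    also have "\<dots> = (\<integral>\<^sup>+ y. ennreal (\<theta> y) * indicator (q -` B) y \<partial>lborel)"
    proof (rule nn_integral_cong)
      fix y
      have "y \<in> coord c ` (B \<inter> dom_of c) \<longleftrightarrow> y \<in> img_of c \<and> chart_inv c y \<in> B"
        using coord_image_iff[OF c, of "B \<inter> dom_of c" y] c by auto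
      then show "ennreal (local_density c y) * indicator (coord c ` (B \<inter> dom_of c)) y =
          ennreal (\<theta> y) * indicator (q -` B) y"
        by (auto simp: indicator_def \<theta>_def q_def)
    qed
    also have "\<dots> = emeasure (density lborel (\<lambda>y. ennreal (\<theta> y))) (q -` B)"
      using measurable_sets[OF q B] by (subst emeasure_density) auto
    also have "\<dots> = emeasure ?\<nu> B"
      by (subst emeasure_distr) auto
    finally show "emeasure ?\<mu> B = emeasure ?\<nu> B" .
  qed
  moreover have "(\<integral>x. h x \<partial>vol) = (\<integral>x. h x \<partial>?\<mu>)"
    using h dom supp by (subst integral_density) (auto intro!: Bochner_Integration.integral_cong
        simp: indicator_def cong: measurable_cong_sets)
  moreover have "(\<integral>x. h x \<partial>?\<nu>) = (\<integral>y. \<theta> y * h (q y) \<partial>lborel)"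
    using h \<theta>_nonneg by (subst integral_distr) (auto simp: integral_density)
  moreover have "\<theta> y * h (q y) =
      (if y \<in> img_of c then local_density c y * h (chart_inv c y) else 0)" for y
    by (simp add: \<theta>_def q_def)
  ultimately show ?thesis by simp
qed

lemma compact_neighbourhood:
  assumes "open U" "x \<in> U"
  obtains c r where "c \<in> A" "x \<in> dom_of c" "0 < r" "cball (coord c x) r \<subseteq> img_of c"
    "compact (chart_inv c ` cball (coord c x) r)" "chart_inv c ` cball (coord c x) r \<subseteq> dom_of c \<inter> U"
    "open (chart_inv c ` ball (coord c x) r)"
proof -
  obtain c where c: "c \<in> A" "x \<in> dom_of c" by (rule chart_around)
  let ?S = "coord c ` (dom_of c \<inter> U)"
  have "open ?S" "coord c x \<in> ?S"
    using open_coord_image[OF c(1) assms(1)] c assms(2) by auto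
  then obtain r where r: "0 < r" "cball (coord c x) r \<subseteq> ?S"
    using open_contains_cball by blast
  then have img: "cball (coord c x) r \<subseteq> img_of c" by blast
  have "chart_inv c ` cball (coord c x) r \<subseteq> dom_of c \<inter> U"
    using r(2) coord_image_eq[OF c(1), of U] c by auto
  moreover have "compact (chart_inv c ` cball (coord c x) r)"
    using continuous_on_subset[OF continuous_chart_inv[OF c(1)] img]
    by (rule compact_continuous_image) simp
  moreover have "open (chart_inv c ` ball (coord c x) r)"
  proof -
    have sub: "ball (coord c x) r \<subseteq> img_of c"
      using img ball_subset_cball by blast
    have image_eq_preimage: "chart_inv c ` S = dom_of c \<inter> coord c -` S" if "S \<subseteq> img_of c" for S
    proof
      show "chart_inv c ` S \<subseteq> dom_of c \<inter> coord c -` S"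
        using that c chart_simps(2,3)[OF c(1)] by (auto simp: subset_iff)
      show "dom_of c \<inter> coord c -` S \<subseteq> chart_inv c ` S"
        using chart_simps(1)[OF c(1)] by (metis IntE image_eqI subsetI vimageE)
    qed
    have "chart_inv c ` ball (coord c x) r = dom_of c \<inter> coord c -` ball (coord c x) r"
      using image_eq_preimage[OF sub] .
    then show ?thesis
      using continuous_open_preimage[OF continuous_coord[OF c(1)] open_dom[OF c(1)] open_ball] by simp
  qed
  ultimately show thesis using that c r(1) img by blast
qed

lemma finite_measure_vol: "finite_measure vol"
proof (rule finite_measureI)
  have "\<exists>V. open V \<and> x \<in> V \<and> emeasure vol V < \<infinity>" for x
  proof -
    obtain c r where c: "c \<in> A" "x \<in> dom_of c" and r: "0 < r" "cball (coord c x) r \<subseteq> img_of c"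
      and V: "chart_inv c ` cball (coord c x) r \<subseteq> dom_of c \<inter> UNIV" "open (chart_inv c ` ball (coord c x) r)"
      by (rule compact_neighbourhood[OF open_UNIV UNIV_I])
    let ?V = "chart_inv c ` ball (coord c x) r"
    have "compact (local_density c ` cball (coord c x) r)"
      using continuous_on_subset[OF Ck_on_imp_continuous[OF Ck_on_local_density[OF c(1), of 0]] r(2)]
      by (rule compact_continuous_image) simp
    then obtain C where C: "\<And>y. y \<in> cball (coord c x) r \<Longrightarrow> \<bar>local_density c y\<bar> \<le> C"
      using compact_imp_bounded bounded_iff by (metis imageI real_norm_def)
    have sub: "?V \<subseteq> dom_of c" using V(1) by auto
    have "emeasure vol ?V = (\<integral>\<^sup>+ y. ennreal (local_density c y) * indicator (coord c ` ?V) y \<partial>lborel)"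
      using V(2) sub by (intro emeasure_vol_chart[OF c(1)]) auto
    also have "\<dots> \<le> (\<integral>\<^sup>+ y. ennreal C * indicator (cball (coord c x) r) y \<partial>lborel)"
    proof (rule nn_integral_mono)
      fix y
      have "y \<in> cball (coord c x) r" if y: "y \<in> coord c ` ?V"
      proof -
        obtain z where z: "z \<in> ball (coord c x) r" "y = coord c (chart_inv c z)"
          using y by blast
        then have "z \<in> cball (coord c x) r" by simp
        then show ?thesis
          using z(2) r(2) chart_simps(2)[OF c(1)] by (simp add: subsetD)
      qed
      then show "ennreal (local_density c y) * indicator (coord c ` ?V) y \<le>
          ennreal C * indicator (cball (coord c x) r) y"
        using C[of y] by (cases "y \<in> coord c ` ?V") (simp_all add: ennreal_leI)
    qed
    also have "\<dots> = ennreal C * emeasure lborel (cball (coord c x) r)"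
      by (simp add: nn_integral_cmult_indicator)
    also have "\<dots> < \<infinity>"
      using emeasure_lborel_cball_finite[of "coord c x" r] by (simp add: ennreal_mult_less_top)
    finally have "emeasure vol ?V < \<infinity>" .
    moreover have "x \<in> ?V"
      using r(1) c by (intro image_eqI[of _ _ "coord c x"]) auto
    ultimately show ?thesis using V(2) by blast
  qed
  then obtain V where V: "\<And>x. open (V x)" "\<And>x. x \<in> V x" "\<And>x. emeasure vol (V x) < \<infinity>"
    by metis
  obtain I where I: "finite I" "UNIV \<subseteq> (\<Union>x\<in>I. V x)"
    by (rule compactE_image[OF compact_M, of UNIV V]) (use V in auto)
  have "emeasure vol (space vol) \<le> emeasure vol (\<Union>x\<in>I. V x)"
    using I V by (intro emeasure_mono) auto
  also have "\<dots> \<le> (\<Sum>x\<in>I. emeasure vol (V x))"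
    using I V by (intro emeasure_subadditive_finite) auto
  also have "\<dots> < \<infinity>"
    using V I(1) by simp
  finally show "emeasure vol (space vol) \<noteq> \<infinity>" by simp
qed

lemma continuous_imp_integrable:
  assumes "continuous_on UNIV (h :: 'm \<Rightarrow> real)"
  shows "integrable vol h"
proof -
  interpret finite_measure vol by (rule finite_measure_vol)
  obtain C where "\<And>x. \<bar>h x\<bar> \<le> C"
    using compact_imp_bounded[OF compact_continuous_image[OF assms compact_M]]
    by (auto simp: bounded_iff)
  then show ?thesis
    using continuous_imp_measurable[OF assms] by (intro integrable_const_bound[of _ C]) auto
qed

text \<open>This is what lets integrals detect that a continuous function is nonzero.\<close>

lemma vol_pos_of_open:
  assumes "open U" "U \<noteq> {}"
  shows "emeasure vol U \<noteq> 0"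
proof
  assume null: "emeasure vol U = 0"
  obtain x where "x \<in> U" using assms by blast
  obtain c where c: "c \<in> A" "x \<in> dom_of c" by (rule chart_around)
  let ?B = "dom_of c \<inter> U"
  have B: "open ?B" "open (coord c ` ?B)"
    using open_dom[OF c(1)] assms open_coord_image[OF c(1)] by auto
  have "emeasure vol ?B = 0"
    using emeasure_mono[of ?B U vol] assms null by auto
  then have "(\<integral>\<^sup>+ y. ennreal (local_density c y) * indicator (coord c ` ?B) y \<partial>lborel) = 0"
    using emeasure_vol_chart[OF c(1), of ?B] B by simp
  also have "(\<integral>\<^sup>+ y. ennreal (local_density c y) * indicator (coord c ` ?B) y \<partial>lborel) =
      (\<integral>\<^sup>+ y. ennreal (if y \<in> coord c ` ?B then local_density c y else 0) \<partial>lborel)"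
    by (intro nn_integral_cong) (auto simp: indicator_def)
  finally have "AE y in lborel. ennreal (if y \<in> coord c ` ?B then local_density c y else 0) = 0"
  proof (subst (asm) nn_integral_0_iff_AE)
    have "continuous_on (coord c ` ?B) (local_density c)"
      by (rule continuous_on_subset[OF Ck_on_imp_continuous[OF Ck_on_local_density[OF c(1), of 0]]]) auto
    then have "(\<lambda>y. if y \<in> coord c ` ?B then local_density c y else 0) \<in> borel_measurable borel"
      using B by (intro borel_measurable_continuous_on_if) auto
    then show "(\<lambda>y. ennreal (if y \<in> coord c ` ?B then local_density c y else 0)) \<in> borel_measurable lborel"
      by simp
  qed auto
  then have "AE y in lborel. y \<notin> coord c ` ?B"
  proof eventually_elim
    case (elim y)
    then show ?case
      using vol_density_pos[OF c(1), of "chart_inv c y"] c(1) by (auto split: if_splits)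
  qed
  then have "coord c ` ?B \<in> null_sets lborel"
    using B by (subst (asm) AE_iff_null_sets[symmetric]) auto
  then have "negligible (coord c ` ?B)"
    by (simp add: negligible_iff_null_sets null_sets_completionI)
  then show False
    using open_not_negligible[OF B(2)] \<open>x \<in> U\<close> c by blast
qed

section \<open>Smooth functions\<close>

lemma Cinf_const: "(\<lambda>_. a) \<in> Cinf"
  by (rule CinfI) (simp add: comp_def Ck_on_const)

lemma Cinf_add: "f \<in> Cinf \<Longrightarrow> h \<in> Cinf \<Longrightarrow> (\<lambda>x. f x + h x) \<in> Cinf"
  using Cinf_Ck by (intro CinfI) (auto simp: comp_def intro!: Ck_on_add open_img)

lemma Cinf_mult: "f \<in> Cinf \<Longrightarrow> h \<in> Cinf \<Longrightarrow> (\<lambda>x. f x * h x) \<in> Cinf"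
  using Cinf_Ck by (intro CinfI) (auto simp: comp_def intro!: Ck_on_mult open_img)

lemma Cinf_sum: "(\<And>i. i \<in> I \<Longrightarrow> f i \<in> Cinf) \<Longrightarrow> (\<lambda>x. \<Sum>i\<in>I. f i x) \<in> Cinf"
  by (induction I rule: infinite_finite_induct) (auto intro: Cinf_const Cinf_add)

lemma Cinf_inverse:
  assumes "f \<in> Cinf" "\<And>x. 0 < f x"
  shows "(\<lambda>x. inverse (f x)) \<in> Cinf"
proof (rule CinfI)
  fix c k
  assume c: "c \<in> A"
  have "Ck_on k (\<lambda>y. inverse ((f \<circ> chart_inv c) y)) (img_of c)"
    by (rule Ck_on_compose[OF open_img[OF c] _ Ck_on_inverse Cinf_Ck[OF assms(1) c]])
      (use assms(2) in auto)
  then show "Ck_on k ((\<lambda>x. inverse (f x)) \<circ> chart_inv c) (img_of c)"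
    by (simp add: comp_def)
qed

lemma subspace_Cinf: "subspace Cinf"
  unfolding subspace_def
  using Cinf_const[of 0] Cinf_add Cinf_mult[OF Cinf_const]
  by (auto simp: plus_fun_def scaleR_fun_def zero_fun_def)

text \<open>
  A Euclidean bump function in a chart, extended by zero.  In another chart the extension is smooth
  on two open sets that cover the image: the overlap, and the complement of the support, which is
  closed because it is compact in a Hausdorff space.
\<close>

lemma bump_exists:
  assumes "open U" "x \<in> U"
  obtains \<phi> K where "\<phi> \<in> Cinf" "compact K" "K \<subseteq> U" "\<And>y. 0 \<le> \<phi> y" "0 < \<phi> x" "\<And>y. y \<notin> K \<Longrightarrow> \<phi> y = 0"
proof -
  obtain c r where c: "c \<in> A" "x \<in> dom_of c" and r: "0 < r" "cball (coord c x) r \<subseteq> img_of c"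
    and K: "compact (chart_inv c ` cball (coord c x) r)" "chart_inv c ` cball (coord c x) r \<subseteq> dom_of c \<inter> U"
    by (rule compact_neighbourhood[OF assms])
  define K where "K = chart_inv c ` cball (coord c x) r"
  define \<phi> where "\<phi> y = (if y \<in> dom_of c then bump (coord c x) r (coord c y) else 0)" for y
  have closed_K: "closed K"
    using K(1) compact_imp_closed by (simp add: K_def)
  have zero: "\<phi> y = 0" if "y \<notin> K" for y
  proof (cases "y \<in> dom_of c")
    case True
    have "coord c y \<notin> cball (coord c x) r"
      using that True c(1) by (force simp: K_def)
    from bump_eq_0[OF r(1) this] show ?thesis by (simp add: \<phi>_def)
  qed (simp add: \<phi>_def)
  have "\<phi> \<in> Cinf"
  proof (rule CinfI)
    fix d k
    assume d: "d \<in> A"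
    let ?S = "coord d ` (dom_of d \<inter> dom_of c)" and ?T = "coord d ` (dom_of d \<inter> - K)"
    have S: "open ?S" and T: "open ?T"
      using open_coord_image[OF d] open_dom[OF c(1)] closed_K by auto
    have comp: "Ck_on k (\<lambda>y. bump (coord c x) r (transition d c y)) ?S"
      by (rule Ck_on_compose[OF S _ Ck_on_bump Ck_on_transition[OF d c(1)]]) auto
    have "Ck_on k (\<phi> \<circ> chart_inv d) ?S"
      by (rule Ck_on_cong[OF S _ comp]) (use d in \<open>auto simp: transition_def \<phi>_def\<close>)
    moreover have "Ck_on k (\<phi> \<circ> chart_inv d) ?T"
      by (rule Ck_on_cong[OF T _ Ck_on_const[of k 0]]) (use d zero in auto)
    moreover have "dom_of d = (dom_of d \<inter> dom_of c) \<union> (dom_of d \<inter> - K)"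
      using K(2) by (auto simp: K_def)
    then have "?S \<union> ?T = img_of d"
      by (simp only: image_Un[symmetric])
    ultimately show "Ck_on k (\<phi> \<circ> chart_inv d) (img_of d)"
      using Ck_on_open_Un[OF S T] by metis
  qed
  moreover have "0 \<le> \<phi> y" for y by (simp add: \<phi>_def bump_nonneg)
  moreover have "0 < \<phi> x" using c bump_centre_pos[OF r(1)] by (simp add: \<phi>_def)
  ultimately show thesis
    using that[of \<phi> K] K zero by (simp add: K_def)
qed

text \<open>
  The fundamental lemma of the calculus of variations: near a point where \<open>h\<close> does not vanish, a
  bump function of small support makes the integrand have one sign.
\<close>

lemma eq_0_of_smooth_test_functions:
  assumes U: "open U" and h: "continuous_on U h" and x: "x \<in> U"
    and test: "\<And>\<phi> K. \<phi> \<in> Cinf \<Longrightarrow> compact K \<Longrightarrow> K \<subseteq> U \<Longrightarrow> (\<And>y. y \<notin> K \<Longrightarrow> \<phi> y = 0) \<Longrightarrow>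
      (\<integral>y. \<phi> y * h y \<partial>vol) = 0"
  shows "h x = 0"
proof (rule ccontr)
  assume hx: "h x \<noteq> 0"
  let ?U = "U \<inter> (\<lambda>y. h y * h x) -` {0<..}"
  have "open ?U"
    using h U by (intro continuous_open_preimage continuous_on_mult continuous_on_const) auto
  moreover have "x \<in> ?U" using x hx by (simp add: zero_less_mult_iff flip: power2_eq_square)
  ultimately obtain \<phi> K where \<phi>: "\<phi> \<in> Cinf" "compact K" "K \<subseteq> ?U" "\<And>y. 0 \<le> \<phi> y" "0 < \<phi> x"
    "\<And>y. y \<notin> K \<Longrightarrow> \<phi> y = 0"
    by (rule bump_exists) blast
  define \<psi> where "\<psi> y = (if y \<in> U then \<phi> y * (h y * h x) else 0)" for y
  have eq: "\<psi> y = \<phi> y * h y * h x" for y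
    using \<phi>(3) \<phi>(6)[of y] by (auto simp: \<psi>_def)
  have cont: "continuous_on UNIV \<psi>"
    unfolding \<psi>_def
  proof (rule continuous_on_zero_extension[OF U compact_imp_closed[OF \<phi>(2)]])
    show "continuous_on U (\<lambda>y. \<phi> y * (h y * h x))"
      using Cinf_continuous[OF \<phi>(1)] h
      by (intro continuous_on_mult continuous_on_const) (auto intro: continuous_on_subset)
  qed (use \<phi> in auto)
  have nonneg: "0 \<le> \<psi> y" for y
  proof (cases "y \<in> K")
    case True
    then have "0 < h y * h x" using \<phi>(3) by auto
    then show ?thesis using \<phi>(4)[of y] by (simp add: \<psi>_def)
  qed (use \<phi>(6) in \<open>simp add: \<psi>_def\<close>)
  have "(\<integral>y. \<psi> y \<partial>vol) = (\<integral>y. \<phi> y * h y \<partial>vol) * h x"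
    by (simp add: eq)
  also have "\<dots> = 0"
    using test[OF \<phi>(1,2) _ \<phi>(6)] \<phi>(3) by auto
  finally have "AE y in vol. \<psi> y = 0"
    using integral_nonneg_eq_0_iff_AE[OF continuous_imp_integrable[OF cont]] nonneg by simp
  then have "AE y in vol. y \<notin> {y. \<psi> y \<noteq> 0}" by simp
  moreover have op: "open {y. \<psi> y \<noteq> 0}"
    using open_Collect_neq[OF cont continuous_on_const] by simp
  ultimately have "{y. \<psi> y \<noteq> 0} \<in> null_sets vol"
    by (subst (asm) AE_iff_null_sets[symmetric]) auto
  moreover have "\<psi> x \<noteq> 0"
    using x hx \<phi>(5) by (simp add: eq)
  ultimately show False
    using vol_pos_of_open[OF op] by blast
qed

section \<open>The divergence theorem\<close>

lemma C1_continuous_field: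
  assumes "X \<in> C1_vector_fields A"
  shows "continuous_field X"
  unfolding continuous_field_def
proof (intro conjI ballI)
  show "X \<in> vector_fields A" using assms by (simp add: C1_vector_fields_def)
  fix c
  assume c: "c \<in> A"
  then have "Ck_on 1 (local_rep c X) (img_of c)"
    using assms by (simp add: C1_vector_fields_def)
  then show "continuous_on (dom_of c) (\<lambda>x. X x c)"
    using Ck_on_imp_continuous c by (fastforce simp: continuous_on_dom_iff local_rep_def)
qed

lemma C1_field_mem: "X \<in> C1_vector_fields A \<Longrightarrow> X x \<in> tangent_space A x"
  by (simp add: C1_vector_fields_def vector_fields_def)

abbreviation flux :: "('m, 'n) chart \<Rightarrow> ('m \<Rightarrow> ('m, 'n) tvec) \<Rightarrow> 'n \<Rightarrow> real ^ 'n \<Rightarrow> real" where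
  "flux c X i \<equiv> \<lambda>y. local_density c y * local_rep c X y $ i"

definition chart_divergence :: "('m, 'n) chart \<Rightarrow> ('m \<Rightarrow> ('m, 'n) tvec) \<Rightarrow> 'm \<Rightarrow> real" where
  "chart_divergence c X x =
    (\<Sum>i\<in>UNIV. frechet_derivative (flux c X i) (at (coord c x)) (axis i 1)) / vol_density A g c x"

lemma Ck_on_flux:
  assumes "X \<in> C1_vector_fields A" "c \<in> A"
  shows "Ck_on 1 (flux c X i) (img_of c)"
proof -
  have "Ck_on 1 (local_rep c X) (img_of c)"
    using assms by (simp add: C1_vector_fields_def)
  then show ?thesis
    by (intro Ck_on_mult Ck_on_local_density assms open_img
        Ck_on_bounded_linear_comp[OF bounded_linear_vec_nth])
qed

lemma continuous_chart_divergence: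
  assumes X: "X \<in> C1_vector_fields A" and c: "c \<in> A"
  shows "continuous_on (dom_of c) (chart_divergence c X)"
proof -
  have "continuous_on (img_of c) (\<lambda>y. (\<Sum>i\<in>UNIV. frechet_derivative (flux c X i) (at y) (axis i 1))
      / local_density c y)"
  proof (intro continuous_on_divide continuous_on_sum)
    show "continuous_on (img_of c) (\<lambda>y. frechet_derivative (flux c X i) (at y) (axis i 1))" for i
      using Ck_on_flux[OF X c, of i] by simp
    show "continuous_on (img_of c) (local_density c)"
      using Ck_on_imp_continuous[OF Ck_on_local_density[OF c, of 0]] .
    show "\<forall>y\<in>img_of c. local_density c y \<noteq> 0"
      using vol_density_pos[OF c] c by (metis chart_simps(3) less_irrefl)
  qed
  then show ?thesis
    using c by (simp add: continuous_on_dom_iff chart_divergence_def cong: continuous_on_cong)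
qed

lemma g_grad_eq_0:
  assumes f: "f \<in> Cinf" and U: "open U" "\<And>y. y \<in> U \<Longrightarrow> f y = 0"
    and x: "x \<in> U" and \<eta>: "\<eta> \<in> tangent_space A x"
  shows "g x (grad A g f x) \<eta> = 0"
proof -
  obtain c where c: "c \<in> A" "x \<in> dom_of c" by (rule chart_around)
  have "((f \<circ> chart_inv c) has_derivative (\<lambda>_. 0)) (at (coord c x))"
    by (rule has_derivative_transform_within_open[of "\<lambda>_. 0" _ _ UNIV "coord c ` (dom_of c \<inter> U)"])
      (use U x c open_coord_image in auto)
  then show ?thesis
    using g_grad[OF f c \<eta>] by (simp add: frechet_derivative_at[symmetric])
qed

text \<open>
  Multiplied by the volume density, the integrand is the Euclidean divergence of the compactly
  supported field with components \<open>\<phi> J X\<^sup>i\<close>.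
\<close>

lemma divergence_theorem_in_chart:
  assumes X: "X \<in> C1_vector_fields A" and c: "c \<in> A" and \<phi>: "\<phi> \<in> Cinf"
    and K: "compact K" "K \<subseteq> dom_of c" "\<And>x. x \<notin> K \<Longrightarrow> \<phi> x = 0"
  shows "continuous_on UNIV (\<lambda>x. \<phi> x * chart_divergence c X x)"
    and "(\<integral>x. \<phi> x * chart_divergence c X x + g x (grad A g \<phi> x) (X x) \<partial>vol) = 0"
proof -
  let ?h = "\<lambda>x. \<phi> x * chart_divergence c X x + g x (grad A g \<phi> x) (X x)"
  let ?p = "\<phi> \<circ> chart_inv c"
  have "continuous_on UNIV (\<lambda>x. if x \<in> dom_of c then \<phi> x * chart_divergence c X x else 0)"
    using continuous_chart_divergence[OF X c] Cinf_continuous[OF \<phi>] K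
    by (intro continuous_on_zero_extension[OF open_dom[OF c] compact_imp_closed[OF K(1)]]
        continuous_on_mult) (auto intro: continuous_on_subset)
  also have "(\<lambda>x. if x \<in> dom_of c then \<phi> x * chart_divergence c X x else 0) =
      (\<lambda>x. \<phi> x * chart_divergence c X x)"
    using K by (auto simp: fun_eq_iff)
  finally show cont: "continuous_on UNIV (\<lambda>x. \<phi> x * chart_divergence c X x)" .
  have "continuous_on UNIV ?h"
    by (intro continuous_on_add cont continuous_inner_fields continuous_field_grad \<phi>
        C1_continuous_field X)
  then have meas: "?h \<in> borel_measurable borel"
    by (rule borel_measurable_continuous_onI)
  have supp: "?h x = 0" if "x \<notin> dom_of c" for x
  proof -
    have "open (- K)" "x \<in> - K" using compact_imp_closed[OF K(1)] that K(2) by auto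
    then have "g x (grad A g \<phi> x) (X x) = 0"
      using K(3) by (intro g_grad_eq_0[OF \<phi>, of "- K"] C1_field_mem[OF X]) auto
    then show ?thesis using K that by auto
  qed
  have coordK: "compact (coord c ` K)" "coord c ` K \<subseteq> img_of c"
    using K continuous_on_subset[OF continuous_coord[OF c] K(2)]
    by (auto intro: compact_continuous_image)
  have F: "Ck_on 1 (\<lambda>y. ?p y * flux c X i y) (img_of c)" for i
    by (intro Ck_on_mult open_img c Ck_on_flux[OF X c] Cinf_Ck[OF \<phi> c])
  have F0: "?p y * flux c X i y = 0" if "y \<in> img_of c - coord c ` K" for y i
  proof -
    have "chart_inv c y \<notin> K"
      using that c by (metis Diff_iff chart_simps(2) imageI)
    then show ?thesis using K(3) by simp
  qed
  note zero = integral_directional_derivative_on_eq_0[OF open_img[OF c] coordK F F0]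
  have pointwise: "local_density c y * ?h (chart_inv c y) =
      (\<Sum>i\<in>UNIV. frechet_derivative (\<lambda>y. ?p y * flux c X i y) (at y) (axis i 1))"
    if y: "y \<in> img_of c" for y
  proof -
    have x: "chart_inv c y \<in> dom_of c" "coord c (chart_inv c y) = y"
      using y c by auto
    note Dp = Cinf_has_derivative[OF \<phi> c x(1), unfolded x(2)]
    have Dq: "(flux c X i has_derivative frechet_derivative (flux c X i) (at y)) (at y)" for i
      using Ck_on_SucD(1)[of 0 "flux c X i", OF _ y] Ck_on_flux[OF X c, of i] by simp
    have D: "frechet_derivative (\<lambda>y. ?p y * flux c X i y) (at y) (axis i 1) =
        ?p y * frechet_derivative (flux c X i) (at y) (axis i 1) +
        frechet_derivative ?p (at y) (axis i 1) * flux c X i y" for i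
      by (simp only: frechet_derivative_at[OF has_derivative_mult[OF Dp Dq[of i]], symmetric])
    have "g (chart_inv c y) (grad A g \<phi> (chart_inv c y)) (X (chart_inv c y)) =
        frechet_derivative ?p (at y) (local_rep c X y)"
      using g_grad[OF \<phi> c x(1) C1_field_mem[OF X]] by (simp add: x(2) local_rep_def)
    also have "\<dots> = (\<Sum>i\<in>UNIV. local_rep c X y $ i * frechet_derivative ?p (at y) (axis i 1))"
      unfolding linear_vec_eq_sum[OF has_derivative_linear[OF Dp], of "local_rep c X y"]
      by (simp only: real_scaleR_def)
    finally have "local_density c y * g (chart_inv c y) (grad A g \<phi> (chart_inv c y)) (X (chart_inv c y))
        = (\<Sum>i\<in>UNIV. frechet_derivative ?p (at y) (axis i 1) * flux c X i y)"
      by (simp only: sum_distrib_left mult_ac)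
    moreover have "local_density c y * (?p y * chart_divergence c X (chart_inv c y)) =
        (\<Sum>i\<in>UNIV. ?p y * frechet_derivative (flux c X i) (at y) (axis i 1))"
    proof -
      have "local_density c y * chart_divergence c X (chart_inv c y) =
          (\<Sum>i\<in>UNIV. frechet_derivative (flux c X i) (at y) (axis i 1))"
        using vol_density_pos[OF c x(1)] by (simp add: chart_divergence_def x(2))
      then show ?thesis
        by (simp only: mult.left_commute[of "local_density c y" "?p y"] sum_distrib_left)
    qed
    ultimately show ?thesis
      unfolding D sum.distrib by (simp add: distrib_left)
  qed
  have "(\<integral>x. ?h x \<partial>vol) = (\<integral>y. (if y \<in> img_of c
      then local_density c y * ?h (chart_inv c y) else 0) \<partial>lborel)"
    by (rule integral_chart[OF c meas supp])
  also have "\<dots> = (\<integral>y. (\<Sum>i\<in>UNIV. if y \<in> img_of c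
      then frechet_derivative (\<lambda>y. ?p y * flux c X i y) (at y) (axis i 1) else 0) \<partial>lborel)"
    by (intro Bochner_Integration.integral_cong) (simp_all add: pointwise)
  also have "\<dots> = 0"
    using zero by (subst Bochner_Integration.integral_sum) simp_all
  finally show "(\<integral>x. ?h x \<partial>vol) = 0" .
qed

text \<open>
  The coordinate expressions for the divergence agree on overlaps because both satisfy the same
  weak equation there, which replaces a computation with second derivatives of transition maps.
\<close>

lemma chart_divergence_eq:
  assumes X: "X \<in> C1_vector_fields A" and c: "c \<in> A" "x \<in> dom_of c" and d: "d \<in> A" "x \<in> dom_of d"
  shows "chart_divergence c X x = chart_divergence d X x"
proof -
  let ?U = "dom_of c \<inter> dom_of d"
  have "chart_divergence c X x - chart_divergence d X x = 0"
  proof (rule eq_0_of_smooth_test_functions[of ?U])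
    show "open ?U" using open_Int[OF open_dom[OF c(1)] open_dom[OF d(1)]] .
    show "continuous_on ?U (\<lambda>x. chart_divergence c X x - chart_divergence d X x)"
      by (intro continuous_on_diff continuous_on_subset[OF continuous_chart_divergence[OF X]] c d) auto
    fix \<phi> K
    assume \<phi>: "\<phi> \<in> Cinf" "compact K" "K \<subseteq> ?U" "\<And>y. y \<notin> K \<Longrightarrow> \<phi> y = 0"
    let ?G = "\<lambda>x. g x (grad A g \<phi> x) (X x)"
    have G: "integrable vol ?G"
      by (intro continuous_imp_integrable continuous_inner_fields continuous_field_grad \<phi>
          C1_continuous_field X)
    have "integrable vol (\<lambda>x. \<phi> x * chart_divergence e X x) \<and>
        (\<integral>x. \<phi> x * chart_divergence e X x \<partial>vol) = - (\<integral>x. ?G x \<partial>vol)"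
      if e: "e \<in> A" "?U \<subseteq> dom_of e" for e
    proof -
      note w = divergence_theorem_in_chart[OF X e(1) \<phi>(1,2) order_trans[OF \<phi>(3) e(2)] \<phi>(4)]
      show ?thesis
        using w(2) continuous_imp_integrable[OF w(1)] G by simp
    qed
    from this[OF c(1)] this[OF d(1)]
    show "(\<integral>y. \<phi> y * (chart_divergence c X y - chart_divergence d X y) \<partial>vol) = 0"
      by (simp add: right_diff_distrib)
  qed (use c d in auto)
  then show ?thesis by simp
qed

lemma divergence_eq:
  assumes X: "X \<in> C1_vector_fields A" and c: "c \<in> A" "x \<in> dom_of c"
  shows "divergence A g X x = chart_divergence c X x"
  unfolding divergence_def
proof (rule the_equality)
  show "\<forall>d\<in>A. x \<in> dom_of d \<longrightarrow> chart_divergence c X x =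
      (\<Sum>i\<in>UNIV. frechet_derivative (flux d X i) (at (coord d x)) (axis i 1)) / vol_density A g d x"
    using chart_divergence_eq[OF X c] by (simp add: chart_divergence_def)
qed (use c in \<open>auto simp: chart_divergence_def\<close>)

lemma continuous_divergence:
  assumes X: "X \<in> C1_vector_fields A"
  shows "continuous_on UNIV (divergence A g X)"
  by (rule continuous_on_charts)
    (use continuous_chart_divergence[OF X] divergence_eq[OF X] in \<open>simp cong: continuous_on_cong\<close>)

lemma g_grad_add:
  assumes f: "f \<in> Cinf" and h: "h \<in> Cinf" and \<eta>: "\<eta> \<in> tangent_space A x"
  shows "g x (grad A g (\<lambda>x. f x + h x) x) \<eta> = g x (grad A g f x) \<eta> + g x (grad A g h x) \<eta>"
proof -
  obtain c where c: "c \<in> A" "x \<in> dom_of c" by (rule chart_around)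
  have "((\<lambda>x. f x + h x) \<circ> chart_inv c has_derivative
      (\<lambda>w. frechet_derivative (f \<circ> chart_inv c) (at (coord c x)) w +
        frechet_derivative (h \<circ> chart_inv c) (at (coord c x)) w)) (at (coord c x))"
    using has_derivative_add[OF Cinf_has_derivative[OF f c] Cinf_has_derivative[OF h c]]
    by (simp add: comp_def)
  then show ?thesis
    by (simp add: g_grad[OF _ c \<eta>] f h Cinf_add frechet_derivative_at[symmetric])
qed

lemma g_grad_const: "\<eta> \<in> tangent_space A x \<Longrightarrow> g x (grad A g (\<lambda>_. a) x) \<eta> = 0"
  by (rule chart_around[of x]) (simp add: g_grad[OF Cinf_const] comp_def)

lemma g_grad_sum:
  assumes "\<And>i. i \<in> I \<Longrightarrow> f i \<in> Cinf" and "\<eta> \<in> tangent_space A x"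
  shows "g x (grad A g (\<lambda>x. \<Sum>i\<in>I. f i x) x) \<eta> = (\<Sum>i\<in>I. g x (grad A g (f i) x) \<eta>)"
  using assms(1)
  by (induction I rule: infinite_finite_induct) (auto simp: g_grad_const g_grad_add Cinf_sum assms(2))

text \<open>
  The pieces \<open>F i = (\<phi> i / S) f\<close> add up to \<open>f\<close>, where the bump functions \<open>\<phi> i\<close> have the positive sum \<open>S\<close>;
  each piece is supported in one chart.
\<close>

theorem divergence_theorem:
  assumes X: "X \<in> C1_vector_fields A" and f: "f \<in> Cinf"
  shows "(\<integral>x. g x (grad A g f x) (X x) \<partial>vol) = - (\<integral>x. f x * divergence A g X x \<partial>vol)"
proof -
  have "\<exists>\<phi> c K. \<phi> \<in> Cinf \<and> (\<forall>y. 0 \<le> \<phi> y) \<and> 0 < \<phi> x \<and> c \<in> A \<and> compact K \<and> K \<subseteq> dom_of c \<and>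
      (\<forall>y. y \<notin> K \<longrightarrow> \<phi> y = 0)" for x
  proof -
    obtain c where c: "c \<in> A" "x \<in> dom_of c" by (rule chart_around)
    show ?thesis
      by (rule bump_exists[OF open_dom[OF c(1)] c(2)]) (use c(1) in blast)
  qed
  then obtain \<phi> c K where \<phi>: "\<And>x. \<phi> x \<in> Cinf" "\<And>x y. 0 \<le> \<phi> x y" "\<And>x. 0 < \<phi> x x"
    and c: "\<And>x. c x \<in> A" and K: "\<And>x. compact (K x)" "\<And>x. K x \<subseteq> dom_of (c x)"
    and supp: "\<And>x y. y \<notin> K x \<Longrightarrow> \<phi> x y = 0"
    by metis
  have "open {y. 0 < \<phi> x y}" for x
    by (intro open_Collect_less continuous_on_const Cinf_continuous \<phi>)
  then obtain I where I: "finite I" "UNIV \<subseteq> (\<Union>x\<in>I. {y. 0 < \<phi> x y})"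
    by (rule_tac compactE_image[OF compact_M, of UNIV "\<lambda>x. {y. 0 < \<phi> x y}"]) (use \<phi>(3) in auto)
  define S where "S y = (\<Sum>i\<in>I. \<phi> i y)" for y
  have S_pos: "0 < S y" for y
  proof -
    obtain i where "i \<in> I" "0 < \<phi> i y" using I(2) by blast
    then show ?thesis
      unfolding S_def using I(1) \<phi>(2) by (intro sum_pos2[of I i]) auto
  qed
  have S: "S \<in> Cinf"
    unfolding S_def by (intro Cinf_sum \<phi>)
  define F where "F i y = \<phi> i y * (f y * inverse (S y))" for i y
  have F: "F i \<in> Cinf" for i
    unfolding F_def by (intro Cinf_mult \<phi> f Cinf_inverse S S_pos)
  have F_sum: "(\<Sum>i\<in>I. F i y) = f y" for y
    using S_pos[of y] by (simp add: F_def S_def flip: sum_distrib_right)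
  have F_supp: "F i y = 0" if "y \<notin> K i" for i y
    using supp[OF that] by (simp add: F_def)
  have F_div: "F i y * chart_divergence (c i) X y = F i y * divergence A g X y" for i y
    using F_supp[of y i] K(2)[of i] divergence_eq[OF X c[of i], of y] by (cases "y \<in> K i") auto
  let ?G = "\<lambda>f x. g x (grad A g f x) (X x)"
  have G: "integrable vol (?G f)" if "f \<in> Cinf" for f
    by (intro continuous_imp_integrable continuous_inner_fields continuous_field_grad
        C1_continuous_field X that)
  have D: "integrable vol (\<lambda>x. f x * divergence A g X x)" if "f \<in> Cinf" for f
    by (intro continuous_imp_integrable continuous_on_mult Cinf_continuous continuous_divergence X that)
  have zero: "(\<integral>x. ?G (F i) x \<partial>vol) = - (\<integral>x. F i x * divergence A g X x \<partial>vol)" for i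
    using divergence_theorem_in_chart(2)[OF X c[of i] F[of i] K(1)[of i] K(2)[of i] F_supp]
      G[OF F[of i]] D[OF F[of i]] by (simp add: F_div)
  have "?G f x = (\<Sum>i\<in>I. ?G (F i) x)" for x
    using g_grad_sum[of I F, OF F C1_field_mem[OF X]] by (simp add: F_sum)
  then have "(\<integral>x. ?G f x \<partial>vol) = (\<Sum>i\<in>I. \<integral>x. ?G (F i) x \<partial>vol)"
    using G[OF F] by simp
  also have "\<dots> = - (\<integral>x. (\<Sum>i\<in>I. F i x * divergence A g X x) \<partial>vol)"
    using D[OF F] by (simp add: zero sum_negf)
  also have "\<dots> = - (\<integral>x. f x * divergence A g X x \<partial>vol)"
    by (simp add: F_sum flip: sum_distrib_right)
  finally show ?thesis .
qed

lemma C1I: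
  "(\<And>x. X x \<in> tangent_space A x) \<Longrightarrow> (\<And>c. c \<in> A \<Longrightarrow> Ck_on 1 (local_rep c X) (img_of c)) \<Longrightarrow>
    X \<in> C1_vector_fields A"
  unfolding C1_vector_fields_def vector_fields_def by blast

lemma C1_local_rep: "X \<in> C1_vector_fields A \<Longrightarrow> c \<in> A \<Longrightarrow> Ck_on 1 (local_rep c X) (img_of c)"
  unfolding C1_vector_fields_def by blast

lemma C1_add:
  assumes "X \<in> C1_vector_fields A" "Y \<in> C1_vector_fields A"
  shows "(\<lambda>x. X x + Y x) \<in> C1_vector_fields A"
proof (rule C1I)
  show "X x + Y x \<in> tangent_space A x" for x
    using subspace_add[OF subspace_tangent C1_field_mem[OF assms(1)] C1_field_mem[OF assms(2)]] .
  fix c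
  assume c: "c \<in> A"
  have "local_rep c (\<lambda>x. X x + Y x) = (\<lambda>y. local_rep c X y + local_rep c Y y)"
    by (simp add: local_rep_def fun_eq_iff)
  then show "Ck_on 1 (local_rep c (\<lambda>x. X x + Y x)) (img_of c)"
    using Ck_on_add[OF open_img[OF c] C1_local_rep[OF assms(1) c] C1_local_rep[OF assms(2) c]]
    by (simp only:)
qed

lemma C1_scale:
  assumes "f \<in> Cinf" "X \<in> C1_vector_fields A"
  shows "(\<lambda>x. f x *\<^sub>R X x) \<in> C1_vector_fields A"
proof (rule C1I)
  show "f x *\<^sub>R X x \<in> tangent_space A x" for x
    using subspace_scale[OF subspace_tangent C1_field_mem[OF assms(2)]] .
  fix c
  assume c: "c \<in> A"
  have "local_rep c (\<lambda>x. f x *\<^sub>R X x) = (\<lambda>y. (f \<circ> chart_inv c) y *\<^sub>R local_rep c X y)"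
    by (simp add: local_rep_def fun_eq_iff scaleR_fun_def)
  then show "Ck_on 1 (local_rep c (\<lambda>x. f x *\<^sub>R X x)) (img_of c)"
    using Ck_on_scaleR[OF open_img[OF c] Cinf_Ck[OF assms(1) c] C1_local_rep[OF assms(2) c]]
    by (simp only:)
qed

lemma flux_has_derivative:
  assumes "X \<in> C1_vector_fields A" "c \<in> A" "x \<in> dom_of c"
  shows "(flux c X i has_derivative frechet_derivative (flux c X i) (at (coord c x))) (at (coord c x))"
  using Ck_on_SucD(1)[of 0 "flux c X i" "img_of c"] Ck_on_flux[OF assms(1,2), of i] assms(3) by simp

lemma divergence_add:
  assumes X: "X \<in> C1_vector_fields A" and Y: "Y \<in> C1_vector_fields A"
  shows "divergence A g (\<lambda>x. X x + Y x) x = divergence A g X x + divergence A g Y x"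
proof -
  obtain c where c: "c \<in> A" "x \<in> dom_of c" by (rule chart_around)
  have "flux c (\<lambda>x. X x + Y x) i = (\<lambda>y. flux c X i y + flux c Y i y)" for i
    by (simp add: fun_eq_iff local_rep_def distrib_left)
  then have "frechet_derivative (flux c (\<lambda>x. X x + Y x) i) (at (coord c x)) w =
      frechet_derivative (flux c X i) (at (coord c x)) w +
      frechet_derivative (flux c Y i) (at (coord c x)) w" for i w
    by (simp only: frechet_derivative_at[OF has_derivative_add[OF flux_has_derivative[OF X c]
            flux_has_derivative[OF Y c]], symmetric])
  then show ?thesis
    by (simp only: divergence_eq[OF X c] divergence_eq[OF Y c] divergence_eq[OF C1_add[OF X Y] c]
        chart_divergence_def sum.distrib add_divide_distrib)
qed

lemma divergence_scale:
  assumes X: "X \<in> C1_vector_fields A"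
  shows "divergence A g (\<lambda>x. a *\<^sub>R X x) x = a * divergence A g X x"
proof -
  obtain c where c: "c \<in> A" "x \<in> dom_of c" by (rule chart_around)
  have "flux c (\<lambda>x. a *\<^sub>R X x) i = (\<lambda>y. a * flux c X i y)" for i
    by (simp add: fun_eq_iff local_rep_def scaleR_fun_def)
  then have "frechet_derivative (flux c (\<lambda>x. a *\<^sub>R X x) i) (at (coord c x)) w =
      a * frechet_derivative (flux c X i) (at (coord c x)) w" for i w
    by (simp only: frechet_derivative_at[OF has_derivative_mult_right[OF flux_has_derivative[OF X c]],
          symmetric])
  then show ?thesis
    by (simp only: divergence_eq[OF X c] divergence_eq[OF C1_scale[OF Cinf_const X] c]
        chart_divergence_def sum_distrib_left[symmetric] times_divide_eq_right)
qed

end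

section \<open>Vector fields in a Hilbert space\<close>

locale hilbert_of_fields = closed_riemannian_manifold A g vol + hilbert_on H ip
  for A :: "('m::{t2_space, second_countable_topology}, 'n::finite) chart set"
    and g :: "('m, 'n) metric" and vol
    and H :: "('m \<Rightarrow> ('m, 'n) tvec) set" and ip +
  fixes \<rho> :: "'m \<Rightarrow> real"
  assumes included: "continuously_included_in_C1 A H ip"
    and \<rho>: "\<rho> \<in> smooth_functions A"
begin

abbreviation continuity :: "('m \<Rightarrow> ('m, 'n) tvec) \<Rightarrow> 'm \<Rightarrow> real" where
  "continuity \<equiv> continuity_op A g \<rho>"

abbreviation velocity :: "('m \<Rightarrow> real) \<Rightarrow> 'm \<Rightarrow> ('m, 'n) tvec" where
  "velocity f \<equiv> I_adj A g vol H ip \<rho> (grad A g f)"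

lemma H_C1: "v \<in> H \<Longrightarrow> v \<in> C1_vector_fields A"
  using included by (auto simp: continuously_included_in_C1_def)

lemma \<rho>_H_C1: "v \<in> H \<Longrightarrow> (\<lambda>x. \<rho> x *\<^sub>R v x) \<in> C1_vector_fields A"
  using C1_scale[OF \<rho>] H_C1 by blast

lemma continuity_continuous: "v \<in> H \<Longrightarrow> continuous_on UNIV (continuity v)"
  using continuous_divergence[OF \<rho>_H_C1]
  by (simp add: continuity_op_def fun_Compl_def continuous_on_minus)

lemma continuity_add:
  assumes "v \<in> H" "w \<in> H"
  shows "continuity (v + w) = continuity v + continuity w"
proof -
  have "(\<lambda>x. \<rho> x *\<^sub>R (v + w) x) = (\<lambda>x. \<rho> x *\<^sub>R v x + \<rho> x *\<^sub>R w x)"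
    by (simp only: plus_fun_apply scaleR_add_right)
  moreover have "divergence A g (\<lambda>x. \<rho> x *\<^sub>R v x + \<rho> x *\<^sub>R w x) =
      divergence A g (\<lambda>x. \<rho> x *\<^sub>R v x) + divergence A g (\<lambda>x. \<rho> x *\<^sub>R w x)"
    using divergence_add[OF \<rho>_H_C1[OF assms(1)] \<rho>_H_C1[OF assms(2)]]
    by (intro ext) (simp only: plus_fun_apply)
  ultimately show ?thesis
    by (simp only: continuity_op_def minus_add_distrib)
qed

lemma continuity_scale:
  assumes "v \<in> H"
  shows "continuity (a *\<^sub>R v) = a *\<^sub>R continuity v"
proof -
  have "(\<lambda>x. \<rho> x *\<^sub>R (a *\<^sub>R v) x) = (\<lambda>x. a *\<^sub>R (\<rho> x *\<^sub>R v x))"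
    by (simp only: scaleR_fun_apply scaleR_scaleR mult.commute)
  moreover have "divergence A g (\<lambda>x. a *\<^sub>R (\<rho> x *\<^sub>R v x)) = a *\<^sub>R divergence A g (\<lambda>x. \<rho> x *\<^sub>R v x)"
    using divergence_scale[OF \<rho>_H_C1[OF assms], of a]
    by (intro ext) (simp only: scaleR_fun_apply real_scaleR_def)
  ultimately show ?thesis
    by (simp only: continuity_op_def scaleR_minus_right)
qed

text \<open>
  Everything rests on this form of the divergence theorem: it turns the \<open>L\<^sup>2\<close> product against a
  gradient into a quantity that is visibly linear in both arguments.
\<close>

lemma L2_inner_grad:
  assumes f: "f \<in> Cinf" and v: "v \<in> H"
  shows "L2_inner g vol \<rho> (grad A g f) v = pairing vol f (continuity v)"
proof -
  have "L2_inner g vol \<rho> (grad A g f) v = (\<integral>x. g x (grad A g f x) (\<rho> x *\<^sub>R v x) \<partial>vol)"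
    using g_scale_right[OF C1_field_mem[OF H_C1[OF v]] grad_mem[OF f]]
    by (simp add: L2_inner_def mult.commute)
  also have "\<dots> = pairing vol f (continuity v)"
    using divergence_theorem[OF \<rho>_H_C1[OF v] f]
    by (simp add: pairing_def continuity_op_def)
  finally show ?thesis .
qed

lemma integrable_pairing:
  assumes "f \<in> Cinf" "v \<in> H"
  shows "integrable vol (\<lambda>x. f x * continuity v x)"
  using assms
  by (intro continuous_imp_integrable continuous_on_mult Cinf_continuous continuity_continuous)

lemma grad_L2:
  assumes f: "f \<in> Cinf"
  shows "grad A g f \<in> L2_vector_fields A g vol \<rho>"
proof -
  note cont = continuous_field_grad[OF f]
  have "integrable vol (\<lambda>x. g x (grad A g f x) (grad A g f x) * \<rho> x)"
    using continuous_inner_fields[OF cont cont] Cinf_continuous[OF \<rho>]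
    by (intro continuous_imp_integrable continuous_on_mult)
  then show ?thesis
    using cont borel_measurable_continuous_on_restrict
    by (auto simp: L2_vector_fields_def continuous_field_def)
qed

text \<open>
  The inclusion into the \<open>C\<^sup>1\<close> vector fields bounds the components of \<open>v\<close> on compact parts of single
  charts; finitely many of them cover the manifold.
\<close>

lemma pointwise_bound:
  assumes u: "continuous_field u"
  shows "\<exists>C. \<forall>v\<in>H. \<forall>x. \<bar>g x (u x) (v x)\<bar> \<le> C * nrm v"
proof -
  have "\<exists>V C. open V \<and> x \<in> V \<and> (\<forall>v\<in>H. \<forall>y\<in>V. \<bar>g y (u y) (v y)\<bar> \<le> C * nrm v)" for x
  proof -
    obtain c r where c: "c \<in> A" "x \<in> dom_of c" and r: "0 < r"
      and K: "compact (chart_inv c ` cball (coord c x) r)"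
        "chart_inv c ` cball (coord c x) r \<subseteq> dom_of c \<inter> UNIV"
      and V: "open (chart_inv c ` ball (coord c x) r)"
      by (rule compact_neighbourhood[OF open_UNIV UNIV_I])
    let ?K = "chart_inv c ` cball (coord c x) r" and ?V = "chart_inv c ` ball (coord c x) r"
    have KD: "?K \<subseteq> dom_of c" using K(2) by simp
    obtain C where C: "\<And>v y. v \<in> H \<Longrightarrow> y \<in> ?K \<Longrightarrow> norm (v y c) \<le> C * nrm v"
      using included c(1) K(1) KD unfolding continuously_included_in_C1_def by metis
    have "compact ((\<lambda>y. gram A g c y *v u y c) ` ?K)"
      by (intro compact_continuous_image continuous_on_subset[OF continuous_field_gram[OF u c(1)] KD] K)
    then obtain D where D: "\<And>y. y \<in> ?K \<Longrightarrow> norm (gram A g c y *v u y c) \<le> D"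
      using compact_imp_bounded bounded_iff by (metis (no_types, lifting) imageI)
    have "\<bar>g y (u y) (v y)\<bar> \<le> C * D * nrm v" if v: "v \<in> H" and y: "y \<in> ?V" for v y
    proof -
      have y': "y \<in> ?K" using y ball_subset_cball by blast
      have "\<bar>g y (u y) (v y)\<bar> = \<bar>v y c \<bullet> (gram A g c y *v u y c)\<bar>"
        using g_coord[OF c(1), of y "u y" "v y"] y' KD u C1_field_mem[OF H_C1[OF v]]
        by (auto simp: continuous_field_def vector_fields_def)
      also have "\<dots> \<le> norm (v y c) * norm (gram A g c y *v u y c)"
        by (rule Cauchy_Schwarz_ineq2)
      also have "\<dots> \<le> (C * nrm v) * D"
        using C[OF v y'] D[OF y'] by (intro mult_mono) (auto intro: order_trans[OF norm_ge_zero])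
      finally show ?thesis by (simp add: mult_ac)
    qed
    moreover have "x \<in> ?V"
      using r c by (intro image_eqI[of _ _ "coord c x"]) auto
    ultimately show ?thesis using V by blast
  qed
  then obtain V C where V: "\<And>x. open (V x)" "\<And>x. x \<in> V x"
    and C: "\<And>x v y. v \<in> H \<Longrightarrow> y \<in> V x \<Longrightarrow> \<bar>g y (u y) (v y)\<bar> \<le> C x * nrm v"
    by metis
  obtain I where I: "finite I" "UNIV \<subseteq> (\<Union>x\<in>I. V x)"
    by (rule compactE_image[OF compact_M, of UNIV V]) (use V in auto)
  have "\<bar>g y (u y) (v y)\<bar> \<le> (\<Sum>x\<in>I. \<bar>C x\<bar>) * nrm v" if v: "v \<in> H" for v y
  proof -
    obtain x where x: "x \<in> I" "y \<in> V x" using I(2) by blast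
    have "C x \<le> (\<Sum>x\<in>I. \<bar>C x\<bar>)"
      using member_le_sum[OF x(1), of "\<lambda>x. \<bar>C x\<bar>"] I(1) by simp
    then have "C x * nrm v \<le> (\<Sum>x\<in>I. \<bar>C x\<bar>) * nrm v"
      using nrm_nonneg[OF v] by (rule mult_right_mono)
    then show ?thesis using C[OF v x(2)] by linarith
  qed
  then show ?thesis by blast
qed

lemma L2_inner_bound:
  assumes f: "f \<in> Cinf"
  shows "\<exists>C. \<forall>v\<in>H. \<bar>L2_inner g vol \<rho> (grad A g f) v\<bar> \<le> C * nrm v"
proof -
  obtain C where C: "\<And>v x. v \<in> H \<Longrightarrow> \<bar>g x (grad A g f x) (v x)\<bar> \<le> C * nrm v"
    using pointwise_bound[OF continuous_field_grad[OF f]] by blast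
  have "\<bar>L2_inner g vol \<rho> (grad A g f) v\<bar> \<le> (C * (\<integral>x. \<bar>\<rho> x\<bar> \<partial>vol)) * nrm v" if v: "v \<in> H" for v
  proof -
    have "continuous_on UNIV (\<lambda>x. g x (grad A g f x) (v x) * \<rho> x)"
      by (intro continuous_on_mult continuous_inner_fields continuous_field_grad f
          C1_continuous_field H_C1 v Cinf_continuous \<rho>)
    then have i: "integrable vol (\<lambda>x. g x (grad A g f x) (v x) * \<rho> x)"
      by (rule continuous_imp_integrable)
    have "continuous_on UNIV (\<lambda>x. C * nrm v * \<bar>\<rho> x\<bar>)"
      by (intro continuous_on_mult continuous_on_const continuous_on_rabs Cinf_continuous \<rho>)
    then have j: "integrable vol (\<lambda>x. C * nrm v * \<bar>\<rho> x\<bar>)"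
      by (rule continuous_imp_integrable)
    have "\<bar>L2_inner g vol \<rho> (grad A g f) v\<bar> \<le> (\<integral>x. \<bar>g x (grad A g f x) (v x) * \<rho> x\<bar> \<partial>vol)"
      unfolding L2_inner_def by (rule integral_abs_bound)
    also have "\<dots> \<le> (\<integral>x. C * nrm v * \<bar>\<rho> x\<bar> \<partial>vol)"
      using C[OF v] by (intro integral_mono integrable_abs i j) (simp add: abs_mult mult_right_mono)
    also have "\<dots> = (C * (\<integral>x. \<bar>\<rho> x\<bar> \<partial>vol)) * nrm v"
      by (simp add: mult_ac)
    finally show ?thesis .
  qed
  then show ?thesis by blast
qed

text \<open>Riesz representation shows that the adjoint takes the gradient to an actual element of \<open>H\<close>.\<close>

lemma velocity:
  assumes f: "f \<in> Cinf"
  shows "velocity f \<in> H" and "v \<in> H \<Longrightarrow> ip (velocity f) v = pairing vol f (continuity v)"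
proof -
  obtain C where C: "\<And>v. v \<in> H \<Longrightarrow> \<bar>L2_inner g vol \<rho> (grad A g f) v\<bar> \<le> C * nrm v"
    using L2_inner_bound[OF f] by blast
  have "\<exists>!w. w \<in> H \<and> (\<forall>v\<in>H. ip w v = L2_inner g vol \<rho> (grad A g f) v)"
  proof (rule riesz[OF _ _ C])
    show "L2_inner g vol \<rho> (grad A g f) (u + v) =
        L2_inner g vol \<rho> (grad A g f) u + L2_inner g vol \<rho> (grad A g f) v"
      if "u \<in> H" "v \<in> H" for u v
      using that integrable_pairing[OF f]
      by (simp add: L2_inner_grad[OF f] continuity_add pairing_def distrib_left)
    show "L2_inner g vol \<rho> (grad A g f) (a *\<^sub>R u) = a * L2_inner g vol \<rho> (grad A g f) u"
      if "u \<in> H" for a u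
      using that
      by (simp add: L2_inner_grad[OF f] continuity_scale pairing_def scaleR_fun_apply
          mult.left_commute[of _ a])
  qed
  from theI'[OF this] show "velocity f \<in> H" "v \<in> H \<Longrightarrow> ip (velocity f) v = pairing vol f (continuity v)"
    using grad_L2[OF f] L2_inner_grad[OF f] by (simp_all add: I_adj_def hilbert_adjoint_def)
qed

lemma velocity_eqI:
  assumes "f \<in> Cinf" "w \<in> H" "\<And>v. v \<in> H \<Longrightarrow> ip w v = pairing vol f (continuity v)"
  shows "velocity f = w"
proof -
  have "ip (velocity f - w) (velocity f - w) = 0"
    using assms velocity[OF assms(1)] by (simp add: ip_diff_left)
  then show ?thesis
    using ip_eq_0_iff[of "velocity f - w"] velocity(1)[OF assms(1)] assms(2) by simp
qed

text \<open>
  A field orthogonal to all velocities has a continuity operator that integrates to zero against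
  every smooth function, so the kernel of that operator is the orthogonal complement of the
  velocities.
\<close>

sublocale covector_completion H ip Cinf velocity continuity "cotangent_form A g vol H ip \<rho>"
proof
  show "subspace Cinf" by (rule subspace_Cinf)
  show "velocity f \<in> H" if "f \<in> Cinf" for f
    using velocity(1)[OF that] .
  show "velocity (f + h) = velocity f + velocity h" if f: "f \<in> Cinf" and h: "h \<in> Cinf" for f h
  proof (rule velocity_eqI)
    show "f + h \<in> Cinf" using subspace_add[OF subspace_Cinf] f h by blast
    show "ip (velocity f + velocity h) v = pairing vol (f + h) (continuity v)" if v: "v \<in> H" for v
      using v f h integrable_pairing[OF f v] integrable_pairing[OF h v]
      by (simp add: ip_add_left velocity pairing_def distrib_right)
  qed (use velocity(1) f h in auto)
  show "velocity (a *\<^sub>R f) = a *\<^sub>R velocity f" if f: "f \<in> Cinf" for a f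
  proof (rule velocity_eqI)
    show "a *\<^sub>R f \<in> Cinf" using subspace_scale[OF subspace_Cinf] f by blast
    show "ip (a *\<^sub>R velocity f) v = pairing vol (a *\<^sub>R f) (continuity v)" if v: "v \<in> H" for v
      using v f by (simp add: ip_scale_left velocity pairing_def scaleR_fun_apply mult.assoc)
  qed (use velocity(1) f in auto)
  show "continuity v = 0 \<longleftrightarrow> (\<forall>f\<in>Cinf. ip (velocity f) v = 0)" if v: "v \<in> H" for v
  proof
    assume "continuity v = 0"
    then show "\<forall>f\<in>Cinf. ip (velocity f) v = 0"
      using v by (simp add: velocity pairing_def)
  next
    assume orth: "\<forall>f\<in>Cinf. ip (velocity f) v = 0"
    have "continuity v x = 0" for x
    proof (rule eq_0_of_smooth_test_functions[of UNIV])
      show "(\<integral>y. \<phi> y * continuity v y \<partial>vol) = 0" if "\<phi> \<in> Cinf" for \<phi>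
        using orth that velocity(2)[OF that v] by (simp add: pairing_def)
    qed (simp_all add: continuity_continuous[OF v])
    then show "continuity v = 0" by (simp add: fun_eq_iff)
  qed
qed (simp_all add: cotangent_form_def continuity_add continuity_scale)

end

section \<open>The isometry\<close>

theorem theorem6p1:
  fixes A :: "('m::{t2_space, second_countable_topology}, 'n::finite) chart set"
    and g :: "('m, 'n) metric"
    and vol :: "'m measure"
    and k :: "('m, 'n) tkernel"
    and H :: "('m \<Rightarrow> ('m, 'n) tvec) set"
    and ip :: "('m \<Rightarrow> ('m, 'n) tvec) \<Rightarrow> ('m \<Rightarrow> ('m, 'n) tvec) \<Rightarrow> real"
    and \<rho> :: "'m \<Rightarrow> real"
  assumes "compact (UNIV :: 'm set)" and "connected (UNIV :: 'm set)"
    and "oriented_atlas A"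
    and "riemannian_metric A g"
    and "riemannian_volume A g vol"
    and "smooth_pos_def_kernel A g k"
    and "rkhs_of_kernel A g k H ip"
    and "continuously_included_in_C1 A H ip"
    and "\<rho> \<in> smooth_pos_densities A vol"
  defines "Cinf \<equiv> smooth_functions A"
    and "form \<equiv> cotangent_form A g vol H ip \<rho>"
  shows "(\<exists>!K. K \<in> extensional (hilbert_completion Cinf form) \<and>
            isometric_iso_from_completion Cinf form (T_S A g H \<rho>) (T_S_norm A g H ip \<rho>) K \<and>
            (\<forall>f\<in>Cinf. K (completion_embed Cinf form f) = K_S A g vol H ip \<rho> f)) \<and>
         (\<forall>f\<in>Cinf.
            B_S A g vol H ip \<rho> f \<in> H \<and>
            continuity_op A g \<rho> (B_S A g vol H ip \<rho> f) = K_S A g vol H ip \<rho> f \<and>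
            (\<forall>v\<in>H. continuity_op A g \<rho> v = K_S A g vol H ip \<rho> f \<longrightarrow> v \<noteq> B_S A g vol H ip \<rho> f \<longrightarrow>
               semi_norm ip (B_S A g vol H ip \<rho> f) < semi_norm ip v)) \<and>
         (\<forall>f\<in>Cinf. \<forall>h\<in>Cinf. pairing vol f (K_S A g vol H ip \<rho> h) = form f h)"
proof -
  interpret hilbert_of_fields A g vol H ip \<rho>
    by unfold_locales (use assms in \<open>auto simp: rkhs_of_kernel_def smooth_pos_densities_def\<close>)
  have TS: "T_S A g H \<rho> = continuity ` H"
    by (auto simp: T_S_def)
  have norm: "T_S_norm A g H ip \<rho> = quotient_norm"
    by (simp add: fun_eq_iff T_S_norm_def quotient_norm_def)
  have K: "K_S A g vol H ip \<rho> f = continuity (velocity f)" for f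
    by (simp add: K_S_def)
  have B: "B_S A g vol H ip \<rho> f = velocity f" for f
    by (simp add: B_S_def)
  have "\<forall>v\<in>H. continuity v = continuity (velocity f) \<longrightarrow> v \<noteq> velocity f \<longrightarrow> nrm (velocity f) < nrm v"
    if "f \<in> smooth_functions A" for f
    using nrm_less_of_range_closure[OF B_range_closure[OF that]] by blast
  moreover have "pairing vol f (continuity (velocity h)) = cotangent_form A g vol H ip \<rho> f h"
    if "f \<in> smooth_functions A" "h \<in> smooth_functions A" for f h
    using velocity(2)[OF that(1) velocity(1)[OF that(2)]] by (simp add: cotangent_form_def)
  ultimately show ?thesis
    unfolding Cinf_def form_def TS norm K B
    by (intro conjI unique_isometric_extension ballI velocity(1) refl) simp_all
qed

end
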